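(* Let $d\in\mathbb{N}$, let $C\in\mathbb{R}^{d\times d}$ be symmetric and positive definite, and let $\bar\Phi\colon \mathbb{S}^{d-1}\to\mathbb{R}$ be measurable and uniformly bounded. Let $\mu$ be the probability measure on $\mathbb{S}^{d-1}$ given by $\frac{\mathrm{d}\mu}{\mathrm{d}\mu_0}(\bar x)\propto \exp(-\bar\Phi(\bar x))$, where $\mu_0=\mathrm{ACG}(C)$. Then the transition kernels corresponding to the Markov chains on $\mathbb{S}^{d-1}$ realised by (i) the reprojected pCN-MH algorithm targeting $\mu$ (with any step size $s\in(0,1]$), and (ii) the reprojected elliptical slice sampling (ESS) algorithm targeting $\mu$ are uniformly ergodic. That is, for each such transition kernel $\bar K$ there exist $\kappa\in[0,1)$ and $c<\infty$ such that $\|\bar K^n(\bar x,\cdot)-\mu\|_{\mathrm{TV}}\le c\,\kappa^n$ for all $n\in\mathbb{N}$ and all $\bar x\in\mathbb{S}^{d-1}$.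
   Context: $\mathbb{S}^{d-1}=\{x\in\mathbb{R}^d:\|x\|=1\}$ (Euclidean norm), with its Borel $\sigma$-algebra. The radial projection $\Pi\colon\mathbb{R}^d\to\mathbb{S}^{d-1}$ is $\Pi(x)=x/\|x\|$ for $x\neq0$ and $\Pi(0)=\bar z$, where $\bar z\in\mathbb{S}^{d-1}$ is fixed and arbitrary. $\mathrm{ACG}(C)$ is the push-forward of the centred Gaussian measure $\mathrm{N}(0,C)$ under $\Pi$. Put $\Phi(x)=\bar\Phi(\Pi(x))$ for $x\in\mathbb{R}^d$. $\mathrm{U}[a,b]$ is the uniform distribution on $[a,b]$, and $\mathrm{Gam}(a,b)$ is the Gamma distribution with shape $a>0$ and inverse scale (rate) $b>0$. $\|\xi-\mu\|_{\mathrm{TV}}=\sup_A|\xi(A)-\mu(A)|$ over Borel sets $A$. $\bar K^n$ is the $n$-step transition kernel. All random draws below are independent of one another, given the quantities their distributions depend on. Reprojected pCN-MH algorithm, one transition from $\bar x\in\mathbb{S}^{d-1}$ with step size $s\in(0,1]$: draw $r\ge0$ with $r^2\sim\mathrm{Gam}(d/2,\tfrac12\bar x^\top C^{-1}\bar x)$ and set $x=r\bar x$; draw $w\sim\mathrm{N}(0,C)$ and set $y=\sqrt{1-s^2}\,x+s\,w$, $\bar y=\Pi(y)$; draw $u\sim\mathrm{U}[0,1]$; the next state is $\bar y$ if $u\le\min\{1,\exp(\bar\Phi(\bar x)-\bar\Phi(\bar y))\}$, and $\bar x$ otherwise. Reprojected ESS algorithm, one transition from $\bar x\in\mathbb{S}^{d-1}$: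 draw $t\sim\mathrm{U}[0,\exp(-\bar\Phi(\bar x))]$; draw $r\ge0$ with $r^2\sim\mathrm{Gam}(d/2,\tfrac12\bar x^\top C^{-1}\bar x)$ and set $x=r\bar x$; let $y=\text{shrink-ellipse}(x,t)$; the next state is $\Pi(y)$. Procedure shrink-ellipse$(x,t)$, with output a state $y$ in the level set $\{z\in\mathbb{R}^d:\exp(-\Phi(z))\ge t\}$: draw $w\sim\mathrm{N}(0,C)$ and $\theta\sim\mathrm{U}[0,2\pi]$; set $\theta_{\min}=\theta-2\pi$, $\theta_{\max}=\theta$, and $y=\cos(\theta)x+\sin(\theta)w$. While $\exp(-\Phi(y))<t$: if $\theta<0$ set $\theta_{\min}=\theta$, otherwise set $\theta_{\max}=\theta$; then draw a new $\theta\sim\mathrm{U}[\theta_{\min},\theta_{\max}]$ and set $y=\cos(\theta)x+\sin(\theta)w$. Output $y$.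
   Formalization: On the event that the while loop of shrink-ellipse(x,t) never terminates (possible for exceptional starting points, e.g. when the level set is a single ray), where the procedure as written has no output, the output is taken to be x. *)

theory Defs
  imports "HOL-Probability.Probability"
begin

definition sphere_borel :: "(real ^ 'n) measure" where
  "sphere_borel = restrict_space borel (sphere 0 1)"

definition radial_proj :: "real ^ 'n \<Rightarrow> real ^ 'n \<Rightarrow> real ^ 'n" where
  "radial_proj zbar x = (if x = 0 then zbar else x /\<^sub>R norm x)"

definition sym_pos_def :: "real ^ 'n ^ 'n \<Rightarrow> bool" where
  "sym_pos_def C \<longleftrightarrow> transpose C = C \<and> (\<forall>x. x \<noteq> 0 \<longrightarrow> x \<bullet> (C *v x) > 0)"

(* The centred Gaussian N(0, C), for positive definite C. *)
definition gaussian :: "real ^ 'n ^ 'n \<Rightarrow> (real ^ 'n) measure" where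
  "gaussian C = density lborel (\<lambda>x. ennreal
     (exp (- (x \<bullet> (matrix_inv C *v x)) / 2) / sqrt ((2 * pi) ^ CARD('n) * det C)))"

definition ACG :: "real ^ 'n \<Rightarrow> real ^ 'n ^ 'n \<Rightarrow> (real ^ 'n) measure" where
  "ACG zbar C = distr (gaussian C) sphere_borel (radial_proj zbar)"

definition target :: "real ^ 'n \<Rightarrow> real ^ 'n ^ 'n \<Rightarrow> (real ^ 'n \<Rightarrow> real) \<Rightarrow> (real ^ 'n) measure" where
  "target zbar C \<Phi> = density (ACG zbar C)
     (\<lambda>x. ennreal (exp (- \<Phi> x) / (LINT z | ACG zbar C. exp (- \<Phi> z))))"

(* Shape a and rate b. *)
definition gamma_dist :: "real \<Rightarrow> real \<Rightarrow> real measure" where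
  "gamma_dist a b = density lborel (\<lambda>x. ennreal
     (if x > 0 then b powr a / Gamma a * x powr (a - 1) * exp (- b * x) else 0))"

abbreviation uniform_dist :: "real \<Rightarrow> real \<Rightarrow> real measure" where
  "uniform_dist a b \<equiv> uniform_measure lborel {a..b}"

(* The law of r^2 given the current state x on the sphere. *)
definition radius_sq_dist :: "real ^ 'n ^ 'n \<Rightarrow> real ^ 'n \<Rightarrow> real measure" where
  "radius_sq_dist C x = gamma_dist (real CARD('n) / 2) ((x \<bullet> (matrix_inv C *v x)) / 2)"

definition pcn_kernel ::
  "real ^ 'n \<Rightarrow> real ^ 'n ^ 'n \<Rightarrow> (real ^ 'n \<Rightarrow> real) \<Rightarrow> real \<Rightarrow> real ^ 'n \<Rightarrow> (real ^ 'n) measure" where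
  "pcn_kernel zbar C \<Phi> s xbar = do {
     r2 \<leftarrow> radius_sq_dist C xbar;
     let x = sqrt r2 *\<^sub>R xbar;
     w \<leftarrow> gaussian C;
     let y = sqrt (1 - s\<^sup>2) *\<^sub>R x + s *\<^sub>R w;
     let ybar = radial_proj zbar y;
     u \<leftarrow> uniform_dist 0 1;
     return sphere_borel (if u \<le> min 1 (exp (\<Phi> xbar - \<Phi> ybar)) then ybar else xbar)
   }"

(* The shrinking loop for a function \<Phi> on the whole space, started at angle \<theta> with bracket
   [a, b] and cut off after k tests of the loop condition. A run that is cut off contributes
   no mass: this is the sub-probability law of the output on the event that at most k tests are
   needed. *)
primrec shrink_loop ::
  "(real ^ 'n \<Rightarrow> real) \<Rightarrow> real ^ 'n \<Rightarrow> real \<Rightarrow> real ^ 'n \<Rightarrow> nat \<Rightarrow> real \<Rightarrow> real \<Rightarrow> real \<Rightarrow> (real ^ 'n) measure"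
where
  "shrink_loop \<Phi> x t w 0 \<theta> a b = null_measure borel"
| "shrink_loop \<Phi> x t w (Suc k) \<theta> a b =
     (let y = cos \<theta> *\<^sub>R x + sin \<theta> *\<^sub>R w;
          a' = (if \<theta> < 0 then \<theta> else a);
          b' = (if \<theta> < 0 then b else \<theta>)
      in if exp (- \<Phi> y) < t
         then uniform_dist a' b' \<bind> (\<lambda>\<theta>'. shrink_loop \<Phi> x t w k \<theta>' a' b')
         else return borel y)"

definition shrink_ellipse_upto ::
  "real ^ 'n ^ 'n \<Rightarrow> (real ^ 'n \<Rightarrow> real) \<Rightarrow> nat \<Rightarrow> real ^ 'n \<Rightarrow> real \<Rightarrow> (real ^ 'n) measure" where
  "shrink_ellipse_upto C \<Phi> k x t = do {
     w \<leftarrow> gaussian C;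
     \<theta> \<leftarrow> uniform_dist 0 (2 * pi);
     shrink_loop \<Phi> x t w k \<theta> (\<theta> - 2 * pi) \<theta>
   }"

(* The supremum over k is the law of the output on the event that the loop terminates.
   If \<Phi> is merely measurable, there can be exceptional starting points x from which the loop
   runs forever with positive probability, e.g. when the level set is a single ray. On that
   event the brackets almost surely shrink to the angle 0, which corresponds to the point x of
   the level set, and the output is taken to be x. *)
definition shrink_ellipse ::
  "real ^ 'n ^ 'n \<Rightarrow> (real ^ 'n \<Rightarrow> real) \<Rightarrow> real ^ 'n \<Rightarrow> real \<Rightarrow> (real ^ 'n) measure" where
  "shrink_ellipse C \<Phi> x t = measure_of UNIV (sets borel) (\<lambda>A.
     (SUP k. emeasure (shrink_ellipse_upto C \<Phi> k x t) A)
     + (1 - (SUP k. emeasure (shrink_ellipse_upto C \<Phi> k x t) UNIV)) * indicator A x)"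

definition ess_kernel ::
  "real ^ 'n \<Rightarrow> real ^ 'n ^ 'n \<Rightarrow> (real ^ 'n \<Rightarrow> real) \<Rightarrow> real ^ 'n \<Rightarrow> (real ^ 'n) measure" where
  "ess_kernel zbar C \<Phi> xbar = do {
     t \<leftarrow> uniform_dist 0 (exp (- \<Phi> xbar));
     r2 \<leftarrow> radius_sq_dist C xbar;
     let x = sqrt r2 *\<^sub>R xbar;
     y \<leftarrow> shrink_ellipse C (\<lambda>z. \<Phi> (radial_proj zbar z)) x t;
     return sphere_borel (radial_proj zbar y)
   }"

definition tv_dist :: "'a measure \<Rightarrow> 'a measure \<Rightarrow> real" where
  "tv_dist \<xi> \<mu> = (SUP A \<in> sets \<mu>. \<bar>measure \<xi> A - measure \<mu> A\<bar>)"

primrec kernel_power :: "'a measure \<Rightarrow> ('a \<Rightarrow> 'a measure) \<Rightarrow> nat \<Rightarrow> 'a \<Rightarrow> 'a measure" where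
  "kernel_power S K 0 x = return S x"
| "kernel_power S K (Suc n) x = kernel_power S K n x \<bind> K"

definition uniformly_ergodic :: "'a measure \<Rightarrow> ('a \<Rightarrow> 'a measure) \<Rightarrow> 'a measure \<Rightarrow> bool" where
  "uniformly_ergodic S K \<mu> \<longleftrightarrow> (\<exists>\<kappa> c :: real. 0 \<le> \<kappa> \<and> \<kappa> < 1 \<and>
     (\<forall>n. \<forall>x \<in> space S. tv_dist (kernel_power S K n x) \<mu> \<le> c * \<kappa> ^ n))"

end

theory Submission
  imports Defs
begin

text \<open>Both kernels \<open>K\<close> leave the target \<open>\<mu>\<close> invariant and dominate a multiple \<open>\<beta> \<mu>\<close> of it, uniformly in the
  current state; by induction \<open>K\<^sup>n\<close> then dominates \<open>(1 - (1 - \<beta>)\<^sup>n) \<mu>\<close>, which gives the rate \<open>1 - \<beta>\<close>.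

  For the minorization, write \<open>q(x) = x \<bullet> C\<^sup>-\<^sup>1 x\<close>. The inequality \<open>q(u - v) \<le> 2 q(u) + 2 q(v)\<close> bounds the
  law of \<open>c x + s w\<close> from below by \<open>exp (- (c/s)\<^sup>2 q(x))\<close> times a centred Gaussian, whose projection is
  \<open>\<mu>\<^sub>0\<close>. Averaged over the Gamma law of the radius, this factor does not depend on the direction of \<open>x\<close>.
  In ESS, a level below \<open>exp (- sup \<bar>\<Phi>\<bar>)\<close> accepts the first proposal.

  Invariance is transported from the whole space, because direction and Gamma radius together have
  law \<open>N(0, C)\<close>. There, pCN is reversible since \<open>N(0, C) \<otimes> N(0, C)\<close> is invariant under reflections of the pair
  \<open>(x, w)\<close>. For ESS, the invariance under rotations of \<open>(x, w)\<close> reduces the claim to the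
  reversibility of the shrinking procedure on a fixed ellipse.\<close>

section \<open>Minorization and uniform ergodicity\<close>

text \<open>Invariance does real work beside the minorization: it fixes the
  \<open>\<mu>\<close>-integral of the nonnegative remainder
  \<open>K y A - \<beta> * \<mu> A\<close> at \<open>(1 - \<beta>) * \<mu> A\<close>, so the
  induction contracts towards \<open>\<mu>\<close> itself. The obstacle in ESS is that
  \<open>\<Phi>\<close> is only measurable, so the loop may fail to stop from some points. No
  termination is proved. For every \<open>k\<close>, the runs that stop within \<open>k\<close>
  tests satisfy a balance on each level set: the mass they deliver to a set equals the mass of those
  that started in it. Monotone convergence carries this to the supremum, and the missing mass sits
  at the starting point, where it cannot disturb the balance. A second difficulty is that the first
  proposal is special: it ranges over a full turn and determines the bracket. Runs are therefore
  split at it. If it is accepted, a reflection of the Gaussian pair exchanges start and output; if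
  it is rejected, a rotation by its angle fixes the bracket and spreads the starting angle uniformly
  over it, which is the one-dimensional situation.\<close>

lemma nn_integral_mono_scaled:
  assumes s: "sets M = sets N"
    and le: "\<And>A. A \<in> sets N \<Longrightarrow> c * emeasure M A \<le> emeasure N A"
    and f: "f \<in> borel_measurable N"
  shows "c * (\<integral>\<^sup>+x. f x \<partial>M) \<le> (\<integral>\<^sup>+x. f x \<partial>N)"
proof -
  have fM: "f \<in> borel_measurable M" using f s measurable_cong_sets by blast
  have "c * (\<integral>\<^sup>+x. f x \<partial>M) = (\<integral>\<^sup>+x. f x \<partial>scale_measure c M)"
    using fM by (simp add: nn_integral_scale_measure)
  also have "\<dots> \<le> (\<integral>\<^sup>+x. f x \<partial>N)"
  proof (rule nn_integral_mono_measure)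
    show "scale_measure c M \<le> N"
      using s le by (subst le_measure) (auto simp: le_fun_def emeasure_notin_sets)
    show "sets (scale_measure c M) = sets N" using s by simp
  qed
  finally show ?thesis .
qed

text \<open>Split \<open>K y\<close> into \<open>\<beta> * \<mu>\<close> and a nonnegative
  remainder. The lower bound for the \<open>n\<close>-step law is applied to the remainder as a
  function of \<open>y\<close>, which turns \<open>\<kappa> ^ n\<close> into
  \<open>\<kappa> ^ Suc n\<close>.\<close>

lemma uniformly_ergodic_doeblin:
  assumes K: "K \<in> S \<rightarrow>\<^sub>M prob_algebra S"
    and mu: "prob_space \<mu>" and smu: "sets \<mu> = sets S"
    and inv: "\<And>A. A \<in> sets S \<Longrightarrow> (\<integral>\<^sup>+x. emeasure (K x) A \<partial>\<mu>) = emeasure \<mu> A"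
    and beta: "\<beta> > 0"
    and minor: "\<And>x A. x \<in> space S \<Longrightarrow> A \<in> sets S \<Longrightarrow> ennreal \<beta> * emeasure \<mu> A \<le> emeasure (K x) A"
  shows "uniformly_ergodic S K \<mu>"
proof -
  interpret mu: prob_space \<mu> by fact
  have Ks: "K \<in> S \<rightarrow>\<^sub>M subprob_algebra S" using K by (rule measurable_prob_algebraD)
  have spmu: "space \<mu> = space S" using smu by (rule sets_eq_imp_space_eq)
  have Kp: "prob_space (K x)" "sets (K x) = sets S" if "x \<in> space S" for x
    using measurable_space[OF K that] by (auto simp: space_prob_algebra)
  define \<kappa> where "\<kappa> = 1 - \<beta>"
  obtain x0 where x0: "x0 \<in> space S" using mu.not_empty spmu by auto
  \<comment> \<open>Evaluating the minorization on the whole space compares \<open>\<beta>\<close>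
    with total mass 1; this gives \<open>\<kappa> \<ge> 0\<close>.\<close>
  have "\<beta> \<le> 1"
  proof -
    interpret k: prob_space "K x0" using Kp x0 by auto
    have "space (K x0) = space S" using Kp(2)[OF x0] by (rule sets_eq_imp_space_eq)
    then have "ennreal \<beta> * 1 \<le> 1"
      using minor[OF x0, of "space S"] k.emeasure_space_1 mu.emeasure_space_1 spmu by auto
    then show ?thesis using beta by (metis ennreal_le_1 mult.right_neutral)
  qed
  then have kap: "0 \<le> \<kappa>" "\<kappa> < 1" using beta by (auto simp: \<kappa>_def)
  have pw: "kernel_power S K n x \<in> space (prob_algebra S)" if "x \<in> space S" for n x
  proof (induction n)
    case 0
    then show ?case using that by (auto simp: space_prob_algebra prob_space_return)
  next
    case (Suc n)
    have "(\<lambda>M. M \<bind> K) \<in> prob_algebra S \<rightarrow>\<^sub>M prob_algebra S"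
      by (rule measurable_bind_prob_space[OF measurable_ident_sets[OF refl, unfolded id_def] K])
    from measurable_space[OF this Suc] show ?case by simp
  qed
  have low: "ennreal (1 - \<kappa> ^ n) * emeasure \<mu> A \<le> emeasure (kernel_power S K n x) A"
    if x: "x \<in> space S" and A: "A \<in> sets S" for n x A
    using A
  proof (induction n arbitrary: A)
    case 0
    then show ?case by simp
  next
    case (Suc n)
    let ?N = "kernel_power S K n x"
    define m where "m = measure \<mu> A"
    have N: "prob_space ?N" "sets ?N = sets S" using pw[OF x, of n] by (auto simp: space_prob_algebra)
    interpret N: prob_space ?N by fact
    have spN: "space ?N = space S" using N(2) by (rule sets_eq_imp_space_eq)
    have m: "emeasure \<mu> A = ennreal m" by (simp add: mu.emeasure_eq_measure m_def)
    have m0: "0 \<le> m" by (simp add: m_def)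
    have KA[measurable]: "(\<lambda>y. emeasure (K y) A) \<in> borel_measurable S"
      using Ks Suc.prems by (simp add: measurable_emeasure_kernel)
    have KAN[measurable]: "(\<lambda>y. emeasure (K y) A) \<in> borel_measurable ?N"
      using KA N(2) measurable_cong_sets by blast
    have KAm[measurable]: "(\<lambda>y. emeasure (K y) A) \<in> borel_measurable \<mu>"
      using KA smu measurable_cong_sets by blast
    have mi: "ennreal (\<beta> * m) \<le> emeasure (K y) A" if "y \<in> space S" for y
      using minor[OF that Suc.prems] m beta m0 by (simp add: ennreal_mult)
    have k1: "0 \<le> 1 - \<kappa> ^ n" using kap by (simp add: power_le_one)
    \<comment> \<open>Truncated subtraction is harmless here, because \<open>mi\<close> keeps the
      difference a genuine one.\<close>
    have "(\<integral>\<^sup>+y. (emeasure (K y) A - ennreal (\<beta> * m)) \<partial>\<mu>) = emeasure \<mu> A - ennreal (\<beta> * m)"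
      using mi spmu by (subst nn_integral_diff)
        (auto simp: inv Suc.prems mu.emeasure_space_1[unfolded spmu])
    also have "\<dots> = ennreal (m - \<beta> * m)" using m0 beta by (simp add: m ennreal_minus)
    finally have i1: "(\<integral>\<^sup>+y. (emeasure (K y) A - ennreal (\<beta> * m)) \<partial>\<mu>) = ennreal (m - \<beta> * m)" .
    have "ennreal (1 - \<kappa> ^ Suc n) * emeasure \<mu> A = ennreal ((1 - \<kappa> ^ Suc n) * m)"
      using m0 unfolding m by (subst ennreal_mult'') auto
    also have "(1 - \<kappa> ^ Suc n) * m = \<beta> * m + (1 - \<kappa> ^ n) * (m - \<beta> * m)"
      by (simp add: \<kappa>_def algebra_simps)
    also have "ennreal (\<beta> * m + (1 - \<kappa> ^ n) * (m - \<beta> * m))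
        = ennreal (\<beta> * m) + ennreal (1 - \<kappa> ^ n) * ennreal (m - \<beta> * m)"
      using k1 beta m0 \<open>\<beta> \<le> 1\<close> by (simp add: ennreal_plus ennreal_mult mult_left_le_one_le)
    also have "\<dots> \<le> ennreal (\<beta> * m) + (\<integral>\<^sup>+y. (emeasure (K y) A - ennreal (\<beta> * m)) \<partial>?N)"
      unfolding i1[symmetric] using N(2) smu Suc.IH
      by (intro add_left_mono nn_integral_mono_scaled) auto
    also have "\<dots> = (\<integral>\<^sup>+y. (ennreal (\<beta> * m) + (emeasure (K y) A - ennreal (\<beta> * m))) \<partial>?N)"
      by (subst nn_integral_add) (auto simp: N.emeasure_space_1[unfolded spN] spN)
    also have "\<dots> = (\<integral>\<^sup>+y. emeasure (K y) A \<partial>?N)"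
      using mi spN by (intro nn_integral_cong) (auto simp: add_diff_inverse_ennreal)
    also have "\<dots> = emeasure (?N \<bind> K) A"
    proof (rule emeasure_bind[symmetric])
      show "K \<in> ?N \<rightarrow>\<^sub>M subprob_algebra S" using Ks N(2) measurable_cong_sets by blast
    qed (use Suc.prems x spN in auto)
    finally show ?case by simp
  qed
  have "tv_dist (kernel_power S K n x) \<mu> \<le> 1 * \<kappa> ^ n" if x: "x \<in> space S" for n x
  proof -
    let ?N = "kernel_power S K n x"
    have N: "prob_space ?N" "sets ?N = sets S" using pw[OF x, of n] by (auto simp: space_prob_algebra)
    interpret N: prob_space ?N by fact
    have spN: "space ?N = space S" using N(2) by (rule sets_eq_imp_space_eq)
    have k1: "0 \<le> 1 - \<kappa> ^ n" "0 \<le> \<kappa> ^ n" using kap by (auto simp add: power_le_one)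
    have l: "(1 - \<kappa> ^ n) * measure \<mu> A \<le> measure ?N A" if "A \<in> sets S" for A
    proof -
      have "ennreal ((1 - \<kappa> ^ n) * measure \<mu> A) \<le> ennreal (measure ?N A)"
        using low[OF x that, of n] k1
        by (simp add: mu.emeasure_eq_measure N.emeasure_eq_measure ennreal_mult)
      then show ?thesis by simp
    qed
    \<comment> \<open>The lower bound on \<open>A\<close> controls one sign of the difference, the
      lower bound on the complement the other.\<close>
    have "\<bar>measure ?N A - measure \<mu> A\<bar> \<le> \<kappa> ^ n" if A: "A \<in> sets S" for A
    proof -
      have "measure ?N (space S - A) = 1 - measure ?N A" "measure \<mu> (space S - A) = 1 - measure \<mu> A"
        using N.prob_compl[of A] mu.prob_compl[of A] A N(2) smu spN spmu by auto
      with l[of "space S - A"] A have "(1 - \<kappa> ^ n) * (1 - measure \<mu> A) \<le> 1 - measure ?N A" by auto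
      then have "measure ?N A - measure \<mu> A \<le> \<kappa> ^ n * (1 - measure \<mu> A)"
        by (simp add: algebra_simps)
      also have "\<dots> \<le> \<kappa> ^ n" using k1 by (simp add: mult_left_le)
      finally have 1: "measure ?N A - measure \<mu> A \<le> \<kappa> ^ n" .
      have "measure \<mu> A - measure ?N A \<le> \<kappa> ^ n * measure \<mu> A"
        using l[OF A] by (simp add: algebra_simps)
      also have "\<dots> \<le> \<kappa> ^ n" using k1 by (simp add: mult_left_le)
      finally show ?thesis using 1 by linarith
    qed
    then show ?thesis unfolding tv_dist_def smu by (intro cSUP_least) auto
  qed
  then show ?thesis unfolding uniformly_ergodic_def using kap by blast
qed

section \<open>Linear changes of variables in Lebesgue integrals\<close>

lemma nn_integral_lborel_affine:
  fixes t :: "'a::euclidean_space"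
  assumes [measurable]: "f \<in> borel_measurable borel" and c: "c \<noteq> 0"
  shows "(\<integral>\<^sup>+x. f x \<partial>lborel) = ennreal (\<bar>c\<bar> ^ DIM('a)) * (\<integral>\<^sup>+x. f (t + c *\<^sub>R x) \<partial>lborel)"
  by (subst lborel_affine[OF c, of t])
     (simp add: nn_integral_density nn_integral_distr nn_integral_cmult)

text \<open>As \<open>g\<close> is constant along \<open>b\<close>, integrating the
  \<open>b\<close>-coordinate innermost turns the shear into a translation of the line by a fixed
  amount.\<close>

lemma nn_integral_lborel_shear:
  fixes f :: "'a::euclidean_space \<Rightarrow> ennreal"
  assumes [measurable]: "f \<in> borel_measurable borel" and b: "b \<in> Basis"
    and g [measurable]: "g \<in> borel_measurable borel"
    and inv: "\<And>x c. g (x + c *\<^sub>R b) = g x"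
  shows "(\<integral>\<^sup>+x. f (x + g x *\<^sub>R b) \<partial>lborel) = (\<integral>\<^sup>+x. f x \<partial>lborel)"
proof -
  interpret P: product_sigma_finite "\<lambda>_::'a. lborel :: real measure" ..
  define I where "I = (Basis :: 'a set) - {b}"
  have I: "finite I" "b \<notin> I" "Basis = insert b I" using b by (auto simp: I_def)
  define e :: "('a \<Rightarrow> real) \<Rightarrow> 'a" where "e w = (\<Sum>i\<in>Basis. w i *\<^sub>R i)" for w
  have [measurable]: "e \<in> borel_measurable (PiM Basis (\<lambda>_. lborel))"
    unfolding e_def by measurable
  have [measurable]: "e \<in> borel_measurable (PiM (insert b I) (\<lambda>_. lborel))"
    unfolding I(3)[symmetric] by measurable
  have lb: "(lborel :: 'a measure) = distr (PiM Basis (\<lambda>_. lborel)) borel e"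
    unfolding lborel_def[where 'a = 'a] lborel_eq_real e_def ..
  have eq: "(\<integral>\<^sup>+x. h x \<partial>lborel) = (\<integral>\<^sup>+w. (\<integral>\<^sup>+y. h (e (w(b := y))) \<partial>lborel) \<partial>PiM I (\<lambda>_. lborel))"
    if [measurable]: "h \<in> borel_measurable borel" for h :: "'a \<Rightarrow> ennreal"
  proof -
    have "(\<integral>\<^sup>+x. h x \<partial>lborel) = (\<integral>\<^sup>+w. h (e w) \<partial>PiM Basis (\<lambda>_. lborel))"
      unfolding lb by (subst nn_integral_distr) auto
    also have "\<dots> = (\<integral>\<^sup>+w. h (e w) \<partial>PiM (insert b I) (\<lambda>_. lborel))"
      using I(3) by simp
    also have "\<dots> = (\<integral>\<^sup>+w. (\<integral>\<^sup>+y. h (e (w(b := y))) \<partial>lborel) \<partial>PiM I (\<lambda>_. lborel))"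
      by (rule P.product_nn_integral_insert) (use I in auto)
    finally show ?thesis .
  qed
  have e: "e (w(b := y)) = (\<Sum>i\<in>I. w i *\<^sub>R i) + y *\<^sub>R b" for w y
  proof -
    have "e (w(b := y)) = y *\<^sub>R b + (\<Sum>i\<in>I. (w(b := y)) i *\<^sub>R i)"
      unfolding e_def I(3) using I by (subst sum.insert) auto
    also have "(\<Sum>i\<in>I. (w(b := y)) i *\<^sub>R i) = (\<Sum>i\<in>I. w i *\<^sub>R i)"
      using I by (intro sum.cong) auto
    finally show ?thesis by (simp only: add.commute)
  qed
  have "(\<integral>\<^sup>+y. f (e (w(b := y)) + g (e (w(b := y))) *\<^sub>R b) \<partial>lborel) = (\<integral>\<^sup>+y. f (e (w(b := y))) \<partial>lborel)" for w
  proof -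
    let ?u = "\<Sum>i\<in>I. w i *\<^sub>R i"
    have [measurable]: "(\<lambda>y. f (?u + y *\<^sub>R b)) \<in> borel_measurable borel" by measurable
    have "(\<integral>\<^sup>+y. f (e (w(b := y))) \<partial>lborel) = (\<integral>\<^sup>+y. f (?u + y *\<^sub>R b) \<partial>lborel)"
      by (simp add: e)
    also have "\<dots> = (\<integral>\<^sup>+y. f (?u + (g ?u + y) *\<^sub>R b) \<partial>lborel)"
      using nn_integral_real_affine[of "\<lambda>y. f (?u + y *\<^sub>R b)" 1 "g ?u"] by simp
    finally show ?thesis by (simp add: e inv) (simp add: algebra_simps)
  qed
  then show ?thesis by (subst (1 2) eq) simp_all
qed

text \<open>The formula is multiplicative in \<open>A\<close>, so it is enough to check it on
  elementary matrices. Its use is the normalisation of \<open>N(0, C)\<close>.\<close>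

lemma nn_integral_lborel_linear:
  fixes A :: "real ^ 'n ^ 'n"
  assumes "f \<in> borel_measurable borel" "det A \<noteq> 0"
  shows "(\<integral>\<^sup>+x. f x \<partial>lborel) = ennreal \<bar>det A\<bar> * (\<integral>\<^sup>+x. f (A *v x) \<partial>lborel)"
proof -
  have vm [measurable]: "(\<lambda>x. A *v x) \<in> borel_measurable borel" for A :: "real ^ 'n ^ 'n"
    by (intro borel_measurable_continuous_onI linear_continuous_on) (simp add: bounded_linear.linear linear_linear)
  \<comment> \<open>The quantifier over \<open>f\<close> stays inside the induction: for a product,
    the hypothesis on \<open>B\<close> is used for \<open>f\<close> composed with
    \<open>A\<close>.\<close>
  have "\<forall>f :: real ^ 'n \<Rightarrow> ennreal. f \<in> borel_measurable borel \<longrightarrow> det A \<noteq> 0 \<longrightarrow>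
     (\<integral>\<^sup>+x. f x \<partial>lborel) = ennreal \<bar>det A\<bar> * (\<integral>\<^sup>+x. f (A *v x) \<partial>lborel)" (is "?P A")
  proof (induction rule: induct_matrix_elementary_alt)
    case (1 A B)
    show ?case
    proof (intro allI impI)
      fix f :: "real ^ 'n \<Rightarrow> ennreal"
      assume [measurable]: "f \<in> borel_measurable borel" and d: "det (A ** B) \<noteq> 0"
      from d have "det A \<noteq> 0" "det B \<noteq> 0" by (auto simp: det_mul)
      then have eA: "(\<integral>\<^sup>+x. f x \<partial>lborel) = ennreal \<bar>det A\<bar> * (\<integral>\<^sup>+x. f (A *v x) \<partial>lborel)"
        by (intro 1(1)[rule_format]) measurable
      have "(\<integral>\<^sup>+x. f (A *v x) \<partial>lborel) = ennreal \<bar>det B\<bar> * (\<integral>\<^sup>+x. f (A *v (B *v x)) \<partial>lborel)"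
        using \<open>det B \<noteq> 0\<close> by (intro 1(2)[rule_format]) measurable
      with eA show "(\<integral>\<^sup>+x. f x \<partial>lborel) = ennreal \<bar>det (A ** B)\<bar> * (\<integral>\<^sup>+x. f ((A ** B) *v x) \<partial>lborel)"
        by (simp only: det_mul abs_mult ennreal_mult[OF abs_ge_zero abs_ge_zero] mult.assoc matrix_vector_mul_assoc)
    qed
  next
    case (2 A i)
    then show ?case by (simp add: det_zero_row)
  next
    case (3 A)
    have dA: "det A = (\<Prod>i\<in>UNIV. A $ i $ i)" using 3 by (rule det_diagonal)
    show ?case
    proof (intro allI impI)
      fix f :: "real ^ 'n \<Rightarrow> ennreal"
      assume [measurable]: "f \<in> borel_measurable borel" and d: "det A \<noteq> 0"
      define c where "c b = b \<bullet> (A *v b)" for b :: "real ^ 'n"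
      have cax: "c (axis i 1) = A $ i $ i" for i
        by (simp add: c_def inner_axis' matrix_vector_mul_component inner_axis)
      have c0: "c j \<noteq> 0" if "j \<in> Basis" for j
        using that d dA by (auto simp: Basis_vec_def cax)
      have prod: "(\<Prod>j\<in>Basis. \<bar>c j\<bar>) = \<bar>det A\<bar>"
      proof -
        have "(\<Prod>j\<in>Basis. \<bar>c j\<bar>) = (\<Prod>j\<in>(\<lambda>i. axis i 1) ` UNIV. \<bar>c j\<bar>)"
          by (intro prod.cong) (auto simp: Basis_vec_def)
        also have "\<dots> = (\<Prod>i\<in>UNIV. \<bar>c (axis i 1)\<bar>)"
          by (subst prod.reindex) (auto simp: inj_on_def axis_eq_axis)
        finally show ?thesis by (simp add: cax dA abs_prod)
      qed
      \<comment> \<open>The vacuous summand 0 matches the translation in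
        \<open>lborel_affine_euclidean\<close>; a diagonal matrix is a coordinatewise
        scaling.\<close>
      have T: "0 + (\<Sum>j\<in>Basis. (c j * (x \<bullet> j)) *\<^sub>R j) = A *v x" for x
      proof -
        have "(\<Sum>j\<in>Basis. (c j * (x \<bullet> j)) *\<^sub>R j) = (\<Sum>j\<in>(\<lambda>i. axis i 1) ` UNIV. (c j * (x \<bullet> j)) *\<^sub>R j)"
          by (intro sum.cong) (auto simp: Basis_vec_def)
        also have "\<dots> = (\<Sum>i\<in>UNIV. (A $ i $ i * x $ i) *\<^sub>R axis i 1)"
          by (subst sum.reindex) (auto simp: inj_on_def axis_eq_axis cax inner_axis)
        also have "\<dots> = A *v x"
        proof -
          have "(\<Sum>j\<in>UNIV. A $ i $ j * x $ j) = A $ i $ i * x $ i" for i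
            using 3 by (subst sum.remove[of _ i]) auto
          then show ?thesis
            by (simp add: vec_eq_iff matrix_vector_mult_def sum_component axis_def if_distrib cong: if_cong)
        qed
        finally show ?thesis by simp
      qed
      have "lborel = density (distr lborel borel (\<lambda>x. A *v x)) (\<lambda>_. ennreal \<bar>det A\<bar>)"
        using lborel_affine_euclidean[of c 0] c0 by (simp add: T[simplified] prod)
      then have "(\<integral>\<^sup>+x. f x \<partial>lborel) = (\<integral>\<^sup>+x. f x \<partial>density (distr lborel borel (\<lambda>x. A *v x)) (\<lambda>_. ennreal \<bar>det A\<bar>))"
        by simp
      then show "(\<integral>\<^sup>+x. f x \<partial>lborel) = ennreal \<bar>det A\<bar> * (\<integral>\<^sup>+x. f (A *v x) \<partial>lborel)"
        by (simp add: nn_integral_density nn_integral_distr nn_integral_cmult)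
    qed
  next
    case (4 m n)
    define p where "p = Transposition.transpose m n"
    let ?A = "(\<chi> i j. mat 1 $ i $ p j) :: real ^ 'n ^ 'n"
    have pp: "p (p i) = i" for i by (simp add: p_def)
    have pU: "p permutes UNIV" by (simp add: p_def permutes_swap_id)
    have bij: "bij p" using pU by (simp add: permutes_bij)
    have d: "\<bar>det ?A\<bar> = 1"
      using det_permute_columns[OF pU, of "mat 1 :: real ^ 'n ^ 'n"] by (simp add: sign_def)
    have A: "?A *v x = (\<chi> i. x $ p i)" for x
    proof -
      have "(\<Sum>j\<in>UNIV. mat 1 $ i $ p j * x $ j) = x $ p i" for i
      proof -
        have "mat 1 $ i $ p j * x $ j = (if j = p i then x $ p i else 0)" for j
          using pp by (auto simp: mat_def)
        then show ?thesis by simp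
      qed
      then show ?thesis by (simp add: matrix_vector_mult_def vec_eq_iff)
    qed
    \<comment> \<open>Swapping two coordinates carries boxes to boxes with permuted side lengths,
      hence of equal volume. Since \<open>p\<close> is an involution, the preimage of a box has the
      permuted corners.\<close>
    have "lborel = distr lborel borel (\<lambda>x. ?A *v x)"
    proof (rule lborel_eqI)
      fix l u :: "real ^ 'n"
      assume lu: "\<And>b. b \<in> Basis \<Longrightarrow> l \<bullet> b \<le> u \<bullet> b"
      then have lu': "l $ i \<le> u $ i" for i using lu[of "axis i 1"] by (auto simp: inner_axis Basis_vec_def)
      have prodB: "(\<Prod>b\<in>Basis. (v :: real ^ 'n) \<bullet> b) = (\<Prod>i\<in>UNIV. v $ i)" for v
      proof -
        have "(\<Prod>b\<in>Basis. v \<bullet> b) = (\<Prod>b\<in>(\<lambda>i. axis i 1) ` UNIV. v \<bullet> b)"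
          by (intro prod.cong) (auto simp: Basis_vec_def)
        also have "\<dots> = (\<Prod>i\<in>UNIV. v $ i)"
          by (subst prod.reindex) (auto simp: inj_on_def axis_eq_axis inner_axis)
        finally show ?thesis .
      qed
      have vim: "(\<lambda>x. ?A *v x) -` box l u = box (?A *v l) (?A *v u)"
        unfolding A by (auto simp: mem_box_cart) (metis pp)+
      have "emeasure (distr lborel borel (\<lambda>x. ?A *v x)) (box l u) = emeasure lborel (box (?A *v l) (?A *v u))"
        by (subst emeasure_distr) (auto simp: vim)
      also have "\<dots> = ennreal (\<Prod>b\<in>Basis. (?A *v u - ?A *v l) \<bullet> b)"
        by (rule emeasure_lborel_box) (auto simp: A Basis_vec_def inner_axis lu')
      also have "(\<Prod>b\<in>Basis. (?A *v u - ?A *v l) \<bullet> b) = (\<Prod>i\<in>UNIV. (u - l) $ p i)"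
        unfolding prodB by (simp add: A)
      also have "\<dots> = (\<Prod>i\<in>UNIV. (u - l) $ i)"
        using prod.reindex_bij_betw[OF bij, of "\<lambda>i. (u - l) $ i"] by simp
      also have "\<dots> = (\<Prod>b\<in>Basis. (u - l) \<bullet> b)" by (simp add: prodB)
      finally show "emeasure (distr lborel borel (\<lambda>x. ?A *v x)) (box l u) = ennreal (\<Prod>b\<in>Basis. (u - l) \<bullet> b)" .
    qed simp
    then have eq: "(\<integral>\<^sup>+x. f x \<partial>lborel) = (\<integral>\<^sup>+x. f x \<partial>distr lborel borel (\<lambda>x. ?A *v x))" for f
      by metis
    have "(\<integral>\<^sup>+x. f x \<partial>lborel) = (\<integral>\<^sup>+x. f (?A *v x) \<partial>lborel)" if [measurable]: "f \<in> borel_measurable borel" for f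
      unfolding eq[of f] by (subst nn_integral_distr) auto
    then show ?case
      unfolding p_def[symmetric] d ennreal_1 mult_1_left by blast
  next
    case (5 m n)
    let ?A = "(\<chi> i j. of_bool (i = m \<and> j = n \<or> i = j)) :: real ^ 'n ^ 'n"
    have Am: "?A = (\<chi> k. if k = m then row m (mat 1) + 1 *s row n (mat 1) else row k (mat 1))"
      using 5 by (auto simp: vec_eq_iff row_def mat_def)
    have d: "det ?A = 1"
      unfolding Am using 5 by (subst det_row_operation) auto
    have A: "?A *v x = x + (x $ n) *\<^sub>R axis m 1" for x
    proof -
      have "(\<Sum>j\<in>UNIV. of_bool (i = m \<and> j = n \<or> i = j) * x $ j) = x $ i + x $ n * axis m 1 $ i" for i
      proof -
        have "of_bool (i = m \<and> j = n \<or> i = j) * x $ j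
            = (if j = i then x $ i else 0) + (if j = n then x $ n * axis m 1 $ i else 0)" for j
          using 5 by (auto simp: axis_def)
        then show ?thesis by (simp add: sum.distrib)
      qed
      then show ?thesis by (simp add: matrix_vector_mult_def vec_eq_iff)
    qed
    have "(\<integral>\<^sup>+x. f (x + (x $ n) *\<^sub>R axis m 1) \<partial>lborel) = (\<integral>\<^sup>+x. f x \<partial>lborel)"
      if "f \<in> borel_measurable borel" for f
      using 5 that by (intro nn_integral_lborel_shear) (auto simp: axis_def Basis_vec_def)
    then show ?case
      unfolding d A by simp
  qed
  then show ?thesis using assms by blast
qed

section \<open>Centred Gaussian measures\<close>

locale pos_def_matrix =
  fixes C :: "real ^ 'n ^ 'n"
  assumes pd: "sym_pos_def C"
begin

definition q :: "real ^ 'n \<Rightarrow> real" where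
  "q x = x \<bullet> (matrix_inv C *v x)"

definition Z :: real where
  "Z = sqrt ((2 * pi) ^ CARD('n) * det C)"

lemma C_pos: "x \<noteq> 0 \<Longrightarrow> x \<bullet> (C *v x) > 0" and C_symmetric: "transpose C = C"
  using pd by (auto simp: sym_pos_def_def)

lemma inverse_C: "C ** matrix_inv C = mat 1" "matrix_inv C ** C = mat 1"
proof -
  have "\<forall>x. C *v x = 0 \<longrightarrow> x = 0" using C_pos by force
  then have "\<exists>B. B ** C = mat 1" by (simp add: matrix_left_invertible_ker)
  then have "\<exists>B. C ** B = mat 1 \<and> B ** C = mat 1" using matrix_left_right_inverse by blast
  from someI_ex[OF this] show "C ** matrix_inv C = mat 1" "matrix_inv C ** C = mat 1"
    by (auto simp: matrix_inv_def)
qed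

lemma sym_inverse: "transpose (matrix_inv C) = matrix_inv C"
proof -
  have "transpose (matrix_inv C) ** C = mat 1"
    using arg_cong[OF inverse_C(1), of transpose] by (simp add: matrix_transpose_mul C_symmetric transpose_mat)
  then have "transpose (matrix_inv C) ** (C ** matrix_inv C) = matrix_inv C"
    by (simp add: matrix_mul_assoc)
  then show ?thesis by (simp add: inverse_C)
qed

lemma inner_swap: "u \<bullet> (matrix_inv C *v v) = v \<bullet> (matrix_inv C *v u)"
  by (metis dot_lmul_matrix inner_commute sym_inverse transpose_matrix_vector)

text \<open>Positivity is inherited from \<open>C\<close>: at \<open>y = matrix_inv C *v x\<close>
  the two quadratic forms agree.\<close>

lemma q_pos: "x \<noteq> 0 \<Longrightarrow> q x > 0"
proof -
  assume "x \<noteq> 0"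
  define y where "y = matrix_inv C *v x"
  have x: "C *v y = x" by (simp add: y_def matrix_vector_mul_assoc inverse_C)
  then have "y \<noteq> 0" using \<open>x \<noteq> 0\<close> by auto
  from C_pos[OF this] show ?thesis by (simp add: q_def x flip: y_def) (simp add: inner_commute)
qed

lemma q_0 [simp]: "q 0 = 0"
  by (simp add: q_def)

lemma q_nonneg: "q x \<ge> 0"
  using q_pos[of x] by (cases "x = 0") auto

lemma q_lincomb: "q (a *\<^sub>R u + b *\<^sub>R v) = a\<^sup>2 * q u + b\<^sup>2 * q v + 2 * a * b * (u \<bullet> (matrix_inv C *v v))"
  unfolding q_def
  by (simp add: matrix_vector_right_distrib matrix_vector_mult_scaleR inner_add_left inner_add_right
      inner_swap[of v u] power2_eq_square algebra_simps)

lemma q_scaleR [simp]: "q (a *\<^sub>R u) = a\<^sup>2 * q u"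
  using q_lincomb[of a u 0 0] by simp

text \<open>The coefficients form an orthogonal two-by-two matrix, so the mixed terms cancel. This
  is what makes the density of the Gaussian pair invariant.\<close>

lemma q_reflect: "c\<^sup>2 + s\<^sup>2 = 1 \<Longrightarrow> q (c *\<^sub>R x + s *\<^sub>R w) + q (s *\<^sub>R x - c *\<^sub>R w) = q x + q w"
proof -
  assume cs: "c\<^sup>2 + s\<^sup>2 = 1"
  have "q (c *\<^sub>R x + s *\<^sub>R w) + q (s *\<^sub>R x + (- c) *\<^sub>R w) = (c\<^sup>2 + s\<^sup>2) * (q x + q w)"
    unfolding q_lincomb by (simp add: algebra_simps)
  then show ?thesis by (simp add: cs)
qed

text \<open>The parallelogram law with the term \<open>q (u + v)\<close> dropped.\<close>

lemma q_diff_le: "q (u - v) \<le> 2 * q u + 2 * q v"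
proof -
  have "q (u - v) + q (u + v) = 2 * q u + 2 * q v"
    using q_lincomb[of 1 u "-1" v] q_lincomb[of 1 u 1 v] by simp
  then show ?thesis using q_nonneg[of "u + v"] by linarith
qed

lemma measurable_q [measurable]: "q \<in> borel_measurable borel"
  unfolding q_def
  by (intro borel_measurable_continuous_onI continuous_intros linear_continuous_on)
     (simp add: linear_linear)

text \<open>Gram-Schmidt for the inner product given by \<open>matrix_inv C\<close>, one index at a
  time.\<close>

lemma q_orthonormal:
  "\<exists>v :: 'n \<Rightarrow> real ^ 'n. \<forall>i j. v i \<bullet> (matrix_inv C *v v j) = of_bool (i = j)"
proof -
  have "\<exists>v :: 'n \<Rightarrow> real ^ 'n. \<forall>i\<in>I. \<forall>j\<in>I. v i \<bullet> (matrix_inv C *v v j) = of_bool (i = j)"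
    if "finite I" for I
    using that
  proof induction
    case empty
    then show ?case by simp
  next
    case (insert k I)
    then obtain v where v: "\<And>i j. i \<in> I \<Longrightarrow> j \<in> I \<Longrightarrow> v i \<bullet> (matrix_inv C *v v j) = of_bool (i = j)"
      by blast
    let ?S = "(\<lambda>i. matrix_inv C *v v i) ` I"
    \<comment> \<open>Fewer than \<open>CARD('n)\<close> vectors lie in a hyperplane; its normal
      \<open>u\<close> is orthogonal, in the new inner product, to all vectors chosen so far and
      only needs rescaling.\<close>
    have "dim ?S \<le> card ?S" using insert(1) by (intro dim_le_card') auto
    also have "\<dots> \<le> card I" using insert(1) by (rule card_image_le)
    also have "card I < card (insert k I)" using insert by simp
    also have "\<dots> \<le> DIM(real ^ 'n)" by (simp add: card_mono)
    finally obtain u where u: "u \<noteq> 0" "span ?S \<subseteq> {x. u \<bullet> x = 0}"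
      using lowdim_subset_hyperplane by blast
    have u0: "u \<bullet> (matrix_inv C *v v i) = 0" if "i \<in> I" for i
      using u(2) that span_base[of _ ?S] by blast
    let ?w = "(1 / sqrt (q u)) *\<^sub>R u"
    have w1: "?w \<bullet> (matrix_inv C *v ?w) = 1"
      using q_scaleR[of "1 / sqrt (q u)" u] q_pos[OF u(1)]
      by (simp add: q_def[symmetric] power_divide)
    have w0: "?w \<bullet> (matrix_inv C *v v i) = 0" if "i \<in> I" for i
      using u0[OF that] by simp
    have w0': "v i \<bullet> (matrix_inv C *v ?w) = 0" if "i \<in> I" for i
      using w0[OF that] inner_swap by metis
    have "\<forall>i\<in>insert k I. \<forall>j\<in>insert k I. (v(k := ?w)) i \<bullet> (matrix_inv C *v (v(k := ?w)) j) = of_bool (i = j)"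
    proof (intro ballI)
      fix i j assume "i \<in> insert k I" "j \<in> insert k I"
      then consider "i = k" "j = k" | "i = k" "j \<in> I" "j \<noteq> k" | "i \<in> I" "i \<noteq> k" "j = k"
        | "i \<in> I" "i \<noteq> k" "j \<in> I" "j \<noteq> k" by blast
      then show "(v(k := ?w)) i \<bullet> (matrix_inv C *v (v(k := ?w)) j) = of_bool (i = j)"
        by cases (use w1 w0 w0' v in auto)
    qed
    then show ?case by blast
  qed
  from this[of UNIV] show ?thesis by simp
qed

text \<open>The columns of \<open>P\<close> are the orthonormal family above, so
  \<open>transpose P ** matrix_inv C ** P\<close> is the identity; determinants then give
  \<open>det C\<close>. No eigenvectors are involved.\<close>

lemma diagonalize:
  obtains P :: "real ^ 'n ^ 'n"
  where "det P \<noteq> 0" "det C = (det P)\<^sup>2" "\<And>y. q (P *v y) = y \<bullet> y"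
proof -
  obtain v :: "'n \<Rightarrow> real ^ 'n" where v: "\<And>i j. v i \<bullet> (matrix_inv C *v v j) = of_bool (i = j)"
    using q_orthonormal by blast
  define P :: "real ^ 'n ^ 'n" where "P = (\<chi> i j. v j $ i)"
  have col: "column j P = v j" for j by (simp add: P_def column_def vec_eq_iff)
  have Pa: "P *v axis j 1 = v j" for j
    using col by (simp add: matrix_vector_mult_basis)
  have "(transpose P ** (matrix_inv C ** P)) $ i $ j = v i \<bullet> (matrix_inv C *v v j)" for i j
  proof -
    have "(matrix_inv C ** P) *v axis j 1 = matrix_inv C *v v j"
      by (simp add: Pa flip: matrix_vector_mul_assoc)
    then have "column j (matrix_inv C ** P) = matrix_inv C *v v j"
      by (simp add: matrix_vector_mult_basis)
    moreover have "(transpose P ** Q) $ i $ j = column i P \<bullet> column j Q" for Q :: "real ^ 'n ^ 'n"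
      by (simp add: matrix_matrix_mult_def transpose_def column_def inner_vec_def)
    ultimately show ?thesis by (simp add: col)
  qed
  then have PMP: "transpose P ** (matrix_inv C ** P) = mat 1"
    by (simp add: vec_eq_iff v mat_def)
  have "det P * (det (matrix_inv C) * det P) = 1"
    using arg_cong[OF PMP, of det] by (simp add: det_mul det_transpose)
  moreover have "det C * det (matrix_inv C) = 1"
    using arg_cong[OF inverse_C(1), of det] by (simp add: det_mul)
  ultimately have d: "det P \<noteq> 0" "det C = (det P)\<^sup>2"
    by (auto simp: power2_eq_square) (metis mult.assoc mult.commute mult.left_neutral)
  have "q (P *v y) = y \<bullet> y" for y
  proof -
    have "q (P *v y) = y \<bullet> (transpose P *v (matrix_inv C *v (P *v y)))"
      unfolding q_def by (metis dot_lmul_matrix transpose_matrix_vector transpose_transpose)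
    also have "\<dots> = y \<bullet> ((transpose P ** (matrix_inv C ** P)) *v y)"
      by (simp add: matrix_vector_mul_assoc)
    finally show ?thesis by (simp add: PMP)
  qed
  with d that show ?thesis by blast
qed

lemma det_pos: "det C > 0"
  using diagonalize by (metis zero_less_power2)

lemma Z_pos: "Z > 0"
  using det_pos by (simp add: Z_def)

lemma gaussian_eq: "gaussian C = density lborel (\<lambda>x. ennreal (exp (- q x / 2) / Z))"
  by (simp add: gaussian_def q_def Z_def)

lemma sets_gaussian [measurable_cong, simp]: "sets (gaussian C) = sets borel"
  by (simp add: gaussian_def)

lemma space_gaussian [simp]: "space (gaussian C) = UNIV"
  by (simp add: gaussian_def)

lemma nn_integral_gaussian:
  "f \<in> borel_measurable borel \<Longrightarrow>
    (\<integral>\<^sup>+x. f x \<partial>gaussian C) = (\<integral>\<^sup>+x. ennreal (exp (- q x / 2) / Z) * f x \<partial>lborel)"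
  unfolding gaussian_eq by (subst nn_integral_density) auto

lemma nn_integral_std_gaussian: "(\<integral>\<^sup>+y. ennreal (exp (- (y \<bullet> y) / 2)) \<partial>(lborel :: (real ^ 'n) measure)) = ennreal (sqrt ((2 * pi) ^ CARD('n)))"
proof -
  have 1: "(\<integral>\<^sup>+x. ennreal (exp (- x\<^sup>2 / 2)) \<partial>lborel) = ennreal (sqrt (2 * pi))"
  proof -
    interpret prob_space "density lborel (normal_density 0 1)" by (rule prob_space_normal_density) simp
    have "1 = (\<integral>\<^sup>+x. ennreal (normal_density 0 1 x) \<partial>lborel)"
      using emeasure_space_1 by (simp add: emeasure_density)
    then have "ennreal (sqrt (2 * pi)) = ennreal (sqrt (2 * pi)) * (\<integral>\<^sup>+x. ennreal (normal_density 0 1 x) \<partial>lborel)"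
      by simp
    also have "\<dots> = (\<integral>\<^sup>+x. ennreal (sqrt (2 * pi)) * ennreal (normal_density 0 1 x) \<partial>lborel)"
      by (subst nn_integral_cmult) auto
    also have "\<dots> = (\<integral>\<^sup>+x. ennreal (exp (- x\<^sup>2 / 2)) \<partial>lborel)"
      by (intro nn_integral_cong) (simp add: std_normal_density_def flip: ennreal_mult)
    finally show ?thesis by simp
  qed
  have "ennreal (exp (- (y \<bullet> y) / 2)) = (\<Prod>b\<in>Basis. ennreal (exp (- (y \<bullet> b)\<^sup>2 / 2)))" for y :: "real ^ 'n"
  proof -
    have "exp (- (y \<bullet> y) / 2) = (\<Prod>b\<in>Basis. exp (- (y \<bullet> b)\<^sup>2 / 2))"
      unfolding exp_sum[OF finite_Basis, symmetric] euclidean_inner[of y y]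
      by (simp add: power2_eq_square sum_negf flip: sum_divide_distrib)
    then show ?thesis by (simp add: prod_ennreal)
  qed
  then have "(\<integral>\<^sup>+y. ennreal (exp (- (y \<bullet> y) / 2)) \<partial>(lborel :: (real ^ 'n) measure))
      = (\<Prod>b\<in>(Basis :: (real ^ 'n) set). \<integral>\<^sup>+x. ennreal (exp (- x\<^sup>2 / 2)) \<partial>lborel)"
    using nn_integral_lborel_prod[of "\<lambda>(_ :: real ^ 'n) x. ennreal (exp (- x\<^sup>2 / 2))"] by simp
  also have "\<dots> = ennreal (sqrt ((2 * pi) ^ CARD('n)))"
    unfolding 1 by (simp add: ennreal_power real_sqrt_power real_sqrt_mult power_mult_distrib)
  finally show ?thesis .
qed

text \<open>Substituting \<open>x = P *v y\<close> leaves the standard Gaussian integral, and the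
  Jacobian \<open>\<bar>det P\<bar>\<close> cancels the root of \<open>det C\<close> in
  \<open>Z\<close>.\<close>

lemma prob_space_gaussian: "prob_space (gaussian C)"
proof
  obtain P :: "real ^ 'n ^ 'n" where P: "det P \<noteq> 0" "det C = (det P)\<^sup>2" "\<And>y. q (P *v y) = y \<bullet> y"
    using diagonalize by metis
  have "emeasure (gaussian C) (space (gaussian C)) = (\<integral>\<^sup>+x. 1 \<partial>gaussian C)"
    by simp
  also have "\<dots> = (\<integral>\<^sup>+x. ennreal (exp (- q x / 2) / Z) \<partial>lborel)"
    by (subst nn_integral_gaussian) auto
  also have "\<dots> = ennreal \<bar>det P\<bar> * (\<integral>\<^sup>+x. ennreal (exp (- ((x :: real ^ 'n) \<bullet> x) / 2) / Z) \<partial>lborel)"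
    using nn_integral_lborel_linear[OF _ P(1), of "\<lambda>x. ennreal (exp (- q x / 2) / Z)"] P by simp
  also have "(\<integral>\<^sup>+x. ennreal (exp (- ((x :: real ^ 'n) \<bullet> x) / 2) / Z) \<partial>lborel) = (\<integral>\<^sup>+x. ennreal (1 / Z) * ennreal (exp (- ((x :: real ^ 'n) \<bullet> x) / 2)) \<partial>lborel)"
    using Z_pos by (intro nn_integral_cong) (simp flip: ennreal_mult)
  also have "\<dots> = ennreal (1 / Z) * ennreal (sqrt ((2 * pi) ^ CARD('n)))"
    unfolding nn_integral_std_gaussian[symmetric] by (subst nn_integral_cmult) auto
  also have "ennreal \<bar>det P\<bar> * \<dots> = ennreal (\<bar>det P\<bar> * (1 / Z * sqrt ((2 * pi) ^ CARD('n))))"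
    using Z_pos by (subst ennreal_mult, simp, simp)+ (rule refl)
  also have "\<bar>det P\<bar> * (1 / Z * sqrt ((2 * pi) ^ CARD('n))) = 1"
    using P(1,2) by (simp add: Z_def real_sqrt_mult)
  finally show "emeasure (gaussian C) (space (gaussian C)) = 1" by simp
qed

end

section \<open>Gamma distributions\<close>

lemma nn_integral_gamma:
  assumes a: "a > 0" and b: "b > 0"
  shows "(\<integral>\<^sup>+x. ennreal (if x > 0 then b powr a / Gamma a * x powr (a - 1) * exp (- b * x) else 0) \<partial>lborel) = 1"
proof -
  have G: "Gamma a > 0" using a by (rule Gamma_real_pos)
  let ?f = "\<lambda>t. ennreal (indicator {0..} t * t powr (a - 1) / exp t)"
  have "ennreal (Gamma a) = (\<integral>\<^sup>+t. ?f t \<partial>lborel)"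
    by (rule Gamma_conv_nn_integral_real[OF a])
  also have "\<dots> = ennreal b * (\<integral>\<^sup>+x. ?f (0 + b * x) \<partial>lborel)"
    using b by (subst nn_integral_real_affine[of _ b 0]) auto
  also have "\<dots> = (\<integral>\<^sup>+x. ennreal b * ?f (0 + b * x) \<partial>lborel)"
    by (subst nn_integral_cmult) auto
  also have "\<dots> = (\<integral>\<^sup>+x. ennreal (Gamma a) * ennreal (if x > 0 then b powr a / Gamma a * x powr (a - 1) * exp (- b * x) else 0) \<partial>lborel)"
  proof (intro nn_integral_cong)
    fix x :: real
    have "b * (indicator {0..} (0 + b * x) * (0 + b * x) powr (a - 1) / exp (0 + b * x))
        = Gamma a * (if x > 0 then b powr a / Gamma a * x powr (a - 1) * exp (- b * x) else 0)"
    proof (cases "x > 0")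
      case True
      have "b * b powr (a - 1) = b powr a" using b by (simp add: powr_diff)
      with True b G show ?thesis
        by (simp add: indicator_def powr_mult exp_minus field_simps)
    next
      case False
      then show ?thesis using b by (cases "x = 0") (auto simp: indicator_def zero_le_mult_iff)
    qed
    then show "ennreal b * ?f (0 + b * x) = ennreal (Gamma a) * ennreal (if x > 0 then b powr a / Gamma a * x powr (a - 1) * exp (- b * x) else 0)"
      using b G by (simp flip: ennreal_mult' del: add_0_left)
  qed
  also have "\<dots> = ennreal (Gamma a) * (\<integral>\<^sup>+x. ennreal (if x > 0 then b powr a / Gamma a * x powr (a - 1) * exp (- b * x) else 0) \<partial>lborel)"
    by (subst nn_integral_cmult) auto
  finally have "ennreal (Gamma a) * 1 = ennreal (Gamma a) *
      (\<integral>\<^sup>+x. ennreal (if x > 0 then b powr a / Gamma a * x powr (a - 1) * exp (- b * x) else 0) \<partial>lborel)"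
    by (simp only: mult_1_right)
  then show ?thesis using G unfolding ennreal_mult_cancel_left by auto
qed

text \<open>The inversion \<open>x \<mapsto> 1 / x\<close> carries the Gamma density to this one;
  its Jacobian \<open>1 / x\<^sup>2\<close> accounts for the exponent \<open>- a - 1\<close>. It
  provides the total mass needed in the radial disintegration.\<close>

lemma nn_integral_inverse_gamma:
  assumes a: "a > 0" and b: "b > 0"
  shows "(\<integral>\<^sup>+x. ennreal (if x > 0 then b powr a / Gamma a * x powr (- a - 1) * exp (- b / x) else 0) \<partial>lborel) = 1"
proof -
  have G: "Gamma a > 0" using a by (rule Gamma_real_pos)
  define f where "f x = b powr a / Gamma a * x powr (a - 1) * exp (- b * x)" for x
  define h where "h x = b powr a / Gamma a * x powr (- a - 1) * exp (- b / x)" for x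
  have [measurable]: "f \<in> borel_measurable borel" unfolding f_def by measurable
  have f0: "f x \<ge> 0" for x using G by (simp add: f_def)
  have h0: "h x \<ge> 0" for x using G by (simp add: h_def)
  have "(\<integral>\<^sup>+x. ennreal (if x \<in> {0<..} then f x else 0) \<partial>lborel) = ennreal 1"
    using nn_integral_gamma[OF a b] by (simp only: f_def greaterThan_iff ennreal_1)
  then have "((\<lambda>x. if x \<in> {0<..} then f x else 0) has_integral 1) UNIV"
    using f0 by (intro nn_integral_has_integral) auto
  then have f1: "(f has_integral 1) {0<..}"
    by (simp only: has_integral_restrict_UNIV)
  have inv: "(\<lambda>x :: real. 1 / x) ` {0<..} = {0<..}"
  proof -
    have "y \<in> (\<lambda>x. 1 / x) ` {0<..}" if "y > 0" for y :: real
      using that by (intro image_eqI[of _ _ "1 / y"]) auto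
    then show ?thesis by auto
  qed
  have "f absolutely_integrable_on ((\<lambda>x. 1 / x) ` {0<..}) \<and> integral ((\<lambda>x. 1 / x) ` {0<..}) f = 1"
    using f1 f0 unfolding inv by (auto intro!: nonnegative_absolutely_integrable_1)
  then have "(\<lambda>x. \<bar>- 1 / x\<^sup>2\<bar> * f (1 / x)) absolutely_integrable_on {0<..} \<and> integral {0<..} (\<lambda>x. \<bar>- 1 / x\<^sup>2\<bar> * f (1 / x)) = 1"
    by (subst has_absolute_integral_change_of_variables_1'[where g = "\<lambda>x. 1 / x" and g' = "\<lambda>x. - 1 / x\<^sup>2"])
       (auto intro!: derivative_eq_intros simp: inj_on_def power2_eq_square)
  then have "((\<lambda>x. \<bar>- 1 / x\<^sup>2\<bar> * f (1 / x)) has_integral 1) {0<..}"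
    using set_lebesgue_integral_eq_integral(1) by (metis has_integral_integrable_integral)
  moreover have "\<bar>- 1 / x\<^sup>2\<bar> * f (1 / x) = h x" if "x > 0" for x
  proof -
    have "(1 / x) powr (a - 1) / x\<^sup>2 = x powr (- a - 1)"
    proof -
      have "(1 / x) powr (a - 1) = x powr (1 - a)"
        using that by (simp add: powr_divide powr_minus_divide[of x "a - 1", symmetric])
      then have "(1 / x) powr (a - 1) / x\<^sup>2 = x powr (1 - a) / x\<^sup>2" by simp
      also have "\<dots> = x powr (1 - a) / x powr 2"
        using that by simp
      also have "\<dots> = x powr (- a - 1)" proof -
        have "1 - a - 2 = - a - 1" by simp
        then show ?thesis using powr_diff[of x "1 - a" 2] by metis
      qed
      finally show ?thesis .
    qed
    then show ?thesis by (simp add: f_def h_def field_simps)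
  qed
  ultimately have "(h has_integral 1) {0<..}"
    using has_integral_eq[of "{0<..}" "\<lambda>x. \<bar>- 1 / x\<^sup>2\<bar> * f (1 / x)" h 1] by simp
  then have "(\<integral>\<^sup>+x. ennreal (h x) * indicator {0<..} x \<partial>lborel) = ennreal 1"
    by (intro nn_integral_has_integral_lebesgue') (use h0 in auto)
  also have "(\<lambda>x. ennreal (h x) * indicator {0<..} x) = (\<lambda>x. ennreal (if x > 0 then h x else 0))"
    by (auto simp: indicator_def)
  finally show ?thesis by (simp only: h_def ennreal_1)
qed

lemma sets_gamma_dist [measurable_cong, simp]: "sets (gamma_dist a b) = sets borel"
  by (simp add: gamma_dist_def)

lemma space_gamma_dist [simp]: "space (gamma_dist a b) = UNIV"
  by (simp add: gamma_dist_def)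

lemma prob_space_gamma_dist: "a > 0 \<Longrightarrow> b > 0 \<Longrightarrow> prob_space (gamma_dist a b)"
  by (rule prob_spaceI) (use nn_integral_gamma[of a b] in \<open>simp add: gamma_dist_def emeasure_density\<close>)

lemma nn_integral_gamma_dist:
  "f \<in> borel_measurable borel \<Longrightarrow> (\<integral>\<^sup>+x. f x \<partial>gamma_dist a b)
    = (\<integral>\<^sup>+x. ennreal (if x > 0 then b powr a / Gamma a * x powr (a - 1) * exp (- b * x) else 0) * f x \<partial>lborel)"
  unfolding gamma_dist_def by (subst nn_integral_density) auto

lemma AE_gamma_dist_pos: "AE x in gamma_dist a b. x > 0"
  unfolding gamma_dist_def by (subst AE_density) auto

lemma nn_integral_gamma_dist_scale:
  assumes [measurable]: "f \<in> borel_measurable borel" and "b > 0" "k > 0"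
  shows "(\<integral>\<^sup>+x. f x \<partial>gamma_dist a b) = (\<integral>\<^sup>+x. f (k * x) \<partial>gamma_dist a (k * b))"
proof -
  let ?g = "\<lambda>b x. if x > 0 then b powr a / Gamma a * x powr (a - 1) * exp (- b * x) else 0"
  have "(\<integral>\<^sup>+x. f x \<partial>gamma_dist a b) = (\<integral>\<^sup>+x. ennreal (?g b x) * f x \<partial>lborel)"
    by (rule nn_integral_gamma_dist) measurable
  also have "\<dots> = ennreal k * (\<integral>\<^sup>+x. ennreal (?g b (0 + k * x)) * f (0 + k * x) \<partial>lborel)"
    using assms(3) by (subst nn_integral_real_affine[of _ k 0]) auto
  also have "\<dots> = (\<integral>\<^sup>+x. ennreal k * (ennreal (?g b (0 + k * x)) * f (0 + k * x)) \<partial>lborel)"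
    by (subst nn_integral_cmult) auto
  also have "\<dots> = (\<integral>\<^sup>+x. ennreal (?g (k * b) x) * f (k * x) \<partial>lborel)"
  proof (intro nn_integral_cong)
    fix x :: real
    have "k * ?g b (0 + k * x) = ?g (k * b) x"
    proof (cases "x > 0")
      case True
      have "k powr a = k * k powr (a - 1)" using assms(3) by (simp add: powr_diff)
      with True show ?thesis using assms by (simp add: powr_mult mult_ac)
    next
      case False
      then show ?thesis using assms(3) by (simp add: zero_less_mult_iff)
    qed
    then have "ennreal k * ennreal (?g b (0 + k * x)) = ennreal (?g (k * b) x)"
      using assms(3) by (simp flip: ennreal_mult' del: add_0_left)
    then show "ennreal k * (ennreal (?g b (0 + k * x)) * f (0 + k * x)) = ennreal (?g (k * b) x) * f (k * x)"
      by (metis add_0_left mult.assoc)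
  qed
  also have "\<dots> = (\<integral>\<^sup>+x. f (k * x) \<partial>gamma_dist a (k * b))"
    by (subst nn_integral_gamma_dist) auto
  finally show ?thesis .
qed

text \<open>Tilting the Gamma density by this exponential gives \<open>(1 + k) powr - a\<close>
  times the density of rate \<open>(1 + k) * b\<close>. Because the exponent is measured in units of
  \<open>b\<close>, the value does not depend on \<open>b\<close>; this makes the minorization
  uniform over directions.\<close>

lemma nn_integral_gamma_dist_exp:
  assumes "a > 0" "b > 0" "k \<ge> 0"
  shows "(\<integral>\<^sup>+x. ennreal (exp (- k * b * x)) \<partial>gamma_dist a b) = ennreal ((1 + k) powr - a)"
proof -
  let ?g = "\<lambda>b x. if x > 0 then b powr a / Gamma a * x powr (a - 1) * exp (- b * x) else 0"
  have "(\<integral>\<^sup>+x. ennreal (exp (- k * b * x)) \<partial>gamma_dist a b) = (\<integral>\<^sup>+x. ennreal (?g b x) * ennreal (exp (- k * b * x)) \<partial>lborel)"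
    by (rule nn_integral_gamma_dist) measurable
  also have "\<dots> = (\<integral>\<^sup>+x. ennreal ((1 + k) powr - a) * ennreal (?g ((1 + k) * b) x) \<partial>lborel)"
  proof (intro nn_integral_cong)
    fix x :: real
    have "?g b x * exp (- k * b * x) = (1 + k) powr - a * ?g ((1 + k) * b) x"
    proof (cases "x > 0")
      case True
      have "exp (- ((1 + k) * b) * x) = exp (- b * x) * exp (- k * b * x)"
        by (simp add: exp_add[symmetric] algebra_simps)
      moreover have "(1 + k) powr - a * ((1 + k) * b) powr a = b powr a"
        using assms by (simp add: powr_mult powr_minus)
      ultimately show ?thesis using True by (simp add: mult_ac)
    qed simp
    then show "ennreal (?g b x) * ennreal (exp (- k * b * x)) = ennreal ((1 + k) powr - a) * ennreal (?g ((1 + k) * b) x)"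
      by (metis ennreal_mult' ennreal_mult'' exp_ge_zero powr_ge_zero)
  qed
  also have "\<dots> = ennreal ((1 + k) powr - a) * (\<integral>\<^sup>+x. ennreal (?g ((1 + k) * b) x) \<partial>lborel)"
    by (subst nn_integral_cmult) auto
  finally show ?thesis using nn_integral_gamma[of a "(1 + k) * b"] assms by simp
qed

lemma measurable_gamma_dist:
  assumes [measurable]: "b \<in> borel_measurable M" and "a > 0" "\<And>x. x \<in> space M \<Longrightarrow> b x > 0"
  shows "(\<lambda>x. gamma_dist a (b x)) \<in> M \<rightarrow>\<^sub>M subprob_algebra borel"
proof (rule measurable_subprob_algebra)
  show "subprob_space (gamma_dist a (b x))" if "x \<in> space M" for x
    using prob_space_gamma_dist[OF assms(2) assms(3)[OF that]] by (rule prob_space_imp_subprob_space)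
  show "(\<lambda>x. emeasure (gamma_dist a (b x)) A) \<in> borel_measurable M" if [measurable]: "A \<in> sets borel" for A
    unfolding gamma_dist_def by (simp add: emeasure_density)
qed simp

section \<open>Invariance of Gaussian measures and the radial disintegration\<close>

text \<open>For \<open>c\<^sup>2 + s\<^sup>2 = 1\<close> this is the first component of the
  statement that the reflection is an involution.\<close>

lemma reflect_reflect:
  fixes x w :: "'a::real_vector"
  shows "c *\<^sub>R (c *\<^sub>R x + s *\<^sub>R w) + s *\<^sub>R (s *\<^sub>R x - c *\<^sub>R w) = (c\<^sup>2 + s\<^sup>2) *\<^sub>R x"
  by (simp add: power2_eq_square algebra_simps)

text \<open>Both sides are compared with the integral of
  \<open>H (y, (x - c *\<^sub>R y) /\<^sub>R s)\<close> over \<open>x\<close> and \<open>y\<close>.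
  Replacing \<open>y\<close> by \<open>w\<close> at fixed \<open>x\<close>, or \<open>x\<close> by
  \<open>v\<close> at fixed \<open>y\<close>, costs the same factor
  \<open>\<bar>s\<bar> ^ DIM('a)\<close>, which cancels.\<close>

lemma nn_integral_lborel_reflect:
  fixes H :: "'a::euclidean_space \<times> 'a \<Rightarrow> ennreal"
  assumes [measurable]: "H \<in> borel_measurable (borel \<Otimes>\<^sub>M borel)" and cs: "c\<^sup>2 + s\<^sup>2 = 1" and s: "s \<noteq> 0"
  shows "(\<integral>\<^sup>+x. \<integral>\<^sup>+w. H (c *\<^sub>R x + s *\<^sub>R w, s *\<^sub>R x - c *\<^sub>R w) \<partial>lborel \<partial>lborel) = (\<integral>\<^sup>+y. \<integral>\<^sup>+v. H (y, v) \<partial>lborel \<partial>lborel)"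
proof -
  let ?k = "ennreal (\<bar>s\<bar> ^ DIM('a))"
  have 1: "(\<integral>\<^sup>+y. H (y, (x - c *\<^sub>R y) /\<^sub>R s) \<partial>lborel) = ?k * (\<integral>\<^sup>+w. H (c *\<^sub>R x + s *\<^sub>R w, s *\<^sub>R x - c *\<^sub>R w) \<partial>lborel)" for x
  proof -
    have e: "(x - c *\<^sub>R (c *\<^sub>R x + s *\<^sub>R w)) /\<^sub>R s = s *\<^sub>R x - c *\<^sub>R w" for w
    proof -
      have "x - c *\<^sub>R (c *\<^sub>R x + s *\<^sub>R w) = (1 - c\<^sup>2) *\<^sub>R x - (c * s) *\<^sub>R w"
        by (simp add: algebra_simps power2_eq_square)
      also have "1 - c\<^sup>2 = s\<^sup>2" using cs by simp
      finally have "x - c *\<^sub>R (c *\<^sub>R x + s *\<^sub>R w) = s *\<^sub>R (s *\<^sub>R x - c *\<^sub>R w)"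
        by (simp add: scaleR_diff_right power2_eq_square mult.commute)
      then show ?thesis using s by simp
    qed
    show ?thesis
      using s nn_integral_lborel_affine[of "\<lambda>y. H (y, (x - c *\<^sub>R y) /\<^sub>R s)" s "c *\<^sub>R x"] by (simp only: e) simp
  qed
  have 2: "(\<integral>\<^sup>+x. H (y, (x - c *\<^sub>R y) /\<^sub>R s) \<partial>lborel) = ?k * (\<integral>\<^sup>+v. H (y, v) \<partial>lborel)" for y
    using s nn_integral_lborel_affine[of "\<lambda>x. H (y, (x - c *\<^sub>R y) /\<^sub>R s)" s "c *\<^sub>R y"] by simp
  have "?k * (\<integral>\<^sup>+x. \<integral>\<^sup>+w. H (c *\<^sub>R x + s *\<^sub>R w, s *\<^sub>R x - c *\<^sub>R w) \<partial>lborel \<partial>lborel)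
      = (\<integral>\<^sup>+x. \<integral>\<^sup>+y. H (y, (x - c *\<^sub>R y) /\<^sub>R s) \<partial>lborel \<partial>lborel)"
    unfolding 1 by (subst nn_integral_cmult) auto
  also have "\<dots> = (\<integral>\<^sup>+y. \<integral>\<^sup>+x. H (y, (x - c *\<^sub>R y) /\<^sub>R s) \<partial>lborel \<partial>lborel)"
    by (rule lborel_pair.Fubini') measurable
  also have "\<dots> = ?k * (\<integral>\<^sup>+y. \<integral>\<^sup>+v. H (y, v) \<partial>lborel \<partial>lborel)"
    unfolding 2 by (subst nn_integral_cmult) auto
  finally show ?thesis using s unfolding ennreal_mult_cancel_left by auto
qed

context pos_def_matrix begin

lemma nn_integral_gaussian_pair:
  assumes [measurable]: "H \<in> borel_measurable (borel \<Otimes>\<^sub>M borel)"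
  shows "(\<integral>\<^sup>+x. \<integral>\<^sup>+w. H (x, w) \<partial>gaussian C \<partial>gaussian C)
    = (\<integral>\<^sup>+x. \<integral>\<^sup>+w. ennreal (exp (- (q x + q w) / 2) / Z\<^sup>2) * H (x, w) \<partial>lborel \<partial>lborel)"
proof -
  interpret prob_space "gaussian C" by (rule prob_space_gaussian)
  have "(\<integral>\<^sup>+x. \<integral>\<^sup>+w. H (x, w) \<partial>gaussian C \<partial>gaussian C)
      = (\<integral>\<^sup>+x. ennreal (exp (- q x / 2) / Z) * (\<integral>\<^sup>+w. H (x, w) \<partial>gaussian C) \<partial>lborel)"
    by (subst nn_integral_gaussian) auto
  also have "\<dots> = (\<integral>\<^sup>+x. ennreal (exp (- q x / 2) / Z) * (\<integral>\<^sup>+w. ennreal (exp (- q w / 2) / Z) * H (x, w) \<partial>lborel) \<partial>lborel)"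
    by (subst nn_integral_gaussian) auto
  also have "\<dots> = (\<integral>\<^sup>+x. \<integral>\<^sup>+w. ennreal (exp (- q x / 2) / Z) * (ennreal (exp (- q w / 2) / Z) * H (x, w)) \<partial>lborel \<partial>lborel)"
    by (subst nn_integral_cmult) auto
  also have "\<dots> = (\<integral>\<^sup>+x. \<integral>\<^sup>+w. ennreal (exp (- (q x + q w) / 2) / Z\<^sup>2) * H (x, w) \<partial>lborel \<partial>lborel)"
  proof (intro nn_integral_cong)
    fix x w
    have "exp (- (q x + q w) / 2) / Z\<^sup>2 = (exp (- q x / 2) / Z) * (exp (- q w / 2) / Z)"
      by (simp add: exp_add[symmetric] power2_eq_square add_divide_distrib)
    then have "ennreal (exp (- (q x + q w) / 2) / Z\<^sup>2) = ennreal (exp (- q x / 2) / Z) * ennreal (exp (- q w / 2) / Z)"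
      using Z_pos by (simp only: ennreal_mult' zero_le_divide_iff exp_ge_zero less_imp_le simp_thms)
    then show "ennreal (exp (- q x / 2) / Z) * (ennreal (exp (- q w / 2) / Z) * H (x, w)) = ennreal (exp (- (q x + q w) / 2) / Z\<^sup>2) * H (x, w)"
      by (simp only: mult.assoc)
  qed
  finally show ?thesis .
qed

lemma gaussian_reflect:
  assumes [measurable]: "H \<in> borel_measurable (borel \<Otimes>\<^sub>M borel)" and cs: "c\<^sup>2 + s\<^sup>2 = 1" and s: "s \<noteq> 0"
  shows "(\<integral>\<^sup>+x. \<integral>\<^sup>+w. H (c *\<^sub>R x + s *\<^sub>R w, s *\<^sub>R x - c *\<^sub>R w) \<partial>gaussian C \<partial>gaussian C) = (\<integral>\<^sup>+x. \<integral>\<^sup>+w. H (x, w) \<partial>gaussian C \<partial>gaussian C)"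
proof -
  have "(\<integral>\<^sup>+x. \<integral>\<^sup>+w. H (c *\<^sub>R x + s *\<^sub>R w, s *\<^sub>R x - c *\<^sub>R w) \<partial>gaussian C \<partial>gaussian C)
     = (\<integral>\<^sup>+x. \<integral>\<^sup>+w. ennreal (exp (- (q x + q w) / 2) / Z\<^sup>2) * H (c *\<^sub>R x + s *\<^sub>R w, s *\<^sub>R x - c *\<^sub>R w) \<partial>lborel \<partial>lborel)"
    using nn_integral_gaussian_pair[of "\<lambda>(x, w). H (c *\<^sub>R x + s *\<^sub>R w, s *\<^sub>R x - c *\<^sub>R w)"] by simp
  also have "\<dots> = (\<integral>\<^sup>+x. \<integral>\<^sup>+w. (\<lambda>(x, w). ennreal (exp (- (q x + q w) / 2) / Z\<^sup>2) * H (x, w)) (c *\<^sub>R x + s *\<^sub>R w, s *\<^sub>R x - c *\<^sub>R w) \<partial>lborel \<partial>lborel)"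
    by (simp only: q_reflect[OF cs] prod.case)
  also have "\<dots> = (\<integral>\<^sup>+x. \<integral>\<^sup>+w. ennreal (exp (- (q x + q w) / 2) / Z\<^sup>2) * H (x, w) \<partial>lborel \<partial>lborel)"
    using cs s by (subst nn_integral_lborel_reflect) auto
  finally show ?thesis by (simp add: nn_integral_gaussian_pair)
qed

lemma gaussian_uminus:
  assumes [measurable]: "f \<in> borel_measurable borel"
  shows "(\<integral>\<^sup>+x. f (- x) \<partial>gaussian C) = (\<integral>\<^sup>+x. f x \<partial>gaussian C)"
  using nn_integral_lborel_affine[of "\<lambda>x. ennreal (exp (- q x / 2) / Z) * f x" "-1" 0]
  using q_scaleR[of "-1"] by (simp add: nn_integral_gaussian)

text \<open>A rotation is the reflection preceded by \<open>w \<mapsto> - w\<close>, which preserves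
  the centred Gaussian.\<close>

lemma gaussian_rotate:
  assumes [measurable]: "H \<in> borel_measurable (borel \<Otimes>\<^sub>M borel)" and cs: "c\<^sup>2 + s\<^sup>2 = 1" and s: "s \<noteq> 0"
  shows "(\<integral>\<^sup>+x. \<integral>\<^sup>+w. H (c *\<^sub>R x - s *\<^sub>R w, s *\<^sub>R x + c *\<^sub>R w) \<partial>gaussian C \<partial>gaussian C) = (\<integral>\<^sup>+x. \<integral>\<^sup>+w. H (x, w) \<partial>gaussian C \<partial>gaussian C)"
proof -
  have "(\<integral>\<^sup>+w. H (c *\<^sub>R x - s *\<^sub>R w, s *\<^sub>R x + c *\<^sub>R w) \<partial>gaussian C) = (\<integral>\<^sup>+w. H (c *\<^sub>R x + s *\<^sub>R w, s *\<^sub>R x - c *\<^sub>R w) \<partial>gaussian C)" for x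
    using gaussian_uminus[of "\<lambda>w. H (c *\<^sub>R x + s *\<^sub>R w, s *\<^sub>R x - c *\<^sub>R w)"] by simp
  then show ?thesis using gaussian_reflect[OF assms] by simp
qed

lemma AE_gaussian_nonzero: "AE x in gaussian C. x \<noteq> 0"
  unfolding gaussian_eq using AE_lborel_singleton[of "0 :: real ^ 'n"] by (subst AE_density) auto

end

section \<open>Directions, radii and the disintegration of the Gaussian\<close>

lemma measurable_radial_proj [measurable]: "radial_proj z \<in> borel_measurable borel"
  unfolding radial_proj_def by measurable

locale angular = pos_def_matrix C for C :: "real ^ 'n ^ 'n" +
  fixes zbar :: "real ^ 'n"
  assumes zbar: "zbar \<in> sphere 0 1"
begin

abbreviation proj :: "real ^ 'n \<Rightarrow> real ^ 'n" where "proj \<equiv> radial_proj zbar"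

lemma norm_proj [simp]: "norm (proj x) = 1"
  using zbar by (simp add: radial_proj_def)

lemma proj_scaleR: "r > 0 \<Longrightarrow> proj (r *\<^sub>R x) = proj x"
  by (simp add: radial_proj_def)

lemma proj_sphere: "norm x = 1 \<Longrightarrow> proj x = x"
  by (auto simp: radial_proj_def)

lemma norm_scaleR_proj: "norm x *\<^sub>R proj x = x"
  by (simp add: radial_proj_def)

lemma radius_sq_dist_eq: "radius_sq_dist C x = gamma_dist (real CARD('n) / 2) (q x / 2)"
  by (simp add: radius_sq_dist_def q_def)

text \<open>Since \<open>q x = (norm x)\<^sup>2 * q (proj x)\<close>, rescaling the Gamma variable
  by \<open>(norm x)\<^sup>2\<close> removes the projection: the squared multiplier of
  \<open>x\<close> itself is again Gamma, with rate \<open>q x / 2\<close>.\<close>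

lemma nn_integral_radius:
  assumes [measurable]: "f \<in> borel_measurable borel" and x: "x \<noteq> 0"
  shows "(\<integral>\<^sup>+r2. f (sqrt r2 *\<^sub>R proj x) \<partial>radius_sq_dist C (proj x))
    = (\<integral>\<^sup>+t. f (sqrt t *\<^sub>R x) \<partial>gamma_dist (real CARD('n) / 2) (q x / 2))"
proof -
  have "proj x \<noteq> 0" using norm_proj[of x] by force
  have q: "q x = (norm x)\<^sup>2 * q (proj x)" using q_scaleR[of "norm x" "proj x"] by (simp add: norm_scaleR_proj)
  have "(\<integral>\<^sup>+r2. f (sqrt r2 *\<^sub>R proj x) \<partial>radius_sq_dist C (proj x))
     = (\<integral>\<^sup>+t. f (sqrt ((norm x)\<^sup>2 * t) *\<^sub>R proj x) \<partial>gamma_dist (real CARD('n) / 2) ((norm x)\<^sup>2 * (q (proj x) / 2)))"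
    unfolding radius_sq_dist_eq using q_pos[OF \<open>proj x \<noteq> 0\<close>] x
    by (subst nn_integral_gamma_dist_scale[of _ _ "(norm x)\<^sup>2"]) auto
  also have "\<dots> = (\<integral>\<^sup>+t. f (sqrt t *\<^sub>R (norm x *\<^sub>R proj x)) \<partial>gamma_dist (real CARD('n) / 2) (q x / 2))"
    unfolding q by (simp add: real_sqrt_mult mult.commute)
  finally show ?thesis by (simp add: norm_scaleR_proj)
qed

text \<open>No polar coordinates are needed: substituting \<open>r2 = t * (norm x)\<^sup>2\<close> and then, for fixed \<open>t\<close>,
  \<open>x = z / sqrt t\<close> turns the left-hand side into an integral over \<open>z\<close> and \<open>t\<close> in which \<open>t\<close> has an
  inverse gamma law.\<close>

lemma nn_integral_gaussian_radial:
  assumes [measurable]: "h \<in> borel_measurable borel"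
  shows "(\<integral>\<^sup>+x. \<integral>\<^sup>+r2. h (sqrt r2 *\<^sub>R proj x) \<partial>radius_sq_dist C (proj x) \<partial>gaussian C) = (\<integral>\<^sup>+x. h x \<partial>gaussian C)"
proof -
  define a where "a = real CARD('n) / 2"
  have a: "a > 0" by (simp add: a_def)
  define g where "g b t = (if t > 0 then b powr a / Gamma a * t powr (a - 1) * exp (- b * t) else 0)" for b t :: real
  define g' where "g' b t = (if t > 0 then b powr a / Gamma a * t powr (- a - 1) * exp (- b / t) else 0)" for b t :: real
  have G: "Gamma a > 0" using a by (rule Gamma_real_pos)
  have g0: "g b t \<ge> 0" "g' b t \<ge> 0" for b t using G by (auto simp: g_def g'_def)
  have [measurable]: "case_prod g \<in> borel_measurable (borel \<Otimes>\<^sub>M borel)" "case_prod g' \<in> borel_measurable (borel \<Otimes>\<^sub>M borel)"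
    unfolding g_def g'_def by measurable
  let ?e = "\<lambda>x. exp (- q x / 2) / Z"
  have e0: "?e x \<ge> 0" for x using Z_pos by simp
  have "(\<integral>\<^sup>+x. \<integral>\<^sup>+r2. h (sqrt r2 *\<^sub>R proj x) \<partial>radius_sq_dist C (proj x) \<partial>gaussian C)
      = (\<integral>\<^sup>+x. \<integral>\<^sup>+t. h (sqrt t *\<^sub>R x) \<partial>gamma_dist a (q x / 2) \<partial>gaussian C)"
    using AE_gaussian_nonzero by (intro nn_integral_cong_AE) (auto simp: nn_integral_radius a_def)
  also have "\<dots> = (\<integral>\<^sup>+x. \<integral>\<^sup>+t. ennreal (g (q x / 2) t) * h (sqrt t *\<^sub>R x) \<partial>lborel \<partial>gaussian C)"
    by (intro nn_integral_cong) (simp add: nn_integral_gamma_dist g_def)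
  also have "\<dots> = (\<integral>\<^sup>+x. \<integral>\<^sup>+t. ennreal (?e x) * (ennreal (g (q x / 2) t) * h (sqrt t *\<^sub>R x)) \<partial>lborel \<partial>lborel)"
    by (subst nn_integral_gaussian) (auto simp: nn_integral_cmult)
  also have "\<dots> = (\<integral>\<^sup>+t. \<integral>\<^sup>+x. ennreal (?e x) * (ennreal (g (q x / 2) t) * h (sqrt t *\<^sub>R x)) \<partial>lborel \<partial>lborel)"
    by (rule lborel_pair.Fubini'[symmetric]) measurable
  also have "\<dots> = (\<integral>\<^sup>+t. \<integral>\<^sup>+z. ennreal (?e z) * (ennreal (g' (q z / 2) t) * h z) \<partial>lborel \<partial>lborel)"
  proof (rule nn_integral_cong)
    fix t :: real
    show "(\<integral>\<^sup>+x. ennreal (?e x) * (ennreal (g (q x / 2) t) * h (sqrt t *\<^sub>R x)) \<partial>lborel)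
        = (\<integral>\<^sup>+z. ennreal (?e z) * (ennreal (g' (q z / 2) t) * h z) \<partial>lborel)"
    proof (cases "t > 0")
      case False
      then show ?thesis by (simp add: g_def g'_def)
    next
      case True
      let ?c = "1 / sqrt t"
      have c: "?c > 0" using True by simp
      have c2: "?c\<^sup>2 = 1 / t" using True by (simp add: power_divide)
      have cn: "?c ^ CARD('n) = t powr - a"
      proof -
        have "?c = t powr - (1 / 2)" using True by (simp add: powr_minus_divide powr_half_sqrt)
        then have "?c ^ CARD('n) = (t powr - (1 / 2)) powr real CARD('n)"
          using True powr_realpow[of "t powr - (1 / 2)" "CARD('n)"] by simp
        then show ?thesis by (simp only: powr_powr a_def) simp
      qed
      have "(\<integral>\<^sup>+x. ennreal (?e x) * (ennreal (g (q x / 2) t) * h (sqrt t *\<^sub>R x)) \<partial>lborel)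
          = ennreal (?c ^ CARD('n)) * (\<integral>\<^sup>+z. ennreal (?e (?c *\<^sub>R z)) * (ennreal (g (q (?c *\<^sub>R z) / 2) t) * h z) \<partial>lborel)"
        using c True by (subst nn_integral_lborel_affine[of _ ?c 0]) auto
      also have "\<dots> = (\<integral>\<^sup>+z. ennreal (?c ^ CARD('n)) * (ennreal (?e (?c *\<^sub>R z)) * (ennreal (g (q (?c *\<^sub>R z) / 2) t) * h z)) \<partial>lborel)"
        by (subst nn_integral_cmult) auto
      also have "\<dots> = (\<integral>\<^sup>+z. ennreal (?e z) * (ennreal (g' (q z / 2) t) * h z) \<partial>lborel)"
      proof (intro nn_integral_cong)
        fix z
        \<comment> \<open>The exponentials exchange roles. The Gamma factor becomes
          \<open>exp (- q z / 2)\<close>, because \<open>t\<close> cancels in rate times argument,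
          and the Gaussian factor becomes the exponential of the inverse gamma density.\<close>
        have "?c ^ CARD('n) * (?e (?c *\<^sub>R z) * g (q (?c *\<^sub>R z) / 2) t) = ?e z * g' (q z / 2) t"
        proof -
          have 1: "q (?c *\<^sub>R z) = q z / t" by (simp only: q_scaleR c2) simp
          have "(q z / t / 2) powr a = (q z / 2) powr a * t powr - a"
            using True q_nonneg[of z] powr_divide[of "q z / 2" t a] by (simp add: powr_minus_divide mult.commute)
          moreover have "t powr - a * (t powr - a * t powr (a - 1)) = t powr (- a - 1)"
          proof -
            have e: "- a - 1 = - a + (- a + (a - 1))" by simp
            show ?thesis by (subst e) (simp only: powr_add)
          qed
          ultimately show ?thesis
            unfolding cn 1 g_def g'_def using True by (simp add: mult_ac)
        qed
        then have "ennreal (?c ^ CARD('n)) * (ennreal (?e (?c *\<^sub>R z)) * ennreal (g (q (?c *\<^sub>R z) / 2) t)) = ennreal (?e z) * ennreal (g' (q z / 2) t)"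
          using c e0 g0 by (metis ennreal_mult mult_nonneg_nonneg zero_le_power less_imp_le)
        then show "ennreal (?c ^ CARD('n)) * (ennreal (?e (?c *\<^sub>R z)) * (ennreal (g (q (?c *\<^sub>R z) / 2) t) * h z)) = ennreal (?e z) * (ennreal (g' (q z / 2) t) * h z)"
          by (metis mult.assoc)
      qed
      finally show ?thesis .
    qed
  qed
  also have "\<dots> = (\<integral>\<^sup>+z. \<integral>\<^sup>+t. ennreal (?e z) * (ennreal (g' (q z / 2) t) * h z) \<partial>lborel \<partial>lborel)"
    by (rule lborel_pair.Fubini') measurable
  also have "\<dots> = (\<integral>\<^sup>+z. ennreal (?e z) * ((\<integral>\<^sup>+t. ennreal (g' (q z / 2) t) \<partial>lborel) * h z) \<partial>lborel)"
    by (intro nn_integral_cong) (subst nn_integral_cmult, measurable, subst nn_integral_multc, auto)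
  also have "\<dots> = (\<integral>\<^sup>+z. ennreal (?e z) * h z \<partial>lborel)"
  proof (rule nn_integral_cong_AE)
    \<comment> \<open>At \<open>z = 0\<close> the rate would be 0, so this Lebesgue-null point is
      excluded.\<close>
    have "(\<integral>\<^sup>+t. ennreal (g' (q z / 2) t) \<partial>lborel) = 1" if "z \<noteq> 0" for z
      using nn_integral_inverse_gamma[of a "q z / 2"] a q_pos[OF that] by (simp add: g'_def)
    then show "AE z in lborel. ennreal (?e z) * ((\<integral>\<^sup>+t. ennreal (g' (q z / 2) t) \<partial>lborel) * h z) = ennreal (?e z) * h z"
      by (intro eventually_mono[OF AE_lborel_singleton[of 0]]) simp
  qed
  also have "\<dots> = (\<integral>\<^sup>+x. h x \<partial>gaussian C)" by (simp add: nn_integral_gaussian)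
  finally show ?thesis .
qed

end

section \<open>Targets and reprojected kernels on the sphere\<close>

lemma space_sphere_borel: "space sphere_borel = sphere 0 1"
  by (simp add: sphere_borel_def space_restrict_space)

lemma measurable_sphere_borel_borel: "(\<lambda>x. x) \<in> sphere_borel \<rightarrow>\<^sub>M borel"
  unfolding sphere_borel_def by (rule measurable_restrict_space1) simp

lemma nn_integral_uniform_dist_accept:
  assumes "0 \<le> p" "p \<le> 1"
  shows "(\<integral>\<^sup>+u. (if u \<le> p then a else b) \<partial>uniform_dist 0 1) = ennreal p * a + ennreal (1 - p) * b"
proof -
  have "(\<integral>\<^sup>+u. (if u \<le> p then a else b) \<partial>uniform_dist 0 1)
      = (\<integral>\<^sup>+u. (if u \<le> p then a else b) * indicator {0..1} u \<partial>lborel)"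
    by (subst nn_integral_uniform_measure) (auto simp: divide_ennreal_def)
  also have "\<dots> = (\<integral>\<^sup>+u. a * indicator {0..p} u + b * indicator {p<..1} u \<partial>lborel)"
    using assms by (intro nn_integral_cong) (auto simp: indicator_def)
  also have "\<dots> = a * ennreal p + b * ennreal (1 - p)"
    using assms by (subst nn_integral_add) (auto simp: nn_integral_cmult)
  finally show ?thesis by (simp add: mult.commute)
qed

context pos_def_matrix begin

text \<open>Substitute \<open>w = - (c / s) x + z / sqrt 2\<close>, which turns the argument of
  \<open>f\<close> into a multiple of \<open>z\<close>. The scale \<open>1 / sqrt 2\<close> absorbs
  the factor 2 of \<open>q_diff_le\<close>, so that exactly \<open>q z\<close> remains in the
  exponent; its Jacobian is the power of 2 in the constant.\<close>

lemma gaussian_affine_ge: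
  assumes [measurable]: "f \<in> borel_measurable borel" and s: "s > 0"
  shows "ennreal (2 powr (- real CARD('n) / 2) * exp (- (c / s)\<^sup>2 * q x)) * (\<integral>\<^sup>+z. f ((s / sqrt 2) *\<^sub>R z) \<partial>gaussian C)
    \<le> (\<integral>\<^sup>+w. f (c *\<^sub>R x + s *\<^sub>R w) \<partial>gaussian C)"
proof -
  let ?e = "\<lambda>x. exp (- q x / 2) / Z"
  let ?t = "(- c / s) *\<^sub>R x" and ?k = "1 / sqrt 2"
  have k: "\<bar>?k\<bar> ^ CARD('n) = 2 powr (- real CARD('n) / 2)"
  proof -
    have "?k = 2 powr - (1 / 2)" by (simp add: powr_minus_divide powr_half_sqrt)
    then have "\<bar>?k\<bar> ^ CARD('n) = (2 powr - (1 / 2)) powr real CARD('n)"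
      using powr_realpow[of "2 powr - (1 / 2) :: real" "CARD('n)"] by simp
    then show ?thesis by (simp only: powr_powr) simp
  qed
  have arg: "c *\<^sub>R x + s *\<^sub>R (?t + ?k *\<^sub>R z) = (s / sqrt 2) *\<^sub>R z" for z
    using s by (simp add: algebra_simps)
  have e: "exp (- (c / s)\<^sup>2 * q x) * ?e z \<le> ?e (?t + ?k *\<^sub>R z)" for z
  proof -
    have "q (?k *\<^sub>R z - (c / s) *\<^sub>R x) \<le> 2 * q (?k *\<^sub>R z) + 2 * q ((c / s) *\<^sub>R x)"
      by (rule q_diff_le)
    also have "\<dots> = q z + 2 * (c / s)\<^sup>2 * q x" by (simp only: q_scaleR) (simp add: power_divide)
    finally have "- (c / s)\<^sup>2 * q x + - q z / 2 \<le> - q (?t + ?k *\<^sub>R z) / 2" by (simp add: algebra_simps)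
    then have "exp (- (c / s)\<^sup>2 * q x) * exp (- q z / 2) \<le> exp (- q (?t + ?k *\<^sub>R z) / 2)"
      by (simp add: exp_add[symmetric])
    then show ?thesis using Z_pos by (simp add: divide_right_mono)
  qed
  have "ennreal (2 powr (- real CARD('n) / 2) * exp (- (c / s)\<^sup>2 * q x)) * (\<integral>\<^sup>+z. f ((s / sqrt 2) *\<^sub>R z) \<partial>gaussian C)
     = ennreal (\<bar>?k\<bar> ^ CARD('n)) * (ennreal (exp (- (c / s)\<^sup>2 * q x)) * (\<integral>\<^sup>+z. ennreal (?e z) * f ((s / sqrt 2) *\<^sub>R z) \<partial>lborel))"
    unfolding k by (simp add: nn_integral_gaussian ennreal_mult' mult.assoc)
  also have "\<dots> = ennreal (\<bar>?k\<bar> ^ CARD('n)) * (\<integral>\<^sup>+z. ennreal (exp (- (c / s)\<^sup>2 * q x)) * (ennreal (?e z) * f ((s / sqrt 2) *\<^sub>R z)) \<partial>lborel)"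
    by (subst nn_integral_cmult) auto
  also have "\<dots> \<le> ennreal (\<bar>?k\<bar> ^ CARD('n)) * (\<integral>\<^sup>+z. ennreal (?e (?t + ?k *\<^sub>R z)) * f ((s / sqrt 2) *\<^sub>R z) \<partial>lborel)"
  proof (intro mult_left_mono nn_integral_mono)
    fix z
    have "ennreal (exp (- (c / s)\<^sup>2 * q x)) * ennreal (?e z) \<le> ennreal (?e (?t + ?k *\<^sub>R z))"
      using e[of z] by (simp only: ennreal_mult'[symmetric] exp_ge_zero ennreal_leI)
    then show "ennreal (exp (- (c / s)\<^sup>2 * q x)) * (ennreal (?e z) * f ((s / sqrt 2) *\<^sub>R z)) \<le> ennreal (?e (?t + ?k *\<^sub>R z)) * f ((s / sqrt 2) *\<^sub>R z)"
      by (simp only: mult.assoc[symmetric] mult_right_mono zero_le)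
  qed simp
  also have "\<dots> = (\<integral>\<^sup>+w. ennreal (?e w) * f (c *\<^sub>R x + s *\<^sub>R w) \<partial>lborel)"
    using nn_integral_lborel_affine[of "\<lambda>w. ennreal (?e w) * f (c *\<^sub>R x + s *\<^sub>R w)" ?k ?t] by (simp only: arg) simp
  finally show ?thesis by (simp add: nn_integral_gaussian)
qed

end

section \<open>The projected Gaussian and the minorization averaged over the radius\<close>

context angular begin

lemma measurable_proj_sphere [measurable]: "proj \<in> borel \<rightarrow>\<^sub>M sphere_borel"
  unfolding sphere_borel_def by (rule measurable_restrict_space2) auto

lemma sets_ACG [simp, measurable_cong]: "sets (ACG zbar C) = sets sphere_borel"
  by (simp add: ACG_def)

lemma nn_integral_ACG: "f \<in> borel_measurable sphere_borel \<Longrightarrow> (\<integral>\<^sup>+x. f x \<partial>ACG zbar C) = (\<integral>\<^sup>+x. f (proj x) \<partial>gaussian C)"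
  unfolding ACG_def by (subst nn_integral_distr) auto

lemma prob_space_ACG: "prob_space (ACG zbar C)"
  unfolding ACG_def by (intro prob_space.prob_space_distr prob_space_gaussian) measurable

lemma q_sphere_pos: "x \<in> sphere 0 1 \<Longrightarrow> q x > 0"
  by (rule q_pos) auto

lemma measurable_radius_sq_dist: "radius_sq_dist C \<in> sphere_borel \<rightarrow>\<^sub>M prob_algebra borel"
proof (rule measurable_prob_algebraI)
  have [measurable]: "q \<in> borel_measurable sphere_borel"
    using measurable_compose[OF measurable_sphere_borel_borel measurable_q] .
  show "radius_sq_dist C \<in> sphere_borel \<rightarrow>\<^sub>M subprob_algebra borel"
    unfolding radius_sq_dist_eq[abs_def]
    by (rule measurable_gamma_dist) (auto simp: space_sphere_borel q_sphere_pos)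
  show "prob_space (radius_sq_dist C x)" if "x \<in> space sphere_borel" for x
    unfolding radius_sq_dist_eq
    by (rule prob_space_gamma_dist) (use that q_sphere_pos[of x] in \<open>auto simp: space_sphere_borel\<close>)
qed

lemma sets_radius_sq_dist [simp, measurable_cong]: "sets (radius_sq_dist C x) = sets borel"
  by (simp add: radius_sq_dist_eq)

lemma space_radius_sq_dist [simp]: "space (radius_sq_dist C x) = UNIV"
  by (simp add: radius_sq_dist_eq)

lemma AE_radius_pos: "AE r2 in radius_sq_dist C x. r2 > 0"
  unfolding radius_sq_dist_eq by (rule AE_gamma_dist_pos)

text \<open>The projection ignores the scale \<open>s / sqrt 2\<close>, so
  \<open>gaussian_affine_ge\<close> yields \<open>ACG zbar C\<close> for every radius. The remaining
  exponential factor is averaged by the Gamma Laplace transform with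
  \<open>k = 2 * (c / s)\<^sup>2\<close>, whence the constant.\<close>

lemma radius_gaussian_affine_ge:
  assumes x: "x \<in> sphere 0 1" and A [measurable]: "A \<in> sets sphere_borel" and s: "s > 0"
  shows "ennreal ((2 * (1 + 2 * (c / s)\<^sup>2)) powr (- real CARD('n) / 2)) * emeasure (ACG zbar C) A
    \<le> (\<integral>\<^sup>+r2. \<integral>\<^sup>+w. indicator A (proj (c *\<^sub>R (sqrt r2 *\<^sub>R x) + s *\<^sub>R w)) \<partial>gaussian C \<partial>radius_sq_dist C x)"
proof -
  let ?d = "- real CARD('n) / 2"
  interpret prob_space "gaussian C" by (rule prob_space_gaussian)
  have pA: "(\<integral>\<^sup>+z. indicator A (proj ((s / sqrt 2) *\<^sub>R z)) \<partial>gaussian C) = emeasure (ACG zbar C) A"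
    using s by (simp add: proj_scaleR nn_integral_ACG flip: nn_integral_indicator)
  have "ennreal ((2 * (1 + 2 * (c / s)\<^sup>2)) powr ?d) = ennreal (2 powr ?d) * ennreal ((1 + 2 * (c / s)\<^sup>2) powr ?d)"
    by (subst powr_mult) (auto simp: ennreal_mult')
  also have "ennreal ((1 + 2 * (c / s)\<^sup>2) powr ?d) = (\<integral>\<^sup>+r2. ennreal (exp (- (2 * (c / s)\<^sup>2) * (q x / 2) * r2)) \<partial>radius_sq_dist C x)"
    unfolding radius_sq_dist_eq using q_sphere_pos[OF x] by (subst nn_integral_gamma_dist_exp) auto
  also have "\<dots> = (\<integral>\<^sup>+r2. ennreal (exp (- (c / s)\<^sup>2 * q (sqrt r2 *\<^sub>R x))) \<partial>radius_sq_dist C x)"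
    using AE_radius_pos[of x] by (intro nn_integral_cong_AE, eventually_elim) (simp add: mult_ac)
  also have "ennreal (2 powr ?d) * \<dots> * emeasure (ACG zbar C) A
      = (\<integral>\<^sup>+r2. ennreal (2 powr ?d * exp (- (c / s)\<^sup>2 * q (sqrt r2 *\<^sub>R x))) * emeasure (ACG zbar C) A \<partial>radius_sq_dist C x)"
    by (simp add: nn_integral_multc nn_integral_cmult ennreal_mult')
  also have "\<dots> \<le> (\<integral>\<^sup>+r2. \<integral>\<^sup>+w. indicator A (proj (c *\<^sub>R (sqrt r2 *\<^sub>R x) + s *\<^sub>R w)) \<partial>gaussian C \<partial>radius_sq_dist C x)"
    unfolding pA[symmetric] using s
    by (intro nn_integral_mono gaussian_affine_ge[of "\<lambda>y. indicator A (proj y)"]) measurable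
  finally show ?thesis .
qed

end

section \<open>The target, its comparison with the projected Gaussian, and the transport of
  invariance\<close>

locale angular_target = angular C zbar for C :: "real ^ 'n ^ 'n" and zbar +
  fixes \<Phi> :: "real ^ 'n \<Rightarrow> real" and B :: real
  assumes measurable_Phi [measurable]: "\<Phi> \<in> borel_measurable sphere_borel"
    and Phi_bound: "norm x = 1 \<Longrightarrow> \<bar>\<Phi> x\<bar> \<le> B"
begin

text \<open>The unnormalised density extended to the whole space; it is constant along open rays, so
  drawing a radius does not change it.\<close>

definition \<psi> :: "real ^ 'n \<Rightarrow> real" where
  "\<psi> x = exp (- \<Phi> (proj x))"

lemma measurable_psi [measurable]: "\<psi> \<in> borel_measurable borel"
  unfolding \<psi>_def by measurable

lemma psi_pos: "\<psi> x > 0"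
  by (simp add: \<psi>_def)

lemma psi_bounds: "exp (- B) \<le> \<psi> x" "\<psi> x \<le> exp B"
  using Phi_bound[of "proj x"] by (auto simp: \<psi>_def)

definition norm_const :: real where
  "norm_const = (LINT z | ACG zbar C. exp (- \<Phi> z))"

lemma norm_const: "ennreal norm_const = (\<integral>\<^sup>+x. ennreal (\<psi> x) \<partial>gaussian C)"
  and norm_const_ge: "exp (- B) \<le> norm_const"
proof -
  interpret A: prob_space "ACG zbar C" by (rule prob_space_ACG)
  have sp: "space (ACG zbar C) = sphere 0 1"
    using sets_eq_imp_space_eq[OF sets_ACG] by (simp add: space_sphere_borel)
  have b: "exp (- B) \<le> exp (- \<Phi> x)" "exp (- \<Phi> x) \<le> exp B" if "x \<in> space (ACG zbar C)" for x
    using Phi_bound[of x] that sp by auto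
  have int: "integrable (ACG zbar C) (\<lambda>z. exp (- \<Phi> z))"
    by (rule A.integrable_const_bound[of _ "exp B"]) (use b in auto)
  have "(\<integral>\<^sup>+z. ennreal (exp (- \<Phi> z)) \<partial>ACG zbar C) = ennreal norm_const"
    unfolding norm_const_def using int by (intro nn_integral_eq_integral) auto
  then show "ennreal norm_const = (\<integral>\<^sup>+x. ennreal (\<psi> x) \<partial>gaussian C)"
    by (simp add: nn_integral_ACG \<psi>_def)
  show "exp (- B) \<le> norm_const"
    unfolding norm_const_def by (rule A.integral_ge_const[OF int]) (use b in auto)
qed

lemma norm_const_pos: "norm_const > 0"
  using norm_const_ge exp_gt_zero less_le_trans by blast

lemma sets_target [simp, measurable_cong]: "sets (target zbar C \<Phi>) = sets sphere_borel"
  by (simp add: target_def)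

lemma nn_integral_target:
  assumes [measurable]: "f \<in> borel_measurable sphere_borel"
  shows "(\<integral>\<^sup>+x. f x \<partial>target zbar C \<Phi>) = ennreal (1 / norm_const) * (\<integral>\<^sup>+x. ennreal (\<psi> x) * f (proj x) \<partial>gaussian C)"
proof -
  have "(\<integral>\<^sup>+x. f x \<partial>target zbar C \<Phi>) = (\<integral>\<^sup>+x. ennreal (exp (- \<Phi> x) / norm_const) * f x \<partial>ACG zbar C)"
    unfolding target_def norm_const_def[symmetric] by (subst nn_integral_density) auto
  also have "\<dots> = (\<integral>\<^sup>+x. ennreal (\<psi> x / norm_const) * f (proj x) \<partial>gaussian C)"
    by (subst nn_integral_ACG) (auto simp: \<psi>_def)
  also have "\<dots> = (\<integral>\<^sup>+x. ennreal (1 / norm_const) * (ennreal (\<psi> x) * f (proj x)) \<partial>gaussian C)"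
  proof (rule nn_integral_cong)
    fix x
    have "ennreal (\<psi> x / norm_const) = ennreal (1 / norm_const) * ennreal (\<psi> x)"
      using norm_const_pos psi_pos[of x] by (simp flip: ennreal_mult)
    then show "ennreal (\<psi> x / norm_const) * f (proj x) = ennreal (1 / norm_const) * (ennreal (\<psi> x) * f (proj x))"
      by (simp add: mult.assoc)
  qed
  finally show ?thesis by (simp add: nn_integral_cmult)
qed

lemma emeasure_target:
  assumes [measurable]: "A \<in> sets sphere_borel"
  shows "emeasure (target zbar C \<Phi>) A = ennreal (1 / norm_const) * (\<integral>\<^sup>+x. ennreal (\<psi> x) * indicator A (proj x) \<partial>gaussian C)"
  using nn_integral_target[of "indicator A"] by simp

lemma prob_space_target: "prob_space (target zbar C \<Phi>)"
proof
  have sp: "space (target zbar C \<Phi>) = sphere 0 1"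
    using sets_eq_imp_space_eq[OF sets_target] by (simp add: space_sphere_borel)
  have "sphere 0 1 \<in> sets sphere_borel" using sets.top[of sphere_borel] by (simp add: space_sphere_borel)
  then have "emeasure (target zbar C \<Phi>) (sphere 0 1) = ennreal (1 / norm_const) * ennreal norm_const"
    by (subst emeasure_target) (auto simp: norm_const)
  also have "\<dots> = 1" using norm_const_pos by (simp flip: ennreal_mult)
  finally show "emeasure (target zbar C \<Phi>) (space (target zbar C \<Phi>)) = 1" by (simp add: sp)
qed

text \<open>The density \<open>\<psi> / norm_const\<close> is at most
  \<open>exp B / exp (- B)\<close>.\<close>

lemma target_le_ACG:
  assumes [measurable]: "A \<in> sets sphere_borel"
  shows "ennreal (exp (- 2 * B)) * emeasure (target zbar C \<Phi>) A \<le> emeasure (ACG zbar C) A"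
proof -
  have c: "exp (- 2 * B) * (1 / norm_const) * \<psi> x \<le> 1" for x
  proof -
    have "exp (- 2 * B) * \<psi> x \<le> exp (- 2 * B) * exp B" using psi_bounds by simp
    also have "\<dots> = exp (- B)" by (simp flip: exp_add)
    also have "\<dots> \<le> norm_const" by (rule norm_const_ge)
    finally show ?thesis using norm_const_pos by (simp add: field_simps)
  qed
  have "ennreal (exp (- 2 * B)) * emeasure (target zbar C \<Phi>) A
      = (\<integral>\<^sup>+x. ennreal (exp (- 2 * B)) * (ennreal (1 / norm_const) * (ennreal (\<psi> x) * indicator A (proj x))) \<partial>gaussian C)"
    by (subst emeasure_target) (auto simp: nn_integral_cmult)
  also have "\<dots> = (\<integral>\<^sup>+x. ennreal (exp (- 2 * B) * (1 / norm_const) * \<psi> x) * indicator A (proj x) \<partial>gaussian C)"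
  proof (rule nn_integral_cong)
    fix x
    have "0 \<le> exp (- 2 * B)" "0 \<le> 1 / norm_const" "0 \<le> \<psi> x"
      using norm_const_pos psi_pos[of x] by auto
    then show "ennreal (exp (- 2 * B)) * (ennreal (1 / norm_const) * (ennreal (\<psi> x) * indicator A (proj x)))
        = ennreal (exp (- 2 * B) * (1 / norm_const) * \<psi> x) * indicator A (proj x)"
      by (simp only: ennreal_mult mult_nonneg_nonneg mult.assoc)
  qed
  also have "\<dots> \<le> (\<integral>\<^sup>+x. 1 * indicator A (proj x) \<partial>gaussian C)"
    using c by (intro nn_integral_mono mult_right_mono) (auto simp: ennreal_le_1)
  also have "\<dots> = emeasure (ACG zbar C) A"
    using nn_integral_ACG[of "indicator A"] by simp
  finally show ?thesis .
qed

text \<open>Here \<open>Q x\<close> stands for the probability that the step from the full-space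
  point \<open>x\<close>, once reprojected, lands in \<open>A\<close>. As \<open>\<psi>\<close> is
  constant along rays it can be moved under the radius integral, and
  \<open>nn_integral_gaussian_radial\<close> then replaces direction plus radius by one Gaussian
  point, where \<open>inv\<close> applies.\<close>

lemma target_invariant_reprojected:
  assumes A [measurable]: "A \<in> sets sphere_borel"
    and K: "K \<in> sphere_borel \<rightarrow>\<^sub>M prob_algebra sphere_borel"
    and Q [measurable]: "Q \<in> borel_measurable borel"
    and KQ: "\<And>x. x \<in> sphere 0 1 \<Longrightarrow> emeasure (K x) A = (\<integral>\<^sup>+r2. Q (sqrt r2 *\<^sub>R x) \<partial>radius_sq_dist C x)"
    and inv: "(\<integral>\<^sup>+x. ennreal (\<psi> x) * Q x \<partial>gaussian C) = (\<integral>\<^sup>+x. ennreal (\<psi> x) * indicator A (proj x) \<partial>gaussian C)"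
  shows "(\<integral>\<^sup>+x. emeasure (K x) A \<partial>target zbar C \<Phi>) = emeasure (target zbar C \<Phi>) A"
proof -
  have "(\<lambda>x. emeasure (K x) A) \<in> borel_measurable sphere_borel"
    using measurable_prob_algebraD[OF K] A by (rule measurable_emeasure_kernel)
  then have "(\<integral>\<^sup>+x. emeasure (K x) A \<partial>target zbar C \<Phi>)
      = ennreal (1 / norm_const) * (\<integral>\<^sup>+x. ennreal (\<psi> x) * (\<integral>\<^sup>+r2. Q (sqrt r2 *\<^sub>R proj x) \<partial>radius_sq_dist C (proj x)) \<partial>gaussian C)"
    by (subst nn_integral_target) (auto simp: KQ)
  also have "(\<integral>\<^sup>+x. ennreal (\<psi> x) * (\<integral>\<^sup>+r2. Q (sqrt r2 *\<^sub>R proj x) \<partial>radius_sq_dist C (proj x)) \<partial>gaussian C)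
      = (\<integral>\<^sup>+x. \<integral>\<^sup>+r2. ennreal (\<psi> (sqrt r2 *\<^sub>R proj x)) * Q (sqrt r2 *\<^sub>R proj x) \<partial>radius_sq_dist C (proj x) \<partial>gaussian C)"
  proof (rule nn_integral_cong)
    fix x
    have "(\<integral>\<^sup>+r2. ennreal (\<psi> (sqrt r2 *\<^sub>R proj x)) * Q (sqrt r2 *\<^sub>R proj x) \<partial>radius_sq_dist C (proj x))
       = (\<integral>\<^sup>+r2. ennreal (\<psi> x) * Q (sqrt r2 *\<^sub>R proj x) \<partial>radius_sq_dist C (proj x))"
      by (intro nn_integral_cong_AE eventually_mono[OF AE_radius_pos]) (simp add: \<psi>_def proj_scaleR proj_sphere)
    then show "ennreal (\<psi> x) * (\<integral>\<^sup>+r2. Q (sqrt r2 *\<^sub>R proj x) \<partial>radius_sq_dist C (proj x))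
      = (\<integral>\<^sup>+r2. ennreal (\<psi> (sqrt r2 *\<^sub>R proj x)) * Q (sqrt r2 *\<^sub>R proj x) \<partial>radius_sq_dist C (proj x))"
      by (simp add: nn_integral_cmult)
  qed
  also have "\<dots> = (\<integral>\<^sup>+x. ennreal (\<psi> x) * Q x \<partial>gaussian C)"
    by (rule nn_integral_gaussian_radial) measurable
  finally show ?thesis by (simp add: inv emeasure_target)
qed

text \<open>The kernels are most easily bounded below by the projected Gaussian; passing from there
  to the target costs the factor \<open>exp (- 2 * B)\<close>.\<close>

lemma uniformly_ergodic_if_minorized:
  assumes K: "K \<in> sphere_borel \<rightarrow>\<^sub>M prob_algebra sphere_borel"
    and inv: "\<And>A. A \<in> sets sphere_borel \<Longrightarrow> (\<integral>\<^sup>+x. emeasure (K x) A \<partial>target zbar C \<Phi>) = emeasure (target zbar C \<Phi>) A"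
    and "\<beta> > 0"
    and minor: "\<And>x A. x \<in> sphere 0 1 \<Longrightarrow> A \<in> sets sphere_borel \<Longrightarrow> ennreal \<beta> * emeasure (ACG zbar C) A \<le> emeasure (K x) A"
  shows "uniformly_ergodic sphere_borel K (target zbar C \<Phi>)"
proof (rule uniformly_ergodic_doeblin[OF K prob_space_target sets_target inv])
  show "\<beta> * exp (- 2 * B) > 0" using \<open>\<beta> > 0\<close> by simp
  show "ennreal (\<beta> * exp (- 2 * B)) * emeasure (target zbar C \<Phi>) A \<le> emeasure (K x) A"
    if "x \<in> space sphere_borel" "A \<in> sets sphere_borel" for x A
  proof -
    have "ennreal (\<beta> * exp (- 2 * B)) * emeasure (target zbar C \<Phi>) A
       = ennreal \<beta> * (ennreal (exp (- 2 * B)) * emeasure (target zbar C \<Phi>) A)"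
      using \<open>\<beta> > 0\<close> by (simp add: ennreal_mult' mult.assoc)
    also have "\<dots> \<le> ennreal \<beta> * emeasure (ACG zbar C) A"
      by (intro mult_left_mono target_le_ACG that) simp
    also have "\<dots> \<le> emeasure (K x) A" using minor that by (simp add: space_sphere_borel)
    finally show ?thesis .
  qed
qed

end

section \<open>The pCN-MH kernel\<close>

lemma (in pos_def_matrix) measurable_gaussian_kernel:
  "(\<lambda>x. gaussian C) \<in> M \<rightarrow>\<^sub>M prob_algebra borel"
  by (rule measurable_const) (simp add: space_prob_algebra prob_space_gaussian)

lemma prob_space_uniform_dist: "a < b \<Longrightarrow> prob_space (uniform_dist a b)"
  by (rule prob_space_uniform_measure) auto

context angular_target begin

definition accept :: "real ^ 'n \<Rightarrow> real ^ 'n \<Rightarrow> real" where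
  "accept x y = min 1 (\<psi> y / \<psi> x)"

lemma accept_bounds: "0 \<le> accept x y" "accept x y \<le> 1" "exp (- 2 * B) \<le> accept x y"
proof -
  show "0 \<le> accept x y" "accept x y \<le> 1"
    using psi_pos[of x] psi_pos[of y] by (auto simp: accept_def)
  have "exp (- 2 * B) * \<psi> x \<le> exp (- 2 * B) * exp B" using psi_bounds by simp
  also have "\<dots> = exp (- B)" by (simp flip: exp_add)
  also have "\<dots> \<le> \<psi> y" by (rule psi_bounds)
  finally have "exp (- 2 * B) \<le> \<psi> y / \<psi> x" using psi_pos[of x] by (simp add: field_simps)
  moreover have "0 \<le> B" using Phi_bound[of "proj x"] by simp
  ultimately show "exp (- 2 * B) \<le> accept x y" by (simp add: accept_def)
qed

lemma measurable_accept [measurable (raw)]: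
  assumes [measurable]: "f \<in> borel_measurable M" "g \<in> borel_measurable M"
  shows "(\<lambda>x. accept (f x) (g x)) \<in> borel_measurable M"
  unfolding accept_def by measurable

lemma accept_sphere: "norm x = 1 \<Longrightarrow> min 1 (exp (\<Phi> x - \<Phi> (proj y))) = accept x y"
  by (simp add: accept_def \<psi>_def proj_sphere exp_minus exp_diff field_simps)

text \<open>The symmetry of the right-hand side in \<open>x\<close> and \<open>y\<close> is the
  detailed balance of the Metropolis acceptance.\<close>

lemma psi_accept: "ennreal (\<psi> x) * ennreal (accept x y) = ennreal (min (\<psi> x) (\<psi> y))"
proof -
  have "\<psi> x * accept x y = min (\<psi> x) (\<psi> y)"
    using psi_pos[of x] by (auto simp: accept_def min_def field_simps)
  then show ?thesis using psi_pos[of x] accept_bounds[of x y] by (simp flip: ennreal_mult)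
qed

text \<open>The full-space function that serves as \<open>Q\<close> in
  \<open>target_invariant_reprojected\<close>; the acceptance variable is already integrated
  out.\<close>

definition pcn_step :: "real \<Rightarrow> (real ^ 'n) set \<Rightarrow> real ^ 'n \<Rightarrow> ennreal" where
  "pcn_step s A x = (\<integral>\<^sup>+w. (let y = sqrt (1 - s\<^sup>2) *\<^sub>R x + s *\<^sub>R w in
     ennreal (accept x y) * indicator A (proj y) + ennreal (1 - accept x y) * indicator A (proj x)) \<partial>gaussian C)"

lemma measurable_pcn_step [measurable]:
  assumes [measurable]: "A \<in> sets sphere_borel"
  shows "pcn_step s A \<in> borel_measurable borel"
proof -
  interpret prob_space "gaussian C" by (rule prob_space_gaussian)
  show ?thesis unfolding pcn_step_def Let_def by measurable
qed

text \<open>The accepted flow into \<open>A\<close> is exchanged by \<open>rev\<close> for the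
  accepted flow out of \<open>A\<close>; together with the rejected mass, which stays in
  \<open>A\<close>, this restores the full weight \<open>\<psi> x\<close>.\<close>

lemma pcn_step_invariant:
  assumes [measurable]: "A \<in> sets sphere_borel" and s: "s \<in> {0<..1}"
  shows "(\<integral>\<^sup>+x. ennreal (\<psi> x) * pcn_step s A x \<partial>gaussian C) = (\<integral>\<^sup>+x. ennreal (\<psi> x) * indicator A (proj x) \<partial>gaussian C)"
proof -
  interpret prob_space "gaussian C" by (rule prob_space_gaussian)
  let ?c = "sqrt (1 - s\<^sup>2)"
  let ?y = "\<lambda>x w. ?c *\<^sub>R x + s *\<^sub>R w" and ?v = "\<lambda>x w. s *\<^sub>R x - ?c *\<^sub>R w"
  let ?m = "\<lambda>x y. ennreal (min (\<psi> x) (\<psi> y))"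
  have "s\<^sup>2 \<le> 1" using s by (simp add: power_le_one)
  then have c2: "?c\<^sup>2 = 1 - s\<^sup>2" by simp
  then have cs: "?c\<^sup>2 + s\<^sup>2 = 1" by simp
  have invol: "?y (?y x w) (?v x w) = x" for x w :: "real ^ 'n"
    by (simp only: reflect_reflect cs scaleR_one)
  \<comment> \<open>The reflection of \<open>(x, w)\<close> is an involution that swaps the state
    and its proposal, and the minimum is symmetric in them.\<close>
  have rev: "(\<integral>\<^sup>+x. \<integral>\<^sup>+w. ?m x (?y x w) * indicator A (proj (?y x w)) \<partial>gaussian C \<partial>gaussian C)
      = (\<integral>\<^sup>+x. \<integral>\<^sup>+w. ?m x (?y x w) * indicator A (proj x) \<partial>gaussian C \<partial>gaussian C)"
    using gaussian_reflect[of "\<lambda>(x, w). ?m x (?y x w) * indicator A (proj x)" ?c s] cs s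
    by (simp add: invol min.commute)
  have "(\<integral>\<^sup>+x. ennreal (\<psi> x) * pcn_step s A x \<partial>gaussian C)
     = (\<integral>\<^sup>+x. \<integral>\<^sup>+w. ?m x (?y x w) * indicator A (proj (?y x w)) + ennreal (\<psi> x - min (\<psi> x) (\<psi> (?y x w))) * indicator A (proj x) \<partial>gaussian C \<partial>gaussian C)"
  proof (rule nn_integral_cong)
    fix x
    have "ennreal (\<psi> x) * (ennreal (accept x y) * a + ennreal (1 - accept x y) * b) = ?m x y * a + ennreal (\<psi> x - min (\<psi> x) (\<psi> y)) * b" for y a b
    proof -
      have "\<psi> x * (1 - accept x y) = \<psi> x - min (\<psi> x) (\<psi> y)"
        using psi_pos[of x] by (auto simp: accept_def min_def field_simps)
      then have "ennreal (\<psi> x) * ennreal (1 - accept x y) = ennreal (\<psi> x - min (\<psi> x) (\<psi> y))"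
        using psi_pos[of x] accept_bounds[of x y] by (simp flip: ennreal_mult)
      then show ?thesis by (simp only: distrib_left mult.assoc[symmetric] psi_accept)
    qed
    note expand = this
    show "ennreal (\<psi> x) * pcn_step s A x = (\<integral>\<^sup>+w. ?m x (?y x w) * indicator A (proj (?y x w)) + ennreal (\<psi> x - min (\<psi> x) (\<psi> (?y x w))) * indicator A (proj x) \<partial>gaussian C)"
      unfolding pcn_step_def Let_def by (subst nn_integral_cmult[symmetric]) (measurable, simp only: expand)
  qed
  also have "\<dots> = (\<integral>\<^sup>+x. \<integral>\<^sup>+w. ?m x (?y x w) * indicator A (proj (?y x w)) \<partial>gaussian C \<partial>gaussian C)
      + (\<integral>\<^sup>+x. \<integral>\<^sup>+w. ennreal (\<psi> x - min (\<psi> x) (\<psi> (?y x w))) * indicator A (proj x) \<partial>gaussian C \<partial>gaussian C)"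
    by (simp add: nn_integral_add)
  also have "\<dots> = (\<integral>\<^sup>+x. \<integral>\<^sup>+w. ?m x (?y x w) * indicator A (proj x) + ennreal (\<psi> x - min (\<psi> x) (\<psi> (?y x w))) * indicator A (proj x) \<partial>gaussian C \<partial>gaussian C)"
    unfolding rev by (simp add: nn_integral_add)
  also have "\<dots> = (\<integral>\<^sup>+x. \<integral>\<^sup>+w. ennreal (\<psi> x) * indicator A (proj x) \<partial>gaussian C \<partial>gaussian C)"
  proof (intro nn_integral_cong)
    fix x w
    have "?m x y + ennreal (\<psi> x - min (\<psi> x) (\<psi> y)) = ennreal (\<psi> x)" for y
      using psi_pos[of x] psi_pos[of y] by (simp flip: ennreal_plus)
    then show "?m x (?y x w) * indicator A (proj x) + ennreal (\<psi> x - min (\<psi> x) (\<psi> (?y x w))) * indicator A (proj x) = ennreal (\<psi> x) * indicator A (proj x)"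
      by (simp only: distrib_right[symmetric])
  qed
  finally show ?thesis by (simp add: emeasure_space_1[simplified])
qed

text \<open>Isolates the deterministic update from the draws, so that measurability of the nested
  binds can be built up one draw at a time.\<close>

definition pcn_next :: "real \<Rightarrow> real ^ 'n \<Rightarrow> real \<Rightarrow> real ^ 'n \<Rightarrow> real \<Rightarrow> real ^ 'n" where
  "pcn_next s x r2 w u = (let y = proj (sqrt (1 - s\<^sup>2) *\<^sub>R (sqrt r2 *\<^sub>R x) + s *\<^sub>R w) in
     if u \<le> min 1 (exp (\<Phi> x - \<Phi> y)) then y else x)"

lemma measurable_pcn_next:
  assumes f [measurable]: "f \<in> M \<rightarrow>\<^sub>M sphere_borel"
    and [measurable]: "r \<in> borel_measurable M" "w \<in> borel_measurable M" "u \<in> borel_measurable M"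
  shows "(\<lambda>p. pcn_next s (f p) (r p) (w p) (u p)) \<in> M \<rightarrow>\<^sub>M sphere_borel"
proof -
  have [measurable]: "f \<in> borel_measurable M"
    by (rule measurable_compose[OF f measurable_sphere_borel_borel])
  show ?thesis unfolding pcn_next_def Let_def by measurable
qed

lemma pcn_kernel_eq:
  "pcn_kernel zbar C \<Phi> s x = radius_sq_dist C x \<bind> (\<lambda>r2. gaussian C \<bind> (\<lambda>w. uniform_dist 0 1 \<bind>
     (\<lambda>u. return sphere_borel (pcn_next s x r2 w u))))"
  unfolding pcn_kernel_def pcn_next_def Let_def ..

lemma measurable_uniform_01: "(\<lambda>x. uniform_dist 0 1) \<in> M \<rightarrow>\<^sub>M prob_algebra borel"
  by (rule measurable_const) (simp add: space_prob_algebra prob_space_uniform_dist)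

lemma measurable_pcn_kernel_u:
  assumes "f \<in> M \<rightarrow>\<^sub>M sphere_borel" "r \<in> borel_measurable M" "w \<in> borel_measurable M"
  shows "(\<lambda>p. uniform_dist 0 1 \<bind> (\<lambda>u. return sphere_borel (pcn_next s (f p) (r p) (w p) u))) \<in> M \<rightarrow>\<^sub>M prob_algebra sphere_borel"
proof (rule measurable_bind_prob_space2[where N = borel])
  show "(\<lambda>(p, u). return sphere_borel (pcn_next s (f p) (r p) (w p) u)) \<in> M \<Otimes>\<^sub>M borel \<rightarrow>\<^sub>M prob_algebra sphere_borel"
    unfolding split_beta'
    by (intro measurable_compose[OF _ measurable_return_prob_space] measurable_pcn_next
        measurable_compose[OF measurable_fst assms(1)] measurable_compose[OF measurable_fst assms(2)]
        measurable_compose[OF measurable_fst assms(3)] measurable_snd)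
qed (rule measurable_uniform_01)

lemma measurable_pcn_kernel_w:
  assumes "f \<in> M \<rightarrow>\<^sub>M sphere_borel" "r \<in> borel_measurable M"
  shows "(\<lambda>p. gaussian C \<bind> (\<lambda>w. uniform_dist 0 1 \<bind> (\<lambda>u. return sphere_borel (pcn_next s (f p) (r p) w u)))) \<in> M \<rightarrow>\<^sub>M prob_algebra sphere_borel"
proof (rule measurable_bind_prob_space2[where N = borel])
  show "(\<lambda>(p, w). uniform_dist 0 1 \<bind> (\<lambda>u. return sphere_borel (pcn_next s (f p) (r p) w u))) \<in> M \<Otimes>\<^sub>M borel \<rightarrow>\<^sub>M prob_algebra sphere_borel"
    unfolding split_beta'
    by (intro measurable_pcn_kernel_u
        measurable_compose[OF measurable_fst assms(1)] measurable_compose[OF measurable_fst assms(2)] measurable_snd)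
qed (rule measurable_gaussian_kernel)

lemma measurable_pcn_kernel: "pcn_kernel zbar C \<Phi> s \<in> sphere_borel \<rightarrow>\<^sub>M prob_algebra sphere_borel"
  unfolding pcn_kernel_eq[abs_def]
proof (rule measurable_bind_prob_space2[where N = borel])
  show "(\<lambda>(x, r2). gaussian C \<bind> (\<lambda>w. uniform_dist 0 1 \<bind> (\<lambda>u. return sphere_borel (pcn_next s x r2 w u))))
     \<in> sphere_borel \<Otimes>\<^sub>M borel \<rightarrow>\<^sub>M prob_algebra sphere_borel"
    unfolding split_beta' by (intro measurable_pcn_kernel_w measurable_fst measurable_snd)
qed (rule measurable_radius_sq_dist)

lemma emeasure_pcn_kernel:
  assumes x: "x \<in> sphere 0 1" and A [measurable]: "A \<in> sets sphere_borel"
  shows "emeasure (pcn_kernel zbar C \<Phi> s x) A = (\<integral>\<^sup>+r2. pcn_step s A (sqrt r2 *\<^sub>R x) \<partial>radius_sq_dist C x)"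
proof -
  have xs: "(\<lambda>_. x) \<in> M \<rightarrow>\<^sub>M sphere_borel" for M :: "'x measure"
    using x by (intro measurable_const) (simp add: space_sphere_borel)
  have n: "norm x = 1" using x by simp
  have "emeasure (pcn_kernel zbar C \<Phi> s x) A = (\<integral>\<^sup>+r2. emeasure (gaussian C \<bind> (\<lambda>w. uniform_dist 0 1 \<bind>
     (\<lambda>u. return sphere_borel (pcn_next s x r2 w u)))) A \<partial>radius_sq_dist C x)"
    unfolding pcn_kernel_eq
    by (intro emeasure_bind[where N = sphere_borel] measurable_prob_algebraD measurable_pcn_kernel_w xs A) auto
  also have "\<dots> = (\<integral>\<^sup>+r2. pcn_step s A (sqrt r2 *\<^sub>R x) \<partial>radius_sq_dist C x)"
  proof (intro nn_integral_cong_AE eventually_mono[OF AE_radius_pos])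
    fix r2 :: real assume r2: "r2 > 0"
    have ax: "accept (sqrt r2 *\<^sub>R x) y = accept x y" for y
      using r2 by (simp add: accept_def \<psi>_def proj_scaleR)
    have px: "proj (sqrt r2 *\<^sub>R x) = x" using r2 n by (simp add: proj_scaleR proj_sphere)
    have "emeasure (gaussian C \<bind> (\<lambda>w. uniform_dist 0 1 \<bind> (\<lambda>u. return sphere_borel (pcn_next s x r2 w u)))) A
       = (\<integral>\<^sup>+w. emeasure (uniform_dist 0 1 \<bind> (\<lambda>u. return sphere_borel (pcn_next s x r2 w u))) A \<partial>gaussian C)"
      by (intro emeasure_bind[where N = sphere_borel] measurable_prob_algebraD measurable_pcn_kernel_u xs A) auto
    also have "\<dots> = pcn_step s A (sqrt r2 *\<^sub>R x)"
      unfolding pcn_step_def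
    proof (rule nn_integral_cong)
      fix w
      let ?y = "sqrt (1 - s\<^sup>2) *\<^sub>R (sqrt r2 *\<^sub>R x) + s *\<^sub>R w"
      have "emeasure (uniform_dist 0 1 \<bind> (\<lambda>u. return sphere_borel (pcn_next s x r2 w u))) A
         = (\<integral>\<^sup>+u. emeasure (return sphere_borel (pcn_next s x r2 w u)) A \<partial>uniform_dist 0 1)"
        by (intro emeasure_bind[where N = sphere_borel] measurable_prob_algebraD
            measurable_compose[OF _ measurable_return_prob_space] measurable_pcn_next xs A) auto
      also have "\<dots> = (\<integral>\<^sup>+u. (if u \<le> accept x ?y then indicator A (proj ?y) else indicator A x) \<partial>uniform_dist 0 1)"
        unfolding pcn_next_def Let_def accept_sphere[OF n]
        by (intro nn_integral_cong) (subst emeasure_return[OF A], simp)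
      also have "\<dots> = ennreal (accept x ?y) * indicator A (proj ?y) + ennreal (1 - accept x ?y) * indicator A x"
        by (rule nn_integral_uniform_dist_accept) (rule accept_bounds)+
      finally show "emeasure (uniform_dist 0 1 \<bind> (\<lambda>u. return sphere_borel (pcn_next s x r2 w u))) A
        = (let y = ?y in ennreal (accept (sqrt r2 *\<^sub>R x) y) * indicator A (proj y) + ennreal (1 - accept (sqrt r2 *\<^sub>R x) y) * indicator A (proj (sqrt r2 *\<^sub>R x)))"
        by (simp only: Let_def ax px)
    qed
    finally show "emeasure (gaussian C \<bind> (\<lambda>w. uniform_dist 0 1 \<bind> (\<lambda>u. return sphere_borel (pcn_next s x r2 w u)))) A
      = pcn_step s A (sqrt r2 *\<^sub>R x)" .
  qed
  finally show ?thesis .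
qed

text \<open>The rejected part is dropped and acceptance is bounded below by
  \<open>exp (- 2 * B)\<close>. What remains is the projected proposal, to which the radial
  minorization applies with coefficient \<open>sqrt (1 - s\<^sup>2)\<close>.\<close>

lemma uniformly_ergodic_pcn:
  assumes s: "s \<in> {0<..1}"
  shows "uniformly_ergodic sphere_borel (pcn_kernel zbar C \<Phi> s) (target zbar C \<Phi>)"
proof (rule uniformly_ergodic_if_minorized[OF measurable_pcn_kernel])
  let ?c = "sqrt (1 - s\<^sup>2)"
  let ?k = "(2 * (1 + 2 * (?c / s)\<^sup>2)) powr (- real CARD('n) / 2)"
  interpret prob_space "gaussian C" by (rule prob_space_gaussian)
  have "2 * (1 + 2 * (?c / s)\<^sup>2) > 0" by (simp add: add_pos_nonneg)
  then have k: "?k > 0" by simp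
  show "exp (- 2 * B) * ?k > 0" using k by simp
  show "(\<integral>\<^sup>+x. emeasure (pcn_kernel zbar C \<Phi> s x) A \<partial>target zbar C \<Phi>) = emeasure (target zbar C \<Phi>) A"
    if [measurable]: "A \<in> sets sphere_borel" for A
    by (rule target_invariant_reprojected[OF that measurable_pcn_kernel measurable_pcn_step[OF that]])
       (use that s in \<open>auto intro: emeasure_pcn_kernel pcn_step_invariant\<close>)
  show "ennreal (exp (- 2 * B) * ?k) * emeasure (ACG zbar C) A \<le> emeasure (pcn_kernel zbar C \<Phi> s x) A"
    if x: "x \<in> sphere 0 1" and A [measurable]: "A \<in> sets sphere_borel" for x A
  proof -
    have "ennreal (exp (- 2 * B) * ?k) * emeasure (ACG zbar C) A = ennreal (exp (- 2 * B)) * (ennreal ?k * emeasure (ACG zbar C) A)"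
      by (simp add: ennreal_mult' mult.assoc)
    also have "\<dots> \<le> ennreal (exp (- 2 * B)) * (\<integral>\<^sup>+r2. \<integral>\<^sup>+w. indicator A (proj (?c *\<^sub>R (sqrt r2 *\<^sub>R x) + s *\<^sub>R w)) \<partial>gaussian C \<partial>radius_sq_dist C x)"
      using s by (intro mult_left_mono radius_gaussian_affine_ge x A) auto
    also have "\<dots> = (\<integral>\<^sup>+r2. \<integral>\<^sup>+w. ennreal (exp (- 2 * B)) * indicator A (proj (?c *\<^sub>R (sqrt r2 *\<^sub>R x) + s *\<^sub>R w)) \<partial>gaussian C \<partial>radius_sq_dist C x)"
      by (simp add: nn_integral_cmult)
    also have "\<dots> \<le> (\<integral>\<^sup>+r2. pcn_step s A (sqrt r2 *\<^sub>R x) \<partial>radius_sq_dist C x)"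
      unfolding pcn_step_def Let_def
      by (intro nn_integral_mono add_increasing2 mult_right_mono ennreal_leI accept_bounds) auto
    also have "\<dots> = emeasure (pcn_kernel zbar C \<Phi> s x) A"
      by (rule emeasure_pcn_kernel[symmetric]) fact+
    finally show ?thesis .
  qed
qed

end

section \<open>Reversibility of the shrinking procedure\<close>

lemma emeasure_lborel_Icc_real: "emeasure lborel {a..b :: real} = ennreal (b - a)"
  by (cases "a \<le> b") (auto simp: ennreal_neg)

lemma nn_integral_uniform_dist:
  "f \<in> borel_measurable borel \<Longrightarrow>
    (\<integral>\<^sup>+u. f u \<partial>uniform_dist a b) = (\<integral>\<^sup>+u. f u * indicator {a..b} u \<partial>lborel) / ennreal (b - a)"
  by (subst nn_integral_uniform_measure) (auto simp: emeasure_lborel_Icc_real)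

text \<open>For \<open>a \<ge> b\<close> the interval is Lebesgue null and the measure vanishes.
  Claiming only total mass at most 1 avoids carrying an order on the bracket ends through the
  loop.\<close>

lemma subprob_space_uniform_dist: "subprob_space (uniform_dist a b)"
proof
  have "ennreal (b - a) / ennreal (b - a) \<le> 1"
    by (cases "a < b") (auto simp: divide_ennreal ennreal_neg)
  then show "emeasure (uniform_dist a b) (space (uniform_dist a b)) \<le> 1"
    by (simp add: emeasure_lborel_Icc_real)
qed simp

lemma measurable_uniform_dist:
  assumes [measurable]: "a \<in> borel_measurable M" "b \<in> borel_measurable M"
  shows "(\<lambda>x. uniform_dist (a x) (b x)) \<in> M \<rightarrow>\<^sub>M subprob_algebra borel"
proof (rule measurable_subprob_algebra)
  show "subprob_space (uniform_dist (a x) (b x))" for x by (rule subprob_space_uniform_dist)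
  show "(\<lambda>x. emeasure (uniform_dist (a x) (b x)) A) \<in> borel_measurable M" if A [measurable]: "A \<in> sets borel" for A
  proof -
    have "emeasure (uniform_dist (a x) (b x)) A
        = (\<integral>\<^sup>+u. (if a x \<le> u \<and> u \<le> b x then indicator A u else 0) \<partial>lborel) / ennreal (b x - a x)" for x
    proof -
      have "emeasure (uniform_dist (a x) (b x)) A = (\<integral>\<^sup>+u. indicator A u \<partial>uniform_dist (a x) (b x))"
        by (subst nn_integral_indicator) auto
      also have "\<dots> = (\<integral>\<^sup>+u. indicator A u * indicator {a x..b x} u \<partial>lborel) / ennreal (b x - a x)"
        by (rule nn_integral_uniform_dist) measurable
      also have "(\<lambda>u. indicator A u * indicator {a x..b x} u) = (\<lambda>u. if a x \<le> u \<and> u \<le> b x then indicator A u else 0 :: ennreal)"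
        by (auto simp: indicator_def)
      finally show ?thesis .
    qed
    then show ?thesis by simp
  qed
qed simp

text \<open>The value of \<open>f\<close> at the output of the shrinking procedure, integrated over all runs with at
  most \<open>k\<close> proposals, for the set \<open>S\<close> of accepted angles, the current angle \<open>\<alpha>\<close> and the bracket
  \<open>[a, b]\<close> from which the next proposal is drawn.\<close>

primrec shrink_int :: "(real \<Rightarrow> bool) \<Rightarrow> (real \<Rightarrow> ennreal) \<Rightarrow> nat \<Rightarrow> real \<Rightarrow> real \<Rightarrow> real \<Rightarrow> ennreal" where
  "shrink_int S f 0 \<alpha> a b = 0"
| "shrink_int S f (Suc k) \<alpha> a b =
    (\<integral>\<^sup>+\<theta>. (if S \<theta> then f \<theta> else if \<theta> < \<alpha> then shrink_int S f k \<alpha> \<theta> b else shrink_int S f k \<alpha> a \<theta>)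
      * indicator {a..b} \<theta> \<partial>lborel) / ennreal (b - a)"

text \<open>Joint measurability includes the parameter \<open>z\<close> of the accepted set, since
  the ellipse itself is later integrated over the Gaussian pair. In the induction step the proposal
  takes the place of a bracket end.\<close>

lemma measurable_shrink_int_tuple:
  assumes S [measurable]: "Measurable.pred (M \<Otimes>\<^sub>M borel) (\<lambda>p. S (fst p) (snd p))"
    and f [measurable]: "(\<lambda>p. f (fst p) (snd p)) \<in> borel_measurable (M \<Otimes>\<^sub>M borel)"
  shows "(\<lambda>(z, \<alpha>, a, b). shrink_int (S z) (f z) k \<alpha> a b) \<in> borel_measurable (M \<Otimes>\<^sub>M borel \<Otimes>\<^sub>M borel \<Otimes>\<^sub>M borel)"
proof (induction k)
  case 0
  then show ?case by simp
next
  case (Suc k)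
  let ?N = "(M \<Otimes>\<^sub>M (borel :: real measure) \<Otimes>\<^sub>M (borel :: real measure) \<Otimes>\<^sub>M (borel :: real measure)) \<Otimes>\<^sub>M (borel :: real measure)"
  have l [measurable]: "(\<lambda>p. shrink_int (S (fst (fst p))) (f (fst (fst p))) k (fst (snd (fst p))) (snd p) (snd (snd (snd (fst p))))) \<in> borel_measurable ?N"
    by (rule measurable_compose[OF _ Suc, of "\<lambda>p. (fst (fst p), fst (snd (fst p)), snd p, snd (snd (snd (fst p))))", simplified]) measurable
  have r [measurable]: "(\<lambda>p. shrink_int (S (fst (fst p))) (f (fst (fst p))) k (fst (snd (fst p))) (fst (snd (snd (fst p)))) (snd p)) \<in> borel_measurable ?N"
    by (rule measurable_compose[OF _ Suc, of "\<lambda>p. (fst (fst p), fst (snd (fst p)), fst (snd (snd (fst p))), snd p)", simplified]) measurable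
  have S' [measurable]: "Measurable.pred ?N (\<lambda>p. S (fst (fst p)) (snd p))"
    by (rule measurable_compose[OF _ S, of "\<lambda>p. (fst (fst p), snd p)", simplified]) measurable
  have f' [measurable]: "(\<lambda>p. f (fst (fst p)) (snd p)) \<in> borel_measurable ?N"
    by (rule measurable_compose[OF _ f, of "\<lambda>p. (fst (fst p), snd p)", simplified]) measurable
  have "(\<lambda>p. (\<integral>\<^sup>+\<theta>. (if S (fst p) \<theta> then f (fst p) \<theta> else if \<theta> < fst (snd p) then shrink_int (S (fst p)) (f (fst p)) k (fst (snd p)) \<theta> (snd (snd (snd p)))
      else shrink_int (S (fst p)) (f (fst p)) k (fst (snd p)) (fst (snd (snd p))) \<theta>)
      * (if fst (snd (snd p)) \<le> \<theta> \<and> \<theta> \<le> snd (snd (snd p)) then 1 else 0) \<partial>lborel) / ennreal (snd (snd (snd p)) - fst (snd (snd p))))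
    \<in> borel_measurable (M \<Otimes>\<^sub>M borel \<Otimes>\<^sub>M borel \<Otimes>\<^sub>M borel)"
    by measurable
  then show ?case by (simp add: split_beta' indicator_def of_bool_def)
qed

lemma measurable_shrink_int_param:
  assumes S: "Measurable.pred (M \<Otimes>\<^sub>M borel) (\<lambda>p. S (fst p) (snd p))"
    and f: "(\<lambda>p. f (fst p) (snd p)) \<in> borel_measurable (M \<Otimes>\<^sub>M borel)"
    and [measurable]: "z \<in> N \<rightarrow>\<^sub>M M" "\<alpha> \<in> borel_measurable N" "a \<in> borel_measurable N" "b \<in> borel_measurable N"
  shows "(\<lambda>x. shrink_int (S (z x)) (f (z x)) k (\<alpha> x) (a x) (b x)) \<in> borel_measurable N"
  using measurable_compose[OF _ measurable_shrink_int_tuple[OF S f], of "\<lambda>x. (z x, \<alpha> x, a x, b x)" N k] by simp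

lemma measurable_shrink_int [measurable (raw)]:
  assumes [measurable]: "Measurable.pred borel S" "f \<in> borel_measurable borel"
    and [measurable]: "\<alpha> \<in> borel_measurable N" "a \<in> borel_measurable N" "b \<in> borel_measurable N"
  shows "(\<lambda>x. shrink_int S f k (\<alpha> x) (a x) (b x)) \<in> borel_measurable N"
  by (rule measurable_shrink_int_param[where M = "count_space (UNIV :: unit set)" and S = "\<lambda>_. S" and f = "\<lambda>_. f" and z = "\<lambda>_. ()"])
     measurable

text \<open>Only comparisons of angles and lengths of brackets enter the recursion. The shift
  compensates the change of parametrisation when the ellipse is rotated.\<close>

lemma shrink_int_shift:
  assumes [measurable]: "Measurable.pred borel S" "f \<in> borel_measurable borel"
  shows "shrink_int S f k \<alpha> a b = shrink_int (\<lambda>\<theta>. S (\<theta> + c)) (\<lambda>\<theta>. f (\<theta> + c)) k (\<alpha> - c) (a - c) (b - c)"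
proof (induction k arbitrary: \<alpha> a b)
  case 0
  then show ?case by simp
next
  case (Suc k)
  let ?S = "\<lambda>\<theta>. S (\<theta> + c)" and ?f = "\<lambda>\<theta>. f (\<theta> + c)"
  let ?g = "\<lambda>\<theta>. (if S \<theta> then f \<theta> else if \<theta> < \<alpha> then shrink_int S f k \<alpha> \<theta> b else shrink_int S f k \<alpha> a \<theta>) * indicator {a..b} \<theta>"
  have "(\<integral>\<^sup>+\<theta>. ?g \<theta> \<partial>lborel) = (\<integral>\<^sup>+\<theta>. ?g (c + 1 * \<theta>) \<partial>lborel)"
    by (subst nn_integral_real_affine[of _ 1 c]) auto
  also have "\<dots> = (\<integral>\<^sup>+\<theta>. (if ?S \<theta> then ?f \<theta> else if \<theta> < \<alpha> - c then shrink_int ?S ?f k (\<alpha> - c) \<theta> (b - c)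
      else shrink_int ?S ?f k (\<alpha> - c) (a - c) \<theta>) * indicator {a - c..b - c} \<theta> \<partial>lborel)"
  proof (rule nn_integral_cong)
    fix \<theta>
    have "shrink_int S f k \<alpha> (c + \<theta>) b = shrink_int ?S ?f k (\<alpha> - c) \<theta> (b - c)"
      "shrink_int S f k \<alpha> a (c + \<theta>) = shrink_int ?S ?f k (\<alpha> - c) (a - c) \<theta>"
      using Suc[of \<alpha> "c + \<theta>" b] Suc[of \<alpha> a "c + \<theta>"] by simp_all
    moreover have "indicator {a..b} (c + \<theta>) = (indicator {a - c..b - c} \<theta> :: ennreal)"
      by (auto simp: indicator_def)
    moreover have "c + \<theta> < \<alpha> \<longleftrightarrow> \<theta> < \<alpha> - c" by auto
    ultimately show "?g (c + 1 * \<theta>) = (if ?S \<theta> then ?f \<theta> else if \<theta> < \<alpha> - c then shrink_int ?S ?f k (\<alpha> - c) \<theta> (b - c)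
      else shrink_int ?S ?f k (\<alpha> - c) (a - c) \<theta>) * indicator {a - c..b - c} \<theta>"
      by (simp add: add.commute)
  qed
  finally show ?case by simp
qed

text \<open>Reversibility of the shrinkage: a rejected angle \<open>\<theta>\<close> lies on the same side of the starting
  angle and of the accepted angle, because both belong to the next bracket. So both directions shrink
  the bracket in the same way.\<close>

lemma shrink_int_symmetric:
  assumes [measurable]: "Measurable.pred borel S" "f \<in> borel_measurable borel"
  shows "(\<integral>\<^sup>+\<alpha>. indicator {\<alpha>. S \<alpha>} \<alpha> * indicator {a..b} \<alpha> * shrink_int S f k \<alpha> a b \<partial>lborel)
    = (\<integral>\<^sup>+\<alpha>. indicator {\<alpha>. S \<alpha>} \<alpha> * f \<alpha> * indicator {a..b} \<alpha> * shrink_int S (\<lambda>_. 1) k \<alpha> a b \<partial>lborel)"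
proof (induction k arbitrary: a b)
  case 0
  then show ?case by simp
next
  case (Suc k)
  let ?s = "\<lambda>\<alpha>. indicator {\<alpha>. S \<alpha>} \<alpha> :: ennreal" and ?n = "\<lambda>\<alpha>. indicator {\<alpha>. \<not> S \<alpha>} \<alpha> :: ennreal"
    and ?i = "\<lambda>\<alpha>. indicator {a..b} \<alpha> :: ennreal"
  let ?r = "\<lambda>f \<alpha> \<theta>. if \<theta> < \<alpha> then shrink_int S f k \<alpha> \<theta> b else shrink_int S f k \<alpha> a \<theta>"
  \<comment> \<open>Splitting at the first proposal gives a product if it is accepted, symmetric
    under exchanging \<open>g\<close> and \<open>h\<close>, and otherwise an integral over starting
    angles for each fixed rejected \<open>\<theta>\<close>, to which the induction hypothesis can be
    applied.\<close>
  have expand: "(\<integral>\<^sup>+\<alpha>. ?s \<alpha> * g \<alpha> * ?i \<alpha> * shrink_int S h (Suc k) \<alpha> a b \<partial>lborel)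
     = ((\<integral>\<^sup>+\<theta>. ?s \<theta> * h \<theta> * ?i \<theta> \<partial>lborel) * (\<integral>\<^sup>+\<alpha>. ?s \<alpha> * g \<alpha> * ?i \<alpha> \<partial>lborel)
       + (\<integral>\<^sup>+\<theta>. ?n \<theta> * ?i \<theta> * (\<integral>\<^sup>+\<alpha>. ?s \<alpha> * g \<alpha> * ?i \<alpha> * ?r h \<alpha> \<theta> \<partial>lborel) \<partial>lborel)) / ennreal (b - a)"
    if [measurable]: "g \<in> borel_measurable borel" "h \<in> borel_measurable borel" for g h
  proof -
    have "(\<integral>\<^sup>+\<alpha>. ?s \<alpha> * g \<alpha> * ?i \<alpha> * shrink_int S h (Suc k) \<alpha> a b \<partial>lborel)
       = (\<integral>\<^sup>+\<alpha>. (?s \<alpha> * g \<alpha> * ?i \<alpha> * (\<integral>\<^sup>+\<theta>. (if S \<theta> then h \<theta> else ?r h \<alpha> \<theta>) * ?i \<theta> \<partial>lborel)) / ennreal (b - a) \<partial>lborel)"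
      by (simp add: ennreal_times_divide)
    also have "\<dots> = (\<integral>\<^sup>+\<alpha>. ?s \<alpha> * g \<alpha> * ?i \<alpha> * (\<integral>\<^sup>+\<theta>. (if S \<theta> then h \<theta> else ?r h \<alpha> \<theta>) * ?i \<theta> \<partial>lborel) \<partial>lborel) / ennreal (b - a)"
      by (rule nn_integral_divide) measurable
    also have "(\<integral>\<^sup>+\<alpha>. ?s \<alpha> * g \<alpha> * ?i \<alpha> * (\<integral>\<^sup>+\<theta>. (if S \<theta> then h \<theta> else ?r h \<alpha> \<theta>) * ?i \<theta> \<partial>lborel) \<partial>lborel)
        = (\<integral>\<^sup>+\<alpha>. \<integral>\<^sup>+\<theta>. ?s \<alpha> * g \<alpha> * ?i \<alpha> * ((if S \<theta> then h \<theta> else ?r h \<alpha> \<theta>) * ?i \<theta>) \<partial>lborel \<partial>lborel)"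
      by (subst nn_integral_cmult) auto
    also have "\<dots> = (\<integral>\<^sup>+\<theta>. \<integral>\<^sup>+\<alpha>. ?s \<alpha> * g \<alpha> * ?i \<alpha> * ((if S \<theta> then h \<theta> else ?r h \<alpha> \<theta>) * ?i \<theta>) \<partial>lborel \<partial>lborel)"
      by (rule lborel_pair.Fubini') measurable
    also have "\<dots> = (\<integral>\<^sup>+\<theta>. ?s \<theta> * h \<theta> * ?i \<theta> * (\<integral>\<^sup>+\<alpha>. ?s \<alpha> * g \<alpha> * ?i \<alpha> \<partial>lborel)
       + ?n \<theta> * ?i \<theta> * (\<integral>\<^sup>+\<alpha>. ?s \<alpha> * g \<alpha> * ?i \<alpha> * ?r h \<alpha> \<theta> \<partial>lborel) \<partial>lborel)"
    proof (rule nn_integral_cong)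
      fix \<theta>
      show "(\<integral>\<^sup>+\<alpha>. ?s \<alpha> * g \<alpha> * ?i \<alpha> * ((if S \<theta> then h \<theta> else ?r h \<alpha> \<theta>) * ?i \<theta>) \<partial>lborel)
        = ?s \<theta> * h \<theta> * ?i \<theta> * (\<integral>\<^sup>+\<alpha>. ?s \<alpha> * g \<alpha> * ?i \<alpha> \<partial>lborel)
         + ?n \<theta> * ?i \<theta> * (\<integral>\<^sup>+\<alpha>. ?s \<alpha> * g \<alpha> * ?i \<alpha> * ?r h \<alpha> \<theta> \<partial>lborel)"
      proof (cases "S \<theta>")
        case True
        then have "(\<integral>\<^sup>+\<alpha>. ?s \<alpha> * g \<alpha> * ?i \<alpha> * ((if S \<theta> then h \<theta> else ?r h \<alpha> \<theta>) * ?i \<theta>) \<partial>lborel)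
          = (\<integral>\<^sup>+\<alpha>. (?s \<alpha> * g \<alpha> * ?i \<alpha>) * (h \<theta> * ?i \<theta>) \<partial>lborel)"
          by simp
        also have "\<dots> = (\<integral>\<^sup>+\<alpha>. ?s \<alpha> * g \<alpha> * ?i \<alpha> \<partial>lborel) * (h \<theta> * ?i \<theta>)"
          by (rule nn_integral_multc) measurable
        finally show ?thesis using True by (simp add: mult_ac)
      next
        case False
        then have "(\<integral>\<^sup>+\<alpha>. ?s \<alpha> * g \<alpha> * ?i \<alpha> * ((if S \<theta> then h \<theta> else ?r h \<alpha> \<theta>) * ?i \<theta>) \<partial>lborel)
          = (\<integral>\<^sup>+\<alpha>. (?s \<alpha> * g \<alpha> * ?i \<alpha> * ?r h \<alpha> \<theta>) * ?i \<theta> \<partial>lborel)"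
          by (simp only: if_False mult.assoc)
        also have "\<dots> = (\<integral>\<^sup>+\<alpha>. ?s \<alpha> * g \<alpha> * ?i \<alpha> * ?r h \<alpha> \<theta> \<partial>lborel) * ?i \<theta>"
          by (rule nn_integral_multc) measurable
        finally show ?thesis using False by (simp add: mult_ac)
      qed
    qed
    also have "\<dots> = (\<integral>\<^sup>+\<theta>. ?s \<theta> * h \<theta> * ?i \<theta> \<partial>lborel) * (\<integral>\<^sup>+\<alpha>. ?s \<alpha> * g \<alpha> * ?i \<alpha> \<partial>lborel)
       + (\<integral>\<^sup>+\<theta>. ?n \<theta> * ?i \<theta> * (\<integral>\<^sup>+\<alpha>. ?s \<alpha> * g \<alpha> * ?i \<alpha> * ?r h \<alpha> \<theta> \<partial>lborel) \<partial>lborel)"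
      by (subst nn_integral_add) (auto simp: nn_integral_multc)
    finally show ?thesis .
  qed
  have reject: "?n \<theta> * ?i \<theta> * (\<integral>\<^sup>+\<alpha>. ?s \<alpha> * 1 * ?i \<alpha> * ?r f \<alpha> \<theta> \<partial>lborel)
      = ?n \<theta> * ?i \<theta> * (\<integral>\<^sup>+\<alpha>. ?s \<alpha> * f \<alpha> * ?i \<alpha> * ?r (\<lambda>_. 1) \<alpha> \<theta> \<partial>lborel)" for \<theta>
  proof (cases "\<not> S \<theta> \<and> a \<le> \<theta> \<and> \<theta> \<le> b")
    case False
    then show ?thesis by (auto simp: indicator_def)
  next
    case True
    \<comment> \<open>The two closed brackets share the point \<open>\<theta>\<close>, but it is
      rejected, so the indicator of \<open>S\<close> prevents double counting.\<close>
    have split: "(\<integral>\<^sup>+\<alpha>. ?s \<alpha> * g \<alpha> * ?i \<alpha> * ?r h \<alpha> \<theta> \<partial>lborel)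
      = (\<integral>\<^sup>+\<alpha>. ?s \<alpha> * g \<alpha> * indicator {\<theta>..b} \<alpha> * shrink_int S h k \<alpha> \<theta> b \<partial>lborel)
        + (\<integral>\<^sup>+\<alpha>. ?s \<alpha> * g \<alpha> * indicator {a..\<theta>} \<alpha> * shrink_int S h k \<alpha> a \<theta> \<partial>lborel)"
      if [measurable]: "g \<in> borel_measurable borel" "h \<in> borel_measurable borel" for g h
    proof -
      have "?s \<alpha> * g \<alpha> * ?i \<alpha> * ?r h \<alpha> \<theta> = ?s \<alpha> * g \<alpha> * indicator {\<theta>..b} \<alpha> * shrink_int S h k \<alpha> \<theta> b
          + ?s \<alpha> * g \<alpha> * indicator {a..\<theta>} \<alpha> * shrink_int S h k \<alpha> a \<theta>" for \<alpha>
        using True by (cases "\<alpha> = \<theta>") (auto simp: indicator_def)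
      then show ?thesis by (simp only:) (subst nn_integral_add, auto)
    qed
    show ?thesis
      using Suc[of \<theta> b] Suc[of a \<theta>] split[of "\<lambda>_. 1" f] split[of f "\<lambda>_. 1"] by simp
  qed
  show ?case
    using expand[of "\<lambda>_. 1" f] expand[of f "\<lambda>_. 1"] reject by (simp add: mult.commute)
qed

section \<open>The kernel of the shrinking procedure\<close>

lemma measurable_shrink_loop_tuple:
  fixes G :: "real ^ 'n \<Rightarrow> real"
  assumes [measurable]: "G \<in> borel_measurable borel"
  shows "(\<lambda>(x, t, w, \<theta>, a, b). shrink_loop G x t w k \<theta> a b)
    \<in> borel \<Otimes>\<^sub>M borel \<Otimes>\<^sub>M borel \<Otimes>\<^sub>M borel \<Otimes>\<^sub>M borel \<Otimes>\<^sub>M borel \<rightarrow>\<^sub>M subprob_algebra borel"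
proof (induction k)
  case 0
  have "subprob_space (null_measure (borel :: (real ^ 'n) measure))" by standard auto
  then have "null_measure borel \<in> space (subprob_algebra (borel :: (real ^ 'n) measure))"
    by (auto simp: space_subprob_algebra)
  then show ?case by (simp add: split_beta')
next
  case (Suc k)
  let ?M = "(borel :: (real ^ 'n) measure) \<Otimes>\<^sub>M (borel :: real measure) \<Otimes>\<^sub>M (borel :: (real ^ 'n) measure) \<Otimes>\<^sub>M (borel :: real measure) \<Otimes>\<^sub>M (borel :: real measure) \<Otimes>\<^sub>M (borel :: real measure)"
  define X where "X = (\<lambda>p :: (real ^ 'n) \<times> real \<times> (real ^ 'n) \<times> real \<times> real \<times> real. fst p)"
  define T where "T = (\<lambda>p :: (real ^ 'n) \<times> real \<times> (real ^ 'n) \<times> real \<times> real \<times> real. fst (snd p))"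
  define W where "W = (\<lambda>p :: (real ^ 'n) \<times> real \<times> (real ^ 'n) \<times> real \<times> real \<times> real. fst (snd (snd p)))"
  define H where "H = (\<lambda>p :: (real ^ 'n) \<times> real \<times> (real ^ 'n) \<times> real \<times> real \<times> real. fst (snd (snd (snd p))))"
  define a where "a = (\<lambda>p :: (real ^ 'n) \<times> real \<times> (real ^ 'n) \<times> real \<times> real \<times> real. fst (snd (snd (snd (snd p)))))"
  define b where "b = (\<lambda>p :: (real ^ 'n) \<times> real \<times> (real ^ 'n) \<times> real \<times> real \<times> real. snd (snd (snd (snd (snd p)))))"
  have [measurable]: "X \<in> borel_measurable ?M" "T \<in> borel_measurable ?M" "W \<in> borel_measurable ?M"
    "H \<in> borel_measurable ?M" "a \<in> borel_measurable ?M" "b \<in> borel_measurable ?M"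
    unfolding X_def T_def W_def H_def a_def b_def by measurable
  define y where "y = (\<lambda>p. cos (H p) *\<^sub>R X p + sin (H p) *\<^sub>R W p)"
  define a' where "a' = (\<lambda>p. if H p < 0 then H p else a p)"
  define b' where "b' = (\<lambda>p. if H p < 0 then b p else H p)"
  have [measurable]: "y \<in> borel_measurable ?M" "a' \<in> borel_measurable ?M" "b' \<in> borel_measurable ?M"
    unfolding y_def a'_def b'_def by measurable
  have next_loop: "(\<lambda>q. shrink_loop G (X (fst q)) (T (fst q)) (W (fst q)) k (snd q) (a' (fst q)) (b' (fst q))) \<in> ?M \<Otimes>\<^sub>M borel \<rightarrow>\<^sub>M subprob_algebra borel"
    using measurable_compose[OF _ Suc, of "\<lambda>q. (X (fst q), T (fst q), W (fst q), snd q, a' (fst q), b' (fst q))" "?M \<Otimes>\<^sub>M borel"]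
    by simp
  have "(\<lambda>p. if exp (- G (y p)) < T p then uniform_dist (a' p) (b' p) \<bind> (\<lambda>\<theta>'. shrink_loop G (X p) (T p) (W p) k \<theta>' (a' p) (b' p))
      else return borel (y p)) \<in> ?M \<rightarrow>\<^sub>M subprob_algebra borel"
  proof (rule measurable_If)
    show "(\<lambda>p. uniform_dist (a' p) (b' p) \<bind> (\<lambda>\<theta>'. shrink_loop G (X p) (T p) (W p) k \<theta>' (a' p) (b' p))) \<in> ?M \<rightarrow>\<^sub>M subprob_algebra borel"
      by (rule measurable_bind[where N = borel, OF measurable_uniform_dist next_loop]) measurable
    show "(\<lambda>p. return borel (y p)) \<in> ?M \<rightarrow>\<^sub>M subprob_algebra borel"
      by (rule measurable_compose[OF _ return_measurable]) measurable
    show "{p \<in> space ?M. exp (- G (y p)) < T p} \<in> sets ?M" by measurable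
  qed
  then show ?case
    unfolding X_def T_def W_def H_def a_def b_def y_def a'_def b'_def by (simp add: split_beta' Let_def)
qed

lemma measurable_shrink_loop:
  fixes G :: "real ^ 'n \<Rightarrow> real"
  assumes "G \<in> borel_measurable borel"
    and [measurable]: "x \<in> borel_measurable M" "t \<in> borel_measurable M" "w \<in> borel_measurable M"
      "\<theta> \<in> borel_measurable M" "a \<in> borel_measurable M" "b \<in> borel_measurable M"
  shows "(\<lambda>p. shrink_loop G (x p) (t p) (w p) k (\<theta> p) (a p) (b p)) \<in> M \<rightarrow>\<^sub>M subprob_algebra borel"
  using measurable_compose[OF _ measurable_shrink_loop_tuple[OF assms(1)], of "\<lambda>p. (x p, t p, w p, \<theta> p, a p, b p)" M k] by simp

definition ellipse_point :: "real ^ 'n \<Rightarrow> real ^ 'n \<Rightarrow> real \<Rightarrow> real ^ 'n" where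
  "ellipse_point x w \<theta> = cos \<theta> *\<^sub>R x + sin \<theta> *\<^sub>R w"

lemma measurable_ellipse_point [measurable (raw)]:
  assumes [measurable]: "x \<in> borel_measurable M" "w \<in> borel_measurable M" "\<theta> \<in> borel_measurable M"
  shows "(\<lambda>p. ellipse_point (x p) (w p) (\<theta> p)) \<in> borel_measurable M"
  unfolding ellipse_point_def by measurable

lemma emeasure_shrink_loop_Suc:
  assumes G: "G \<in> borel_measurable borel" and A [measurable]: "A \<in> sets borel"
  shows "emeasure (shrink_loop G x t w (Suc k) \<theta> a b) A =
    (if t \<le> exp (- G (ellipse_point x w \<theta>)) then indicator A (ellipse_point x w \<theta>)
     else if \<theta> < 0 then (\<integral>\<^sup>+\<theta>'. emeasure (shrink_loop G x t w k \<theta>' \<theta> b) A \<partial>uniform_dist \<theta> b)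
     else (\<integral>\<^sup>+\<theta>'. emeasure (shrink_loop G x t w k \<theta>' a \<theta>) A \<partial>uniform_dist a \<theta>))"
proof -
  have "emeasure (uniform_dist c d \<bind> (\<lambda>\<theta>'. shrink_loop G x t w k \<theta>' c d)) A
      = (\<integral>\<^sup>+\<theta>'. emeasure (shrink_loop G x t w k \<theta>' c d) A \<partial>uniform_dist c d)" for c d
    by (rule emeasure_bind[OF _ measurable_shrink_loop[OF G] A]) auto
  then show ?thesis by (simp add: Let_def ellipse_point_def not_less[symmetric])
qed

lemma measurable_emeasure_shrink_loop [measurable (raw)]:
  assumes "G \<in> borel_measurable borel" "A \<in> sets borel"
    and "x \<in> borel_measurable M" "t \<in> borel_measurable M" "w \<in> borel_measurable M"
      "\<theta> \<in> borel_measurable M" "a \<in> borel_measurable M" "b \<in> borel_measurable M"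
  shows "(\<lambda>p. emeasure (shrink_loop G (x p) (t p) (w p) k (\<theta> p) (a p) (b p)) A) \<in> borel_measurable M"
  by (rule measurable_emeasure_kernel[OF measurable_shrink_loop[OF assms(1,3-)] assms(2)])

text \<open>The loop tests an angle that it has received, whereas \<open>shrink_int\<close> begins
  by drawing one; averaging over the received angle aligns the recursions. The starting angle is 0
  because it represents \<open>x\<close>.\<close>

lemma emeasure_shrink_loop_average:
  assumes G [measurable]: "G \<in> borel_measurable borel" and A [measurable]: "A \<in> sets borel"
  shows "(\<integral>\<^sup>+\<theta>. emeasure (shrink_loop G x t w k \<theta> a b) A \<partial>uniform_dist a b)
    = shrink_int (\<lambda>\<theta>. t \<le> exp (- G (ellipse_point x w \<theta>))) (\<lambda>\<theta>. indicator A (ellipse_point x w \<theta>)) k 0 a b"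
proof (induction k arbitrary: a b)
  case 0
  then show ?case by simp
next
  case (Suc k)
  show ?case
    unfolding emeasure_shrink_loop_Suc[OF G A] Suc shrink_int.simps
    by (rule nn_integral_uniform_dist) measurable
qed

lemma emeasure_shrink_loop_mono:
  assumes G [measurable]: "G \<in> borel_measurable borel" and A [measurable]: "A \<in> sets borel"
  shows "emeasure (shrink_loop G x t w k \<theta> a b) A \<le> emeasure (shrink_loop G x t w (Suc k) \<theta> a b) A"
proof (induction k arbitrary: \<theta> a b)
  case 0
  then show ?case by simp
next
  case (Suc k)
  show ?case
    unfolding emeasure_shrink_loop_Suc[OF G A, of x t w k \<theta> a b] emeasure_shrink_loop_Suc[OF G A, of x t w "Suc k" \<theta> a b]
    using Suc by (auto intro!: nn_integral_mono simp del: shrink_loop.simps)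
qed

section \<open>The truncated and the full shrinking procedure as kernels\<close>

context pos_def_matrix begin

lemma measurable_shrink_ellipse_upto:
  assumes G [measurable]: "G \<in> borel_measurable borel"
    and [measurable]: "x \<in> borel_measurable M" "t \<in> borel_measurable M"
  shows "(\<lambda>p. shrink_ellipse_upto C G k (x p) (t p)) \<in> M \<rightarrow>\<^sub>M subprob_algebra borel"
  unfolding shrink_ellipse_upto_def
proof (intro measurable_bind[where N = borel])
  show "(\<lambda>p. gaussian C) \<in> M \<rightarrow>\<^sub>M subprob_algebra borel"
    by (rule measurable_prob_algebraD[OF measurable_gaussian_kernel])
  show "(\<lambda>p. uniform_dist 0 (2 * pi)) \<in> M \<Otimes>\<^sub>M borel \<rightarrow>\<^sub>M subprob_algebra borel"
    by (rule measurable_uniform_dist) measurable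
  show "(\<lambda>p. shrink_loop G (x (fst (fst p))) (t (fst (fst p))) (snd (fst p)) k (snd p) (snd p - 2 * pi) (snd p))
    \<in> (M \<Otimes>\<^sub>M borel) \<Otimes>\<^sub>M borel \<rightarrow>\<^sub>M subprob_algebra borel"
    by (rule measurable_shrink_loop[OF G]) measurable
qed

lemma emeasure_shrink_ellipse_upto:
  assumes G [measurable]: "G \<in> borel_measurable borel" and A [measurable]: "A \<in> sets borel"
  shows "emeasure (shrink_ellipse_upto C G k x t) A
    = (\<integral>\<^sup>+w. \<integral>\<^sup>+\<theta>. emeasure (shrink_loop G x t w k \<theta> (\<theta> - 2 * pi) \<theta>) A \<partial>uniform_dist 0 (2 * pi) \<partial>gaussian C)"
proof -
  have "(\<lambda>w. uniform_dist 0 (2 * pi) \<bind> (\<lambda>\<theta>. shrink_loop G x t w k \<theta> (\<theta> - 2 * pi) \<theta>)) \<in> gaussian C \<rightarrow>\<^sub>M subprob_algebra borel"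
  proof (intro measurable_bind[where N = borel])
    show "(\<lambda>p. uniform_dist 0 (2 * pi)) \<in> gaussian C \<rightarrow>\<^sub>M subprob_algebra borel"
      by (rule measurable_uniform_dist) measurable
    show "(\<lambda>p. shrink_loop G x t (fst p) k (snd p) (snd p - 2 * pi) (snd p)) \<in> gaussian C \<Otimes>\<^sub>M borel \<rightarrow>\<^sub>M subprob_algebra borel"
      by (rule measurable_shrink_loop[OF G]) measurable
  qed
  then have "emeasure (shrink_ellipse_upto C G k x t) A
     = (\<integral>\<^sup>+w. emeasure (uniform_dist 0 (2 * pi) \<bind> (\<lambda>\<theta>. shrink_loop G x t w k \<theta> (\<theta> - 2 * pi) \<theta>)) A \<partial>gaussian C)"
    unfolding shrink_ellipse_upto_def by (intro emeasure_bind[OF _ _ A]) auto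
  also have "\<dots> = (\<integral>\<^sup>+w. \<integral>\<^sup>+\<theta>. emeasure (shrink_loop G x t w k \<theta> (\<theta> - 2 * pi) \<theta>) A \<partial>uniform_dist 0 (2 * pi) \<partial>gaussian C)"
    by (intro nn_integral_cong emeasure_bind[OF _ measurable_shrink_loop[OF G] A]) auto
  finally show ?thesis .
qed

lemma emeasure_shrink_ellipse_upto_0:
  "G \<in> borel_measurable borel \<Longrightarrow> A \<in> sets borel \<Longrightarrow> emeasure (shrink_ellipse_upto C G 0 x t) A = 0"
  by (simp add: emeasure_shrink_ellipse_upto)

text \<open>The first angle is almost surely nonnegative, so rejecting it resets the upper end to
  the value it already has: the second proposal still comes from the full turn
  \<open>[\<theta> - 2 * pi, \<theta>]\<close>.\<close>

lemma emeasure_shrink_ellipse_upto_Suc: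
  assumes G [measurable]: "G \<in> borel_measurable borel" and A [measurable]: "A \<in> sets borel"
  shows "emeasure (shrink_ellipse_upto C G (Suc k) x t) A
    = (\<integral>\<^sup>+w. \<integral>\<^sup>+\<theta>. (if t \<le> exp (- G (ellipse_point x w \<theta>)) then indicator A (ellipse_point x w \<theta>)
        else shrink_int (\<lambda>\<theta>. t \<le> exp (- G (ellipse_point x w \<theta>))) (\<lambda>\<theta>. indicator A (ellipse_point x w \<theta>)) k 0 (\<theta> - 2 * pi) \<theta>)
        \<partial>uniform_dist 0 (2 * pi) \<partial>gaussian C)"
proof -
  have nonneg: "AE \<theta> in uniform_dist 0 (2 * pi). 0 \<le> \<theta>"
    by (intro AE_uniform_measureI) auto
  show ?thesis
    unfolding emeasure_shrink_ellipse_upto[OF G A] emeasure_shrink_loop_Suc[OF G A] emeasure_shrink_loop_average[OF G A]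
    by (intro nn_integral_cong nn_integral_cong_AE eventually_mono[OF nonneg]) auto
qed

lemma subprob_shrink_ellipse_upto:
  assumes "G \<in> borel_measurable borel"
  shows "subprob_space (shrink_ellipse_upto C G k x t)" "sets (shrink_ellipse_upto C G k x t) = sets borel"
proof -
  have "shrink_ellipse_upto C G k x t \<in> space (subprob_algebra borel)"
    using measurable_space[OF measurable_shrink_ellipse_upto[OF assms, of fst "borel \<Otimes>\<^sub>M borel" snd k], of "(x, t)"]
    by (simp add: space_pair_measure)
  then show "subprob_space (shrink_ellipse_upto C G k x t)" "sets (shrink_ellipse_upto C G k x t) = sets borel"
    by (auto simp: space_subprob_algebra)
qed

lemma emeasure_shrink_ellipse_upto_le_1:
  "G \<in> borel_measurable borel \<Longrightarrow> emeasure (shrink_ellipse_upto C G k x t) A \<le> 1"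
  using subprob_shrink_ellipse_upto(1) by (rule subprob_space.subprob_emeasure_le_1)

lemma incseq_shrink_ellipse_upto:
  assumes G: "G \<in> borel_measurable borel" and A: "A \<in> sets borel"
  shows "incseq (\<lambda>k. emeasure (shrink_ellipse_upto C G k x t) A)"
  unfolding emeasure_shrink_ellipse_upto[OF G A]
  by (intro incseq_SucI nn_integral_mono emeasure_shrink_loop_mono[OF G A])

text \<open>The set function in the definition must be shown to be countably additive. Monotonicity
  in \<open>k\<close> lets the supremum commute with the sum over disjoint sets, and the rest is a
  point mass that fills the total up to 1.\<close>

lemma
  assumes G: "G \<in> borel_measurable borel"
  shows emeasure_shrink_ellipse: "A \<in> sets borel \<Longrightarrow> emeasure (shrink_ellipse C G x t) A =
    (SUP k. emeasure (shrink_ellipse_upto C G k x t) A)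
     + (1 - (SUP k. emeasure (shrink_ellipse_upto C G k x t) UNIV)) * indicator A x" (is "_ \<Longrightarrow> _ = ?\<mu> A")
    and sets_shrink_ellipse: "sets (shrink_ellipse C G x t) = sets borel"
    and prob_space_shrink_ellipse: "prob_space (shrink_ellipse C G x t)"
proof -
  let ?U = "\<lambda>k. shrink_ellipse_upto C G k x t"
  let ?r = "1 - (SUP k. emeasure (?U k) UNIV)"
  have sigma: "sigma_algebra UNIV (sets (borel :: (real ^ 'n) measure))"
    using sets.sigma_algebra_axioms[of "borel :: (real ^ 'n) measure"] by simp
  have sets: "sets (shrink_ellipse C G x t) = sets borel"
    unfolding shrink_ellipse_def using sigma_algebra.sigma_sets_eq[OF sigma] by (subst sets_measure_of) auto
  have pos: "positive (sets (shrink_ellipse C G x t)) ?\<mu>" by (simp add: positive_def)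
  have ca: "countably_additive (sets (shrink_ellipse C G x t)) ?\<mu>"
    unfolding sets
  proof (rule countably_additiveI)
    fix A :: "nat \<Rightarrow> (real ^ 'n) set"
    assume A: "range A \<subseteq> sets borel" "disjoint_family A" "(\<Union>i. A i) \<in> sets borel"
    have A': "A i \<in> sets borel" for i using A(1) by auto
    have "(\<Sum>i. ?\<mu> (A i)) = (\<Sum>i. SUP k. emeasure (?U k) (A i)) + (\<Sum>i. ?r * indicator (A i) x)"
      by (rule suminf_add[symmetric]) auto
    also have "(\<Sum>i. SUP k. emeasure (?U k) (A i)) = (SUP k. \<Sum>i. emeasure (?U k) (A i))"
      by (rule ennreal_suminf_SUP_eq) (rule incseq_shrink_ellipse_upto[OF G A'])
    also have "\<dots> = (SUP k. emeasure (?U k) (\<Union>i. A i))"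
      using A subprob_shrink_ellipse_upto(2)[OF G] by (intro SUP_cong refl suminf_emeasure) auto
    also have "(\<Sum>i. ?r * indicator (A i) x) = ?r * indicator (\<Union>i. A i) x"
      using suminf_indicator[OF A(2), of x] by (simp add: ennreal_suminf_cmult)
    finally show "(\<Sum>i. ?\<mu> (A i)) = ?\<mu> (\<Union>i. A i)" .
  qed
  show em: "emeasure (shrink_ellipse C G x t) A = ?\<mu> A" if "A \<in> sets borel" for A
    by (rule emeasure_measure_of[OF shrink_ellipse_def _ pos ca]) (use that sets in auto)
  show "sets (shrink_ellipse C G x t) = sets borel" by (rule sets)
  show "prob_space (shrink_ellipse C G x t)"
  proof
    have "space (shrink_ellipse C G x t) = UNIV" using sets_eq_imp_space_eq[OF sets] by simp
    moreover have "(SUP k. emeasure (?U k) UNIV) \<le> 1"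
      by (intro SUP_least emeasure_shrink_ellipse_upto_le_1[OF G])
    ultimately show "emeasure (shrink_ellipse C G x t) (space (shrink_ellipse C G x t)) = 1"
      by (simp add: em add_diff_inverse_ennreal)
  qed
qed

lemma measurable_shrink_ellipse:
  assumes G [measurable]: "G \<in> borel_measurable borel"
    and x [measurable]: "x \<in> borel_measurable M" and t [measurable]: "t \<in> borel_measurable M"
  shows "(\<lambda>p. shrink_ellipse C G (x p) (t p)) \<in> M \<rightarrow>\<^sub>M prob_algebra borel"
proof (intro measurable_prob_algebraI measurable_subprob_algebra)
  fix p
  show "prob_space (shrink_ellipse C G (x p) (t p))" by (rule prob_space_shrink_ellipse[OF G])
  then show "subprob_space (shrink_ellipse C G (x p) (t p))" by (rule prob_space_imp_subprob_space)
  show "sets (shrink_ellipse C G (x p) (t p)) = sets borel" by (rule sets_shrink_ellipse[OF G])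
next
  fix A :: "(real ^ 'n) set" assume A [measurable]: "A \<in> sets borel"
  have [measurable]: "(\<lambda>p. emeasure (shrink_ellipse_upto C G k (x p) (t p)) D) \<in> borel_measurable M" if "D \<in> sets borel" for k D
    by (rule measurable_emeasure_kernel[OF measurable_shrink_ellipse_upto[OF G x t] that])
  show "(\<lambda>p. emeasure (shrink_ellipse C G (x p) (t p)) A) \<in> borel_measurable M"
    unfolding emeasure_shrink_ellipse[OF G A] by measurable
qed

end

section \<open>Invariance of the ESS kernel on level sets\<close>

context pos_def_matrix begin

abbreviation gaussian2 :: "((real ^ 'n) \<times> (real ^ 'n)) measure" where
  "gaussian2 \<equiv> gaussian C \<Otimes>\<^sub>M gaussian C"

lemma nn_integral_gaussian2:
  assumes [measurable]: "H \<in> borel_measurable (borel \<Otimes>\<^sub>M borel)"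
  shows "(\<integral>\<^sup>+z. H z \<partial>gaussian2) = (\<integral>\<^sup>+x. \<integral>\<^sup>+w. H (x, w) \<partial>gaussian C \<partial>gaussian C)"
proof -
  interpret prob_space "gaussian C" by (rule prob_space_gaussian)
  show ?thesis by (rule nn_integral_fst[symmetric]) measurable
qed

lemma gaussian2_reflect:
  assumes [measurable]: "H \<in> borel_measurable (borel \<Otimes>\<^sub>M borel)" and "c\<^sup>2 + s\<^sup>2 = 1" "s \<noteq> 0"
  shows "(\<integral>\<^sup>+z. H (c *\<^sub>R fst z + s *\<^sub>R snd z, s *\<^sub>R fst z - c *\<^sub>R snd z) \<partial>gaussian2) = (\<integral>\<^sup>+z. H z \<partial>gaussian2)"
  using gaussian_reflect[OF assms] by (simp add: nn_integral_gaussian2)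

lemma gaussian2_rotate:
  assumes [measurable]: "H \<in> borel_measurable (borel \<Otimes>\<^sub>M borel)" and "c\<^sup>2 + s\<^sup>2 = 1" "s \<noteq> 0"
  shows "(\<integral>\<^sup>+z. H (c *\<^sub>R fst z - s *\<^sub>R snd z, s *\<^sub>R fst z + c *\<^sub>R snd z) \<partial>gaussian2) = (\<integral>\<^sup>+z. H z \<partial>gaussian2)"
  using gaussian_rotate[OF assms] by (simp add: nn_integral_gaussian2)

lemma pair_sigma_finite_gaussian2: "pair_sigma_finite gaussian2 (lborel :: real measure)"
proof -
  interpret prob_space "gaussian C" by (rule prob_space_gaussian)
  interpret pair_prob_space "gaussian C" "gaussian C" ..
  show ?thesis ..
qed

end

text \<open>The reflection and rotation formulas require \<open>s \<noteq> 0\<close>, here the sine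
  of the first angle; the exceptional angles are countably many.\<close>

lemma AE_sin_nonzero: "AE \<theta> in lborel. sin \<theta> \<noteq> (0 :: real)"
proof -
  have "{\<theta> :: real. sin \<theta> = 0} = (\<lambda>i. real_of_int i * pi) ` UNIV"
    by (auto simp: sin_zero_iff_int2)
  then have "countable {\<theta> :: real. sin \<theta> = 0}" by simp
  then have "{\<theta> :: real. sin \<theta> = 0} \<in> null_sets lborel" by (rule countable_imp_null_set_lborel)
  then show ?thesis by (auto dest!: AE_not_in)
qed

section \<open>Balance on a level set, split at the first proposal\<close>

context angular_target begin

definition level :: "real \<Rightarrow> (real ^ 'n) set" where
  "level t = {x. t \<le> \<psi> x}"

lemma measurable_level [measurable]: "level t \<in> sets borel"
  unfolding level_def by measurable

abbreviation pt :: "(real ^ 'n) \<times> (real ^ 'n) \<Rightarrow> real \<Rightarrow> real ^ 'n" where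
  "pt z \<equiv> ellipse_point (fst z) (snd z)"

definition shrink_from :: "real \<Rightarrow> (real ^ 'n) set \<Rightarrow> (real ^ 'n) \<times> (real ^ 'n) \<Rightarrow> nat \<Rightarrow> real \<Rightarrow> real \<Rightarrow> real \<Rightarrow> ennreal" where
  "shrink_from t D z = shrink_int (\<lambda>\<theta>. pt z \<theta> \<in> level t) (\<lambda>\<theta>. indicator D (pt z \<theta>))"

lemma measurable_shrink_from [measurable (raw)]:
  assumes [measurable]: "D \<in> sets borel" "z \<in> N \<rightarrow>\<^sub>M borel \<Otimes>\<^sub>M borel"
    "\<alpha> \<in> borel_measurable N" "a \<in> borel_measurable N" "b \<in> borel_measurable N"
  shows "(\<lambda>x. shrink_from t D (z x) k (\<alpha> x) (a x) (b x)) \<in> borel_measurable N"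
  unfolding shrink_from_def
  by (rule measurable_shrink_int_param[where M = "borel \<Otimes>\<^sub>M borel" and S = "\<lambda>z \<theta>. pt z \<theta> \<in> level t" and f = "\<lambda>z \<theta>. indicator D (pt z \<theta>)"])
     measurable

lemma emeasure_upto_Suc:
  assumes [measurable]: "D \<in> sets borel"
  shows "emeasure (shrink_ellipse_upto C (\<lambda>z. \<Phi> (proj z)) (Suc k) x t) D
    = (\<integral>\<^sup>+w. (\<integral>\<^sup>+\<theta>. (indicator (level t) (ellipse_point x w \<theta>) * indicator D (ellipse_point x w \<theta>)
        + indicator (- level t) (ellipse_point x w \<theta>) * shrink_from t D (x, w) k 0 (\<theta> - 2 * pi) \<theta>) * indicator {0..2 * pi} \<theta> \<partial>lborel)
        / ennreal (2 * pi) \<partial>gaussian C)"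
proof -
  have "emeasure (shrink_ellipse_upto C (\<lambda>z. \<Phi> (proj z)) (Suc k) x t) D = (\<integral>\<^sup>+w. \<integral>\<^sup>+\<theta>. (if ellipse_point x w \<theta> \<in> level t then indicator D (ellipse_point x w \<theta>)
        else shrink_from t D (x, w) k 0 (\<theta> - 2 * pi) \<theta>) \<partial>uniform_dist 0 (2 * pi) \<partial>gaussian C)"
  proof -
    have G: "(\<lambda>z. \<Phi> (proj z)) \<in> borel_measurable borel" by measurable
    show ?thesis
      by (simp only: emeasure_shrink_ellipse_upto_Suc[OF G assms] shrink_from_def level_def \<psi>_def mem_Collect_eq fst_conv snd_conv)
  qed
  also have "\<dots> = (\<integral>\<^sup>+w. \<integral>\<^sup>+\<theta>. (indicator (level t) (ellipse_point x w \<theta>) * indicator D (ellipse_point x w \<theta>)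
        + indicator (- level t) (ellipse_point x w \<theta>) * shrink_from t D (x, w) k 0 (\<theta> - 2 * pi) \<theta>) \<partial>uniform_dist 0 (2 * pi) \<partial>gaussian C)"
    by (intro nn_integral_cong) (auto simp: indicator_def)
  also have "\<dots> = (\<integral>\<^sup>+w. (\<integral>\<^sup>+\<theta>. (indicator (level t) (ellipse_point x w \<theta>) * indicator D (ellipse_point x w \<theta>)
        + indicator (- level t) (ellipse_point x w \<theta>) * shrink_from t D (x, w) k 0 (\<theta> - 2 * pi) \<theta>) * indicator {0..2 * pi} \<theta> \<partial>lborel)
        / ennreal (2 * pi) \<partial>gaussian C)"
    by (subst nn_integral_uniform_dist) auto
  finally show ?thesis .
qed

text \<open>The first angle is kept fixed, so that a reflection or rotation depending on it can act
  on the Gaussian pair. \<open>D'\<close> constrains the start and \<open>D\<close> the output;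
  symmetry will mean exchanging the two.\<close>

definition accepted :: "real \<Rightarrow> (real ^ 'n) set \<Rightarrow> (real ^ 'n) set \<Rightarrow> real \<Rightarrow> ennreal" where
  "accepted t D' D \<theta> = (\<integral>\<^sup>+z. indicator (level t) (fst z) * indicator D' (fst z)
     * indicator (level t) (pt z \<theta>) * indicator D (pt z \<theta>) \<partial>gaussian2)"

definition rejected :: "real \<Rightarrow> (real ^ 'n) set \<Rightarrow> (real ^ 'n) set \<Rightarrow> nat \<Rightarrow> real \<Rightarrow> ennreal" where
  "rejected t D' D k \<theta> = (\<integral>\<^sup>+z. indicator (level t) (fst z) * indicator D' (fst z)
     * indicator (- level t) (pt z \<theta>) * shrink_from t D z k 0 (\<theta> - 2 * pi) \<theta> \<partial>gaussian2)"

lemma sigma_finite_gaussian2: "sigma_finite_measure gaussian2"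
  using pair_sigma_finite_gaussian2 by (simp add: pair_sigma_finite_def)

lemma measurable_accepted [measurable]: "D \<in> sets borel \<Longrightarrow> D' \<in> sets borel \<Longrightarrow> accepted t D' D \<in> borel_measurable borel"
  and measurable_rejected [measurable]: "D \<in> sets borel \<Longrightarrow> D' \<in> sets borel \<Longrightarrow> rejected t D' D k \<in> borel_measurable borel"
proof -
  interpret sigma_finite_measure gaussian2 by (rule sigma_finite_gaussian2)
  assume [measurable]: "D \<in> sets borel" "D' \<in> sets borel"
  show "accepted t D' D \<in> borel_measurable borel" "rejected t D' D k \<in> borel_measurable borel"
    unfolding accepted_def rejected_def by measurable
qed

lemma level_emeasure_upto_Suc:
  assumes [measurable]: "D \<in> sets borel" "D' \<in> sets borel"
  shows "(\<integral>\<^sup>+x. indicator (level t) x * indicator D' x * emeasure (shrink_ellipse_upto C (\<lambda>z. \<Phi> (proj z)) (Suc k) x t) D \<partial>gaussian C)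
    = ((\<integral>\<^sup>+\<theta>. accepted t D' D \<theta> * indicator {0..2 * pi} \<theta> \<partial>lborel) + (\<integral>\<^sup>+\<theta>. rejected t D' D k \<theta> * indicator {0..2 * pi} \<theta> \<partial>lborel)) / ennreal (2 * pi)"
proof -
  interpret prob_space "gaussian C" by (rule prob_space_gaussian)
  interpret GL: pair_sigma_finite gaussian2 "lborel :: real measure" by (rule pair_sigma_finite_gaussian2)
  let ?l = "\<lambda>z :: (real ^ 'n) \<times> (real ^ 'n). indicator (level t) (fst z) * indicator D' (fst z) :: ennreal"
  let ?A = "\<lambda>z \<theta>. indicator (level t) (pt z \<theta>) * indicator D (pt z \<theta>) :: ennreal"
  let ?R = "\<lambda>z \<theta>. indicator (- level t) (pt z \<theta>) * shrink_from t D z k 0 (\<theta> - 2 * pi) \<theta> :: ennreal"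
  let ?i = "\<lambda>\<theta>. indicator {0..2 * pi} \<theta> :: ennreal"
  have "(\<integral>\<^sup>+x. indicator (level t) x * indicator D' x * emeasure (shrink_ellipse_upto C (\<lambda>z. \<Phi> (proj z)) (Suc k) x t) D \<partial>gaussian C)
      = (\<integral>\<^sup>+x. \<integral>\<^sup>+w. ?l (x, w) * ((\<integral>\<^sup>+\<theta>. (?A (x, w) \<theta> + ?R (x, w) \<theta>) * ?i \<theta> \<partial>lborel) / ennreal (2 * pi)) \<partial>gaussian C \<partial>gaussian C)"
    unfolding emeasure_upto_Suc[OF assms(1)] fst_conv snd_conv
    by (intro nn_integral_cong nn_integral_cmult[symmetric]) measurable
  also have "\<dots> = (\<integral>\<^sup>+z. ?l z * ((\<integral>\<^sup>+\<theta>. (?A z \<theta> + ?R z \<theta>) * ?i \<theta> \<partial>lborel) / ennreal (2 * pi)) \<partial>gaussian2)"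
    by (subst nn_integral_gaussian2) auto
  also have "\<dots> = (\<integral>\<^sup>+z. (\<integral>\<^sup>+\<theta>. ?l z * ((?A z \<theta> + ?R z \<theta>) * ?i \<theta>) \<partial>lborel) / ennreal (2 * pi) \<partial>gaussian2)"
    by (subst nn_integral_cmult) (auto simp: ennreal_times_divide)
  also have "\<dots> = (\<integral>\<^sup>+z. \<integral>\<^sup>+\<theta>. ?l z * ((?A z \<theta> + ?R z \<theta>) * ?i \<theta>) \<partial>lborel \<partial>gaussian2) / ennreal (2 * pi)"
    by (rule nn_integral_divide) measurable
  also have "(\<integral>\<^sup>+z. \<integral>\<^sup>+\<theta>. ?l z * ((?A z \<theta> + ?R z \<theta>) * ?i \<theta>) \<partial>lborel \<partial>gaussian2)
      = (\<integral>\<^sup>+\<theta>. \<integral>\<^sup>+z. ?l z * ((?A z \<theta> + ?R z \<theta>) * ?i \<theta>) \<partial>gaussian2 \<partial>lborel)"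
    by (rule GL.Fubini'[symmetric]) measurable
  also have "\<dots> = (\<integral>\<^sup>+\<theta>. accepted t D' D \<theta> * ?i \<theta> + rejected t D' D k \<theta> * ?i \<theta> \<partial>lborel)"
  proof (rule nn_integral_cong)
    fix \<theta>
    have "(\<integral>\<^sup>+z. ?l z * ((?A z \<theta> + ?R z \<theta>) * ?i \<theta>) \<partial>gaussian2) = (\<integral>\<^sup>+z. (?l z * ?A z \<theta> + ?l z * ?R z \<theta>) * ?i \<theta> \<partial>gaussian2)"
      by (simp only: distrib_left mult.assoc[symmetric])
    also have "\<dots> = (\<integral>\<^sup>+z. ?l z * ?A z \<theta> + ?l z * ?R z \<theta> \<partial>gaussian2) * ?i \<theta>"
      by (rule nn_integral_multc) measurable
    also have "(\<integral>\<^sup>+z. ?l z * ?A z \<theta> + ?l z * ?R z \<theta> \<partial>gaussian2) = (\<integral>\<^sup>+z. ?l z * ?A z \<theta> \<partial>gaussian2) + (\<integral>\<^sup>+z. ?l z * ?R z \<theta> \<partial>gaussian2)"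
      by (rule nn_integral_add) measurable
    finally show "(\<integral>\<^sup>+z. ?l z * ((?A z \<theta> + ?R z \<theta>) * ?i \<theta>) \<partial>gaussian2) = accepted t D' D \<theta> * ?i \<theta> + rejected t D' D k \<theta> * ?i \<theta>"
      by (simp add: accepted_def rejected_def distrib_right mult.assoc)
  qed
  also have "\<dots> = (\<integral>\<^sup>+\<theta>. accepted t D' D \<theta> * ?i \<theta> \<partial>lborel) + (\<integral>\<^sup>+\<theta>. rejected t D' D k \<theta> * ?i \<theta> \<partial>lborel)"
    by (rule nn_integral_add) measurable
  finally show ?thesis .
qed

text \<open>The reflection with angle \<open>\<theta>\<close> exchanges the starting point
  \<open>fst z\<close> and the proposal \<open>pt z \<theta>\<close>, and both are required to lie
  in the level set.\<close>

lemma accepted_symmetric: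
  assumes [measurable]: "D \<in> sets borel" "D' \<in> sets borel" and s: "sin \<theta> \<noteq> 0"
  shows "accepted t D' D \<theta> = accepted t D D' \<theta>"
proof -
  let ?H = "\<lambda>z. indicator (level t) (fst z) * indicator D (fst z) * indicator (level t) (pt z \<theta>) * indicator D' (pt z \<theta>) :: ennreal"
  from reflect_reflect[of "cos \<theta>" _ "sin \<theta>"] have "pt (cos \<theta> *\<^sub>R fst z + sin \<theta> *\<^sub>R snd z, sin \<theta> *\<^sub>R fst z - cos \<theta> *\<^sub>R snd z) \<theta> = fst z" for z :: "(real ^ 'n) \<times> (real ^ 'n)"
    by (simp add: ellipse_point_def)
  then have "?H (cos \<theta> *\<^sub>R fst z + sin \<theta> *\<^sub>R snd z, sin \<theta> *\<^sub>R fst z - cos \<theta> *\<^sub>R snd z)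
      = indicator (level t) (fst z) * indicator D' (fst z) * indicator (level t) (pt z \<theta>) * indicator D (pt z \<theta>)" for z
    by (simp add: ellipse_point_def mult_ac)
  then show ?thesis
    unfolding accepted_def using gaussian2_reflect[of ?H "cos \<theta>" "sin \<theta>"] s by simp
qed

text \<open>Rotating the pair \<open>(x, w)\<close> by the first, rejected angle \<open>\<theta>\<close> moves the rejected point to angle 0,
  so that the bracket becomes \<open>[-2\<pi>, 0]\<close> and the chain starts at angle \<open>-\<theta>\<close>.\<close>

lemma rejected_rotate:
  assumes [measurable]: "D \<in> sets borel" "D' \<in> sets borel" and s: "sin \<theta> \<noteq> 0"
  shows "rejected t D' D k \<theta> = (\<integral>\<^sup>+z. indicator (- level t) (fst z) *
    (indicator (level t) (pt z (- \<theta>)) * indicator D' (pt z (- \<theta>)) * shrink_from t D z k (- \<theta>) (- (2 * pi)) 0) \<partial>gaussian2)"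
proof -
  let ?H = "\<lambda>z. indicator (level t) (fst z) * indicator D' (fst z) * indicator (- level t) (pt z \<theta>) * shrink_from t D z k 0 (\<theta> - 2 * pi) \<theta>"
  let ?rot = "\<lambda>z :: (real ^ 'n) \<times> (real ^ 'n). (cos \<theta> *\<^sub>R fst z - sin \<theta> *\<^sub>R snd z, sin \<theta> *\<^sub>R fst z + cos \<theta> *\<^sub>R snd z)"
  have pt_rot: "pt (?rot z) \<phi> = pt z (\<phi> - \<theta>)" for z \<phi>
    by (simp add: ellipse_point_def cos_diff sin_diff algebra_simps)
  have fst_rot: "fst (?rot z) = pt z (- \<theta>)" for z by (simp add: ellipse_point_def)
  have shift: "shrink_from t D (?rot z) k 0 (\<theta> - 2 * pi) \<theta> = shrink_from t D z k (- \<theta>) (- (2 * pi)) 0" for z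
    unfolding shrink_from_def pt_rot
    by (subst shrink_int_shift[of _ _ _ "- \<theta>" _ _ "- \<theta>"]) auto
  have pt_theta: "pt (?rot z) \<theta> = fst z" for z
    unfolding pt_rot by (simp add: ellipse_point_def)
  have "?H (?rot z) = indicator (- level t) (fst z) *
      (indicator (level t) (pt z (- \<theta>)) * indicator D' (pt z (- \<theta>)) * shrink_from t D z k (- \<theta>) (- (2 * pi)) 0)" for z
    by (simp only: pt_theta shift) (simp only: fst_rot mult_ac)
  then show ?thesis
    unfolding rejected_def using gaussian2_rotate[of ?H "cos \<theta>" "sin \<theta>"] s by simp
qed

text \<open>With \<open>\<alpha> = - \<theta>\<close> the averaging over the first angle becomes an
  integral of the starting angle over the fixed bracket \<open>[- (2 * pi), 0]\<close>. For each
  \<open>z\<close> the inner integral then has the form treated by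
  \<open>shrink_int_symmetric\<close>.\<close>

lemma rejected_average:
  assumes [measurable]: "D \<in> sets borel" "D' \<in> sets borel"
  shows "(\<integral>\<^sup>+\<theta>. rejected t D' D k \<theta> * indicator {0..2 * pi} \<theta> \<partial>lborel)
    = (\<integral>\<^sup>+z. indicator (- level t) (fst z) * (\<integral>\<^sup>+\<alpha>. indicator (level t) (pt z \<alpha>) * indicator D' (pt z \<alpha>)
        * indicator {- (2 * pi)..0} \<alpha> * shrink_from t D z k \<alpha> (- (2 * pi)) 0 \<partial>lborel) \<partial>gaussian2)"
proof -
  interpret GL: pair_sigma_finite gaussian2 "lborel :: real measure" by (rule pair_sigma_finite_gaussian2)
  let ?F = "\<lambda>z \<alpha>. indicator (level t) (pt z \<alpha>) * indicator D' (pt z \<alpha>) * shrink_from t D z k \<alpha> (- (2 * pi)) 0"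
  have "(\<integral>\<^sup>+\<theta>. rejected t D' D k \<theta> * indicator {0..2 * pi} \<theta> \<partial>lborel)
     = (\<integral>\<^sup>+\<theta>. (\<integral>\<^sup>+z. indicator (- level t) (fst z) * ?F z (- \<theta>) \<partial>gaussian2) * indicator {0..2 * pi} \<theta> \<partial>lborel)"
    by (intro nn_integral_cong_AE eventually_mono[OF AE_sin_nonzero]) (simp add: rejected_rotate)
  also have "\<dots> = (\<integral>\<^sup>+\<theta>. \<integral>\<^sup>+z. indicator (- level t) (fst z) * ?F z (- \<theta>) * indicator {0..2 * pi} \<theta> \<partial>gaussian2 \<partial>lborel)"
    by (subst nn_integral_multc) auto
  also have "\<dots> = (\<integral>\<^sup>+z. \<integral>\<^sup>+\<theta>. indicator (- level t) (fst z) * ?F z (- \<theta>) * indicator {0..2 * pi} \<theta> \<partial>lborel \<partial>gaussian2)"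
    by (rule GL.Fubini') measurable
  also have "\<dots> = (\<integral>\<^sup>+z. indicator (- level t) (fst z) * (\<integral>\<^sup>+\<alpha>. indicator (level t) (pt z \<alpha>) * indicator D' (pt z \<alpha>)
        * indicator {- (2 * pi)..0} \<alpha> * shrink_from t D z k \<alpha> (- (2 * pi)) 0 \<partial>lborel) \<partial>gaussian2)"
  proof (rule nn_integral_cong)
    fix z :: "(real ^ 'n) \<times> (real ^ 'n)"
    have [measurable]: "fst z \<in> space borel" "snd z \<in> space borel" "z \<in> space (borel \<Otimes>\<^sub>M borel)" by (auto simp: space_pair_measure)
    have ind: "indicator {0..2 * pi} (- \<alpha>) = (indicator {- (2 * pi)..0} \<alpha> :: ennreal)" for \<alpha> :: real
      by (auto simp: indicator_def)
    have "(\<integral>\<^sup>+\<theta>. indicator (- level t) (fst z) * ?F z (- \<theta>) * indicator {0..2 * pi} \<theta> \<partial>lborel)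
       = (\<integral>\<^sup>+\<alpha>. indicator (- level t) (fst z) * ?F z \<alpha> * indicator {- (2 * pi)..0} \<alpha> \<partial>lborel)"
      by (subst nn_integral_real_affine[of _ "-1" 0]) (auto simp: ind)
    also have "\<dots> = (\<integral>\<^sup>+\<alpha>. indicator (- level t) (fst z) * (indicator (level t) (pt z \<alpha>) * indicator D' (pt z \<alpha>)
        * indicator {- (2 * pi)..0} \<alpha> * shrink_from t D z k \<alpha> (- (2 * pi)) 0) \<partial>lborel)"
      by (simp only: mult_ac)
    also have "\<dots> = indicator (- level t) (fst z) * (\<integral>\<^sup>+\<alpha>. indicator (level t) (pt z \<alpha>) * indicator D' (pt z \<alpha>)
        * indicator {- (2 * pi)..0} \<alpha> * shrink_from t D z k \<alpha> (- (2 * pi)) 0 \<partial>lborel)"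
      by (rule nn_integral_cmult) measurable
    finally show "(\<integral>\<^sup>+\<theta>. indicator (- level t) (fst z) * ?F z (- \<theta>) * indicator {0..2 * pi} \<theta> \<partial>lborel) = \<dots>" .
  qed
  finally show ?thesis .
qed

text \<open>Reversibility of the truncated kernel on the level set, used only for the pair
  \<open>D\<close>, \<open>UNIV\<close>, from which invariance follows. Runs that accept at once are
  covered by \<open>accepted_symmetric\<close>, the others ellipse by ellipse.\<close>

lemma level_emeasure_upto_symmetric:
  assumes D [measurable]: "D \<in> sets borel"
  shows "(\<integral>\<^sup>+x. indicator (level t) x * emeasure (shrink_ellipse_upto C (\<lambda>z. \<Phi> (proj z)) k x t) D \<partial>gaussian C)
    = (\<integral>\<^sup>+x. indicator (level t) x * indicator D x * emeasure (shrink_ellipse_upto C (\<lambda>z. \<Phi> (proj z)) k x t) UNIV \<partial>gaussian C)"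
proof (cases k)
  case 0
  then show ?thesis by (simp add: emeasure_shrink_ellipse_upto_0)
next
  case (Suc j)
  have "(\<integral>\<^sup>+\<theta>. accepted t UNIV D \<theta> * indicator {0..2 * pi} \<theta> \<partial>lborel) = (\<integral>\<^sup>+\<theta>. accepted t D UNIV \<theta> * indicator {0..2 * pi} \<theta> \<partial>lborel)"
    by (intro nn_integral_cong_AE eventually_mono[OF AE_sin_nonzero]) (simp add: accepted_symmetric[of D UNIV])
  moreover have "(\<integral>\<^sup>+\<theta>. rejected t UNIV D j \<theta> * indicator {0..2 * pi} \<theta> \<partial>lborel) = (\<integral>\<^sup>+\<theta>. rejected t D UNIV j \<theta> * indicator {0..2 * pi} \<theta> \<partial>lborel)"
  proof -
    have "(\<integral>\<^sup>+\<alpha>. indicator (level t) (pt z \<alpha>) * indicator UNIV (pt z \<alpha>) * indicator {- (2 * pi)..0} \<alpha> * shrink_from t D z j \<alpha> (- (2 * pi)) 0 \<partial>lborel)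
       = (\<integral>\<^sup>+\<alpha>. indicator (level t) (pt z \<alpha>) * indicator D (pt z \<alpha>) * indicator {- (2 * pi)..0} \<alpha> * shrink_from t UNIV z j \<alpha> (- (2 * pi)) 0 \<partial>lborel)" for z
    proof -
      have "indicator {\<alpha>. pt z \<alpha> \<in> level t} \<alpha> = (indicator (level t) (pt z \<alpha>) :: ennreal)" for \<alpha>
        by (simp add: indicator_def)
      then show ?thesis
        using shrink_int_symmetric[of "\<lambda>\<theta>. pt z \<theta> \<in> level t" "\<lambda>\<theta>. indicator D (pt z \<theta>)" "- (2 * pi)" 0 j]
        by (simp add: shrink_from_def)
    qed
    moreover have U: "UNIV \<in> sets (borel :: (real ^ 'n) measure)" by simp
    ultimately show ?thesis by (simp only: rejected_average[OF D U] rejected_average[OF U D])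
  qed
  ultimately show ?thesis
    using level_emeasure_upto_Suc[of D UNIV t j] level_emeasure_upto_Suc[of UNIV D t j] unfolding Suc by simp
qed

text \<open>In the limit, the terminating runs that output into \<open>D\<close> have the same mass
  as those that start in \<open>D\<close>. The mass left at the starting point complements the
  latter to 1.\<close>

lemma level_shrink_ellipse_invariant:
  assumes D [measurable]: "D \<in> sets borel"
  shows "(\<integral>\<^sup>+x. indicator (level t) x * emeasure (shrink_ellipse C (\<lambda>z. \<Phi> (proj z)) x t) D \<partial>gaussian C)
    = (\<integral>\<^sup>+x. indicator (level t) x * indicator D x \<partial>gaussian C)"
proof -
  have G: "(\<lambda>z. \<Phi> (proj z)) \<in> borel_measurable borel" by measurable
  let ?e = "\<lambda>k x D. emeasure (shrink_ellipse_upto C (\<lambda>z. \<Phi> (proj z)) k x t) D"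
  let ?l = "\<lambda>x. indicator (level t) x :: ennreal"
  have m [measurable]: "(\<lambda>x. ?e k x A) \<in> borel_measurable borel" if "A \<in> sets borel" for k A
    by (rule measurable_emeasure_kernel[OF measurable_shrink_ellipse_upto[OF G] that]) measurable
  have mono: "incseq (\<lambda>k x. g x * ?e k x A)" if "A \<in> sets borel" for A and g :: "real ^ 'n \<Rightarrow> ennreal"
    using incseq_shrink_ellipse_upto[OF G that] by (intro incseq_SucI le_funI mult_left_mono) (auto dest: incseq_SucD)
  have mct: "(\<integral>\<^sup>+x. g x * (SUP k. ?e k x A) \<partial>gaussian C) = (SUP k. \<integral>\<^sup>+x. g x * ?e k x A \<partial>gaussian C)"
    if [measurable]: "A \<in> sets borel" "g \<in> borel_measurable borel" for A g
    unfolding SUP_mult_left_ennreal by (rule nn_integral_monotone_convergence_SUP[OF mono]) measurable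
  have le1: "(SUP k. ?e k x UNIV) \<le> 1" for x
    by (intro SUP_least emeasure_shrink_ellipse_upto_le_1[OF G])
  have "(\<integral>\<^sup>+x. ?l x * emeasure (shrink_ellipse C (\<lambda>z. \<Phi> (proj z)) x t) D \<partial>gaussian C)
     = (\<integral>\<^sup>+x. ?l x * (SUP k. ?e k x D) + ?l x * indicator D x * (1 - (SUP k. ?e k x UNIV)) \<partial>gaussian C)"
    by (simp add: emeasure_shrink_ellipse[OF G D] distrib_left mult_ac)
  also have "\<dots> = (\<integral>\<^sup>+x. ?l x * (SUP k. ?e k x D) \<partial>gaussian C) + (\<integral>\<^sup>+x. ?l x * indicator D x * (1 - (SUP k. ?e k x UNIV)) \<partial>gaussian C)"
    by (rule nn_integral_add) measurable
  also have "(\<integral>\<^sup>+x. ?l x * (SUP k. ?e k x D) \<partial>gaussian C) = (\<integral>\<^sup>+x. ?l x * indicator D x * (SUP k. ?e k x UNIV) \<partial>gaussian C)"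
    by (simp add: mct level_emeasure_upto_symmetric[OF D])
  also have "\<dots> + (\<integral>\<^sup>+x. ?l x * indicator D x * (1 - (SUP k. ?e k x UNIV)) \<partial>gaussian C)
      = (\<integral>\<^sup>+x. ?l x * indicator D x * (SUP k. ?e k x UNIV) + ?l x * indicator D x * (1 - (SUP k. ?e k x UNIV)) \<partial>gaussian C)"
    by (rule nn_integral_add[symmetric]) measurable
  also have "\<dots> = (\<integral>\<^sup>+x. ?l x * indicator D x \<partial>gaussian C)"
    using le1 by (intro nn_integral_cong) (simp only: distrib_left[symmetric] add_diff_inverse_ennreal mult_1_right)
  finally show ?thesis .
qed

end

section \<open>Uniform ergodicity of the ESS kernel\<close>

context angular_target begin

abbreviation ellipse_kernel :: "real ^ 'n \<Rightarrow> real \<Rightarrow> (real ^ 'n) measure" where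
  "ellipse_kernel \<equiv> shrink_ellipse C (\<lambda>z. \<Phi> (proj z))"

lemma measurable_Phi_proj: "(\<lambda>z. \<Phi> (proj z)) \<in> borel_measurable borel"
  by measurable

lemma measurable_reproject:
  assumes "x \<in> borel_measurable M" "t \<in> borel_measurable M"
  shows "(\<lambda>p. ellipse_kernel (x p) (t p) \<bind> (\<lambda>y. return sphere_borel (proj y))) \<in> M \<rightarrow>\<^sub>M prob_algebra sphere_borel"
proof (rule measurable_bind_prob_space2[where N = borel])
  show "(\<lambda>p. ellipse_kernel (x p) (t p)) \<in> M \<rightarrow>\<^sub>M prob_algebra borel"
    by (rule measurable_shrink_ellipse[OF measurable_Phi_proj assms])
  show "(\<lambda>(p, y). return sphere_borel (proj y)) \<in> M \<Otimes>\<^sub>M borel \<rightarrow>\<^sub>M prob_algebra sphere_borel"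
    unfolding split_beta' by (rule measurable_compose[OF _ measurable_return_prob_space]) measurable
qed

lemma emeasure_reproject:
  assumes A [measurable]: "A \<in> sets sphere_borel"
  shows "emeasure (ellipse_kernel x t \<bind> (\<lambda>y. return sphere_borel (proj y))) A = emeasure (ellipse_kernel x t) (proj -` A)"
proof -
  note sets = sets_shrink_ellipse[OF measurable_Phi_proj, of x t]
  have D: "proj -` A \<in> sets borel" using measurable_sets[OF measurable_proj_sphere A] by simp
  have "emeasure (ellipse_kernel x t \<bind> (\<lambda>y. return sphere_borel (proj y))) A
      = (\<integral>\<^sup>+y. emeasure (return sphere_borel (proj y)) A \<partial>ellipse_kernel x t)"
  proof (rule emeasure_bind[OF _ _ A])
    show "space (ellipse_kernel x t) \<noteq> {}" using sets_eq_imp_space_eq[OF sets] by simp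
    have "(\<lambda>y. return sphere_borel (proj y)) \<in> borel \<rightarrow>\<^sub>M subprob_algebra sphere_borel"
      by (rule measurable_compose[OF _ return_measurable]) measurable
    then show "(\<lambda>y. return sphere_borel (proj y)) \<in> ellipse_kernel x t \<rightarrow>\<^sub>M subprob_algebra sphere_borel"
      using sets measurable_cong_sets by blast
  qed
  also have "\<dots> = (\<integral>\<^sup>+y. indicator (proj -` A) y \<partial>ellipse_kernel x t)"
    by (intro nn_integral_cong) (simp add: indicator_def)
  also have "\<dots> = emeasure (ellipse_kernel x t) (proj -` A)"
    using D sets by (intro nn_integral_indicator) simp
  finally show ?thesis .
qed

lemma measurable_uniform_dist_prob:
  assumes [measurable]: "b \<in> borel_measurable M" and "\<And>x. x \<in> space M \<Longrightarrow> 0 < b x"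
  shows "(\<lambda>x. uniform_dist 0 (b x)) \<in> M \<rightarrow>\<^sub>M prob_algebra borel"
  by (intro measurable_prob_algebraI measurable_uniform_dist prob_space_uniform_dist assms) measurable

lemma measurable_ess_kernel_radius:
  assumes f: "f \<in> M \<rightarrow>\<^sub>M sphere_borel" and t: "t \<in> borel_measurable M"
  shows "(\<lambda>p. radius_sq_dist C (f p) \<bind> (\<lambda>r2. ellipse_kernel (sqrt r2 *\<^sub>R f p) (t p) \<bind> (\<lambda>y. return sphere_borel (proj y))))
    \<in> M \<rightarrow>\<^sub>M prob_algebra sphere_borel"
proof (rule measurable_bind_prob_space2[where N = borel])
  show "(\<lambda>p. radius_sq_dist C (f p)) \<in> M \<rightarrow>\<^sub>M prob_algebra borel"
    by (rule measurable_compose[OF f measurable_radius_sq_dist])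
  have [measurable]: "f \<in> borel_measurable M" "t \<in> borel_measurable M"
    using measurable_compose[OF f measurable_sphere_borel_borel] t by auto
  show "(\<lambda>(p, r2). ellipse_kernel (sqrt r2 *\<^sub>R f p) (t p) \<bind> (\<lambda>y. return sphere_borel (proj y))) \<in> M \<Otimes>\<^sub>M borel \<rightarrow>\<^sub>M prob_algebra sphere_borel"
    unfolding split_beta' by (rule measurable_reproject) measurable
qed

lemma measurable_ess_kernel: "ess_kernel zbar C \<Phi> \<in> sphere_borel \<rightarrow>\<^sub>M prob_algebra sphere_borel"
  unfolding ess_kernel_def[abs_def] Let_def
proof (rule measurable_bind_prob_space2[where N = borel])
  show "(\<lambda>x. uniform_dist 0 (exp (- \<Phi> x))) \<in> sphere_borel \<rightarrow>\<^sub>M prob_algebra borel"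
    by (rule measurable_uniform_dist_prob) auto
  show "(\<lambda>(x, t). radius_sq_dist C x \<bind> (\<lambda>r2. ellipse_kernel (sqrt r2 *\<^sub>R x) t \<bind> (\<lambda>y. return sphere_borel (proj y))))
    \<in> sphere_borel \<Otimes>\<^sub>M borel \<rightarrow>\<^sub>M prob_algebra sphere_borel"
    unfolding split_beta' by (intro measurable_ess_kernel_radius measurable_fst measurable_snd)
qed

definition ess_step :: "(real ^ 'n) set \<Rightarrow> real ^ 'n \<Rightarrow> ennreal" where
  "ess_step A x = (\<integral>\<^sup>+t. emeasure (ellipse_kernel x t) (proj -` A) * indicator {0..\<psi> x} t \<partial>lborel) / ennreal (\<psi> x)"

lemma measurable_emeasure_ellipse_kernel [measurable (raw)]:
  assumes A: "A \<in> sets sphere_borel" and "x \<in> borel_measurable M" "t \<in> borel_measurable M"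
  shows "(\<lambda>p. emeasure (ellipse_kernel (x p) (t p)) (proj -` A)) \<in> borel_measurable M"
proof -
  have "proj -` A \<in> sets borel" using measurable_sets[OF measurable_proj_sphere A] by simp
  then show ?thesis
    by (rule measurable_emeasure_kernel[OF measurable_prob_algebraD[OF measurable_shrink_ellipse[OF measurable_Phi_proj assms(2,3)]]])
qed

lemma measurable_ess_step [measurable]:
  assumes [measurable]: "A \<in> sets sphere_borel"
  shows "ess_step A \<in> borel_measurable borel"
proof -
  have "(\<lambda>x. (\<integral>\<^sup>+t. emeasure (ellipse_kernel x t) (proj -` A) * (if 0 \<le> t \<and> t \<le> \<psi> x then 1 else 0) \<partial>lborel) / ennreal (\<psi> x)) \<in> borel_measurable borel"
    by measurable
  then show ?thesis by (simp add: ess_step_def[abs_def] indicator_def of_bool_def)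
qed

text \<open>The kernel draws the level before the radius, while the full-space step needs the
  opposite order. The draws can be exchanged because the law of the level depends only on the
  direction.\<close>

lemma emeasure_ess_kernel:
  assumes x: "x \<in> sphere 0 1" and A [measurable]: "A \<in> sets sphere_borel"
  shows "emeasure (ess_kernel zbar C \<Phi> x) A = (\<integral>\<^sup>+r2. ess_step A (sqrt r2 *\<^sub>R x) \<partial>radius_sq_dist C x)"
proof -
  let ?U = "uniform_dist 0 (exp (- \<Phi> x))" and ?R = "radius_sq_dist C x"
  have xs: "x \<in> space sphere_borel" using x by (simp add: space_sphere_borel)
  then have xm: "(\<lambda>_. x) \<in> M \<rightarrow>\<^sub>M sphere_borel" for M :: "'x measure" by simp
  have n: "norm x = 1" using x by simp
  interpret U: prob_space ?U by (rule prob_space_uniform_dist) simp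
  interpret R: prob_space ?R
    using measurable_space[OF measurable_radius_sq_dist xs] by (simp add: space_prob_algebra)
  interpret UR: pair_prob_space ?U ?R ..
  have "emeasure (ess_kernel zbar C \<Phi> x) A = (\<integral>\<^sup>+t. emeasure (?R \<bind> (\<lambda>r2. ellipse_kernel (sqrt r2 *\<^sub>R x) t \<bind> (\<lambda>y. return sphere_borel (proj y)))) A \<partial>?U)"
    unfolding ess_kernel_def Let_def
    by (intro emeasure_bind[OF _ measurable_prob_algebraD[OF measurable_ess_kernel_radius[OF xm]] A]) auto
  also have "\<dots> = (\<integral>\<^sup>+t. \<integral>\<^sup>+r2. emeasure (ellipse_kernel (sqrt r2 *\<^sub>R x) t) (proj -` A) \<partial>?R \<partial>?U)"
  proof (rule nn_integral_cong)
    fix t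
    have "emeasure (?R \<bind> (\<lambda>r2. ellipse_kernel (sqrt r2 *\<^sub>R x) t \<bind> (\<lambda>y. return sphere_borel (proj y)))) A
       = (\<integral>\<^sup>+r2. emeasure (ellipse_kernel (sqrt r2 *\<^sub>R x) t \<bind> (\<lambda>y. return sphere_borel (proj y))) A \<partial>?R)"
      by (intro emeasure_bind[OF _ measurable_prob_algebraD[OF measurable_reproject] A]) auto
    then show "emeasure (?R \<bind> (\<lambda>r2. ellipse_kernel (sqrt r2 *\<^sub>R x) t \<bind> (\<lambda>y. return sphere_borel (proj y)))) A
       = (\<integral>\<^sup>+r2. emeasure (ellipse_kernel (sqrt r2 *\<^sub>R x) t) (proj -` A) \<partial>?R)"
      by (simp only: emeasure_reproject[OF A])
  qed
  also have "\<dots> = (\<integral>\<^sup>+r2. \<integral>\<^sup>+t. emeasure (ellipse_kernel (sqrt r2 *\<^sub>R x) t) (proj -` A) \<partial>?U \<partial>?R)"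
    by (rule UR.Fubini'[symmetric]) measurable
  also have "\<dots> = (\<integral>\<^sup>+r2. ess_step A (sqrt r2 *\<^sub>R x) \<partial>?R)"
  proof (intro nn_integral_cong_AE eventually_mono[OF AE_radius_pos])
    fix r2 :: real assume "r2 > 0"
    then have "\<psi> (sqrt r2 *\<^sub>R x) = exp (- \<Phi> x)" using n by (simp add: \<psi>_def proj_scaleR proj_sphere)
    then show "(\<integral>\<^sup>+t. emeasure (ellipse_kernel (sqrt r2 *\<^sub>R x) t) (proj -` A) \<partial>?U) = ess_step A (sqrt r2 *\<^sub>R x)"
      by (subst nn_integral_uniform_dist) (auto simp: ess_step_def)
  qed
  finally show ?thesis .
qed

text \<open>The weight \<open>\<psi> x\<close> cancels the normalisation of the level, so
  \<open>t\<close> runs over the region below the graph of \<open>\<psi>\<close>. Fubini fixes the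
  level instead of the point, and each level set is covered by
  \<open>level_shrink_ellipse_invariant\<close>.\<close>

lemma ess_step_invariant:
  assumes A [measurable]: "A \<in> sets sphere_borel"
  shows "(\<integral>\<^sup>+x. ennreal (\<psi> x) * ess_step A x \<partial>gaussian C) = (\<integral>\<^sup>+x. ennreal (\<psi> x) * indicator A (proj x) \<partial>gaussian C)"
proof -
  interpret prob_space "gaussian C" by (rule prob_space_gaussian)
  interpret L: pair_sigma_finite "gaussian C" "lborel :: real measure" ..
  let ?D = "proj -` A"
  have D [measurable]: "?D \<in> sets borel" using measurable_sets[OF measurable_proj_sphere A] by simp
  have ind: "indicator {0..\<psi> x} t = indicator {0..} t * (indicator (level t) x :: ennreal)" for x t
    by (auto simp: indicator_def level_def)
  have [measurable]: "(\<lambda>p. indicator (level (snd p)) (fst p) :: ennreal) \<in> borel_measurable (borel \<Otimes>\<^sub>M borel)"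
    unfolding level_def indicator_def by measurable
  have "(\<integral>\<^sup>+x. ennreal (\<psi> x) * ess_step A x \<partial>gaussian C)
      = (\<integral>\<^sup>+x. \<integral>\<^sup>+t. indicator {0..} t * (indicator (level t) x * emeasure (ellipse_kernel x t) ?D) \<partial>lborel \<partial>gaussian C)"
  proof (rule nn_integral_cong)
    fix x
    have "ennreal (\<psi> x) * ess_step A x = (\<integral>\<^sup>+t. emeasure (ellipse_kernel x t) ?D * indicator {0..\<psi> x} t \<partial>lborel)"
      unfolding ess_step_def using psi_pos[of x]
      by (simp add: ennreal_times_divide mult_divide_eq_ennreal mult.commute[of "ennreal (\<psi> x)"])
    then show "ennreal (\<psi> x) * ess_step A x = (\<integral>\<^sup>+t. indicator {0..} t * (indicator (level t) x * emeasure (ellipse_kernel x t) ?D) \<partial>lborel)"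
      by (simp only: ind mult_ac)
  qed
  also have "\<dots> = (\<integral>\<^sup>+t. \<integral>\<^sup>+x. indicator {0..} t * (indicator (level t) x * emeasure (ellipse_kernel x t) ?D) \<partial>gaussian C \<partial>lborel)"
    by (rule L.Fubini'[symmetric]) measurable
  also have "\<dots> = (\<integral>\<^sup>+t. \<integral>\<^sup>+x. indicator {0..} t * (indicator (level t) x * indicator ?D x) \<partial>gaussian C \<partial>lborel)"
  proof (rule nn_integral_cong)
    fix t :: real
    have "(\<integral>\<^sup>+x. indicator {0..} t * (indicator (level t) x * emeasure (ellipse_kernel x t) ?D) \<partial>gaussian C)
       = indicator {0..} t * (\<integral>\<^sup>+x. indicator (level t) x * emeasure (ellipse_kernel x t) ?D \<partial>gaussian C)"
      by (rule nn_integral_cmult) measurable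
    also have "\<dots> = indicator {0..} t * (\<integral>\<^sup>+x. indicator (level t) x * indicator ?D x \<partial>gaussian C)"
      by (simp only: level_shrink_ellipse_invariant[OF D])
    also have "\<dots> = (\<integral>\<^sup>+x. indicator {0..} t * (indicator (level t) x * indicator ?D x) \<partial>gaussian C)"
      by (rule nn_integral_cmult[symmetric]) measurable
    finally show "(\<integral>\<^sup>+x. indicator {0..} t * (indicator (level t) x * emeasure (ellipse_kernel x t) ?D) \<partial>gaussian C) = \<dots>" .
  qed
  also have "\<dots> = (\<integral>\<^sup>+x. \<integral>\<^sup>+t. indicator {0..} t * (indicator (level t) x * indicator ?D x) \<partial>lborel \<partial>gaussian C)"
    by (rule L.Fubini') measurable
  also have "\<dots> = (\<integral>\<^sup>+x. ennreal (\<psi> x) * indicator A (proj x) \<partial>gaussian C)"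
  proof (rule nn_integral_cong)
    fix x
    have "(\<integral>\<^sup>+t. indicator {0..} t * (indicator (level t) x * indicator ?D x) \<partial>lborel)
      = (\<integral>\<^sup>+t. indicator {0..\<psi> x} t * indicator ?D x \<partial>lborel)"
      by (simp only: ind mult.assoc)
    also have "\<dots> = ennreal (\<psi> x) * indicator A (proj x)"
      using psi_pos[of x] by (subst nn_integral_multc) (auto simp: indicator_def)
    finally show "(\<integral>\<^sup>+t. indicator {0..} t * (indicator (level t) x * indicator ?D x) \<partial>lborel) = ennreal (\<psi> x) * indicator A (proj x)" .
  qed
  finally show ?thesis .
qed

text \<open>A level \<open>t \<le> exp (- B)\<close> accepts the first proposal.\<close>

lemma ess_step_ge:
  assumes A [measurable]: "A \<in> sets sphere_borel"
  shows "ennreal (exp (- 2 * B)) * (\<integral>\<^sup>+w. \<integral>\<^sup>+\<theta>. indicator A (proj (ellipse_point x w \<theta>)) \<partial>uniform_dist 0 (2 * pi) \<partial>gaussian C) \<le> ess_step A x"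
proof -
  let ?D = "proj -` A"
  let ?m = "\<integral>\<^sup>+w. \<integral>\<^sup>+\<theta>. indicator A (proj (ellipse_point x w \<theta>)) \<partial>uniform_dist 0 (2 * pi) \<partial>gaussian C"
  have D [measurable]: "?D \<in> sets borel" using measurable_sets[OF measurable_proj_sphere A] by simp
  \<comment> \<open>The law cut off after a single test lies below the full law, and at such a level
    this test always succeeds.\<close>
  have first: "?m \<le> emeasure (ellipse_kernel x t) ?D" if "t \<le> exp (- B)" for t
  proof -
    have "t \<le> \<psi> y" for y using that psi_bounds(1)[of y] by simp
    then have "?m = emeasure (shrink_ellipse_upto C (\<lambda>z. \<Phi> (proj z)) (Suc 0) x t) ?D"
      unfolding emeasure_shrink_ellipse_upto_Suc[OF measurable_Phi_proj D]
      by (intro nn_integral_cong) (simp add: \<psi>_def indicator_def)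
    also have "\<dots> \<le> (SUP k. emeasure (shrink_ellipse_upto C (\<lambda>z. \<Phi> (proj z)) k x t) ?D)"
      by (rule SUP_upper) simp
    also have "\<dots> \<le> emeasure (ellipse_kernel x t) ?D"
      unfolding emeasure_shrink_ellipse[OF measurable_Phi_proj D] by simp
    finally show ?thesis .
  qed
  \<comment> \<open>A uniform level on \<open>[0, \<psi> x]\<close> falls below
    \<open>exp (- B)\<close> with probability \<open>exp (- B) / \<psi> x\<close>, hence at least
    \<open>exp (- 2 * B)\<close>.\<close>
  have "exp (- 2 * B) * \<psi> x \<le> exp (- B)"
  proof -
    have "exp (- 2 * B) * \<psi> x \<le> exp (- 2 * B) * exp B" using psi_bounds by simp
    then show ?thesis by (simp flip: exp_add)
  qed
  then have "exp (- 2 * B) \<le> exp (- B) / \<psi> x" using psi_pos[of x] by (simp add: field_simps)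
  then have "ennreal (exp (- 2 * B)) * ?m \<le> ennreal (exp (- B) / \<psi> x) * ?m"
    by (intro mult_right_mono ennreal_leI) auto
  also have "\<dots> = ?m * ennreal (exp (- B)) / ennreal (\<psi> x)"
    using psi_pos[of x] by (simp add: divide_ennreal[symmetric] divide_ennreal_def mult_ac)
  also have "?m * ennreal (exp (- B)) = (\<integral>\<^sup>+t. ?m * indicator {0..exp (- B)} t \<partial>lborel)"
    by (simp add: nn_integral_cmult)
  also have "\<dots> / ennreal (\<psi> x) \<le> ess_step A x"
    unfolding ess_step_def
  proof (intro divide_right_mono_ennreal nn_integral_mono)
    fix t
    show "?m * indicator {0..exp (- B)} t \<le> emeasure (ellipse_kernel x t) ?D * indicator {0..\<psi> x} t"
      using first[of t] psi_bounds(1)[of x] by (auto simp: indicator_def)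
  qed
  finally show ?thesis .
qed

text \<open>After the first proposal has been accepted through a low level, Fubini puts the angle
  outside. At a fixed angle the proposal is an affine Gaussian with coefficients
  \<open>cos \<theta>\<close> and \<open>sin \<theta>\<close>, so the radial minorization
  applies.\<close>

lemma uniformly_ergodic_ess:
  "uniformly_ergodic sphere_borel (ess_kernel zbar C \<Phi>) (target zbar C \<Phi>)"
proof (rule uniformly_ergodic_if_minorized[OF measurable_ess_kernel])
  let ?U = "uniform_dist 0 (2 * pi)"
  \<comment> \<open>For angles in \<open>[pi / 4, pi / 2]\<close> the cotangent is at most 1, so
    \<open>2 * (1 + 2 * (cos \<theta> / sin \<theta>)\<^sup>2)\<close> is at most 6. This range is
    one eighth of the turn, which explains \<open>\<delta> / 8\<close>.\<close>
  define \<delta> :: real where "\<delta> = 6 powr (- real CARD('n) / 2)"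
  show "exp (- 2 * B) * (\<delta> / 8) > 0" by (simp add: \<delta>_def)
  show "(\<integral>\<^sup>+x. emeasure (ess_kernel zbar C \<Phi> x) A \<partial>target zbar C \<Phi>) = emeasure (target zbar C \<Phi>) A"
    if [measurable]: "A \<in> sets sphere_borel" for A
    by (rule target_invariant_reprojected[OF that measurable_ess_kernel measurable_ess_step[OF that]])
       (use that in \<open>auto intro: emeasure_ess_kernel ess_step_invariant\<close>)
  show "ennreal (exp (- 2 * B) * (\<delta> / 8)) * emeasure (ACG zbar C) A \<le> emeasure (ess_kernel zbar C \<Phi> x) A"
    if x: "x \<in> sphere 0 1" and A [measurable]: "A \<in> sets sphere_borel" for x A
  proof -
    let ?R = "radius_sq_dist C x"
    let ?f = "\<lambda>r2 w \<theta>. indicator A (proj (ellipse_point (sqrt r2 *\<^sub>R x) w \<theta>)) :: ennreal"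
    interpret U: prob_space ?U by (rule prob_space_uniform_dist) simp
    interpret R: prob_space ?R
      using measurable_space[OF measurable_radius_sq_dist, of x] x by (simp add: space_prob_algebra space_sphere_borel)
    interpret G: prob_space "gaussian C" by (rule prob_space_gaussian)
    interpret GU: pair_prob_space "gaussian C" ?U ..
    interpret RU: pair_prob_space ?R ?U ..
    have step: "ennreal \<delta> * emeasure (ACG zbar C) A \<le> (\<integral>\<^sup>+r2. \<integral>\<^sup>+w. ?f r2 w \<theta> \<partial>gaussian C \<partial>?R)"
      if th: "\<theta> \<in> {pi / 4..pi / 2}" for \<theta>
    proof -
      have s: "sin \<theta> \<ge> cos \<theta>" "cos \<theta> \<ge> 0" "sin \<theta> > 0"
      proof -
        have "sin (pi / 4) \<le> sin \<theta>" using th by (intro sin_monotone_2pi_le) auto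
        moreover have "cos \<theta> \<le> cos (pi / 4)" using th by (intro cos_monotone_0_pi_le) auto
        ultimately show "sin \<theta> \<ge> cos \<theta>" by (simp add: sin_45 cos_45)
        show "cos \<theta> \<ge> 0" using th by (intro cos_ge_zero) auto
        show "sin \<theta> > 0" using th pi_gt_zero by (intro sin_gt_zero) (auto simp del: pi_gt_zero)
      qed
      then have "0 \<le> cos \<theta> / sin \<theta>" "cos \<theta> / sin \<theta> \<le> 1" by (auto simp: divide_simps)
      then have "(cos \<theta> / sin \<theta>)\<^sup>2 \<le> 1" by (rule power_le_one)
      then have "\<delta> \<le> (2 * (1 + 2 * (cos \<theta> / sin \<theta>)\<^sup>2)) powr (- real CARD('n) / 2)"
        unfolding \<delta>_def by (intro powr_mono2') (auto simp: add_pos_nonneg)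
      then have "ennreal \<delta> * emeasure (ACG zbar C) A
          \<le> ennreal ((2 * (1 + 2 * (cos \<theta> / sin \<theta>)\<^sup>2)) powr (- real CARD('n) / 2)) * emeasure (ACG zbar C) A"
        by (intro mult_right_mono ennreal_leI) auto
      also have "\<dots> \<le> (\<integral>\<^sup>+r2. \<integral>\<^sup>+w. ?f r2 w \<theta> \<partial>gaussian C \<partial>?R)"
        unfolding ellipse_point_def by (rule radius_gaussian_affine_ge[OF x A s(3)])
      finally show ?thesis .
    qed
    have eighth: "emeasure ?U {pi / 4..pi / 2} = ennreal (1 / 8)"
    proof -
      have "{0..2 * pi} \<inter> {pi / 4..pi / 2} = {pi / 4..pi / 2}" using pi_gt_zero by auto
      then show ?thesis by (simp add: emeasure_lborel_Icc_real divide_ennreal field_simps)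
    qed
    have "ennreal (exp (- 2 * B) * (\<delta> / 8)) * emeasure (ACG zbar C) A
        = ennreal (exp (- 2 * B)) * (ennreal \<delta> * emeasure (ACG zbar C) A * emeasure ?U {pi / 4..pi / 2})"
    proof -
      have "exp (- 2 * B) * (\<delta> / 8) = exp (- 2 * B) * (\<delta> * (1 / 8))" by simp
      moreover have "0 \<le> \<delta>" by (simp add: \<delta>_def)
      ultimately show ?thesis by (simp only: eighth ennreal_mult exp_ge_zero mult_nonneg_nonneg) (simp add: ennreal_mult mult_ac)
    qed
    also have "ennreal \<delta> * emeasure (ACG zbar C) A * emeasure ?U {pi / 4..pi / 2}
        = (\<integral>\<^sup>+\<theta>. ennreal \<delta> * emeasure (ACG zbar C) A * indicator {pi / 4..pi / 2} \<theta> \<partial>?U)"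
      by (subst nn_integral_cmult) auto
    also have "\<dots> \<le> (\<integral>\<^sup>+\<theta>. \<integral>\<^sup>+r2. \<integral>\<^sup>+w. ?f r2 w \<theta> \<partial>gaussian C \<partial>?R \<partial>?U)"
      using step by (intro nn_integral_mono) (auto simp: indicator_def)
    also have "\<dots> = (\<integral>\<^sup>+r2. \<integral>\<^sup>+\<theta>. \<integral>\<^sup>+w. ?f r2 w \<theta> \<partial>gaussian C \<partial>?U \<partial>?R)"
      by (rule RU.Fubini') measurable
    also have "\<dots> = (\<integral>\<^sup>+r2. \<integral>\<^sup>+w. \<integral>\<^sup>+\<theta>. ?f r2 w \<theta> \<partial>?U \<partial>gaussian C \<partial>?R)"
      by (intro nn_integral_cong GU.Fubini') measurable
    also have "ennreal (exp (- 2 * B)) * \<dots> = (\<integral>\<^sup>+r2. ennreal (exp (- 2 * B)) * (\<integral>\<^sup>+w. \<integral>\<^sup>+\<theta>. ?f r2 w \<theta> \<partial>?U \<partial>gaussian C) \<partial>?R)"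
      by (rule nn_integral_cmult[symmetric]) measurable
    also have "\<dots> \<le> (\<integral>\<^sup>+r2. ess_step A (sqrt r2 *\<^sub>R x) \<partial>?R)"
      by (intro nn_integral_mono ess_step_ge A)
    also have "\<dots> = emeasure (ess_kernel zbar C \<Phi> x) A"
      by (rule emeasure_ess_kernel[OF x A, symmetric])
    finally show ?thesis by (simp add: mult_left_mono)
  qed
qed

end

theorem theorem3p7:
  fixes C :: "real ^ 'n ^ 'n" and \<Phi> :: "real ^ 'n \<Rightarrow> real" and zbar :: "real ^ 'n"
  assumes "sym_pos_def C"
    and "zbar \<in> sphere 0 1"
    and "\<Phi> \<in> borel_measurable sphere_borel"
    and "bounded (\<Phi> ` sphere 0 1)"
  shows "(\<forall>s \<in> {0<..1}. uniformly_ergodic sphere_borel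
            (pcn_kernel zbar C \<Phi> s) (target zbar C \<Phi>))
       \<and> uniformly_ergodic sphere_borel (ess_kernel zbar C \<Phi>) (target zbar C \<Phi>)"
proof -
  obtain B where B: "\<And>x. norm x = 1 \<Longrightarrow> \<bar>\<Phi> x\<bar> \<le> B"
    using assms(4) unfolding bounded_iff by (metis dist_0_norm image_eqI mem_sphere real_norm_def)
  interpret angular_target C zbar \<Phi> B
    by unfold_locales (use assms B in auto)
  show ?thesis using uniformly_ergodic_pcn uniformly_ergodic_ess by blast
qed

end
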